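(* Let $k$ be a field and let $A=kQ/I$ be a monomial algebra. Then for every $n\ge 0$, $HH_n(A)\cong\bigoplus_Z HH_n(Z)$ and $HC_n(A)\cong\bigoplus_Z HC_n(Z)$, where the index $Z$ runs through all minimal cycle algebras overlying $A$.
   Context: $HH_n$ and $HC_n$ denote the $n$-th Hochschild homology and $n$-th cyclic homology over $k$ (as in Loday's book "Cyclic Homology"); $HH_n(A)=\mathrm{Tor}_n^{A^e}(A,A)$ with $A^e=A\otimes_kA^{op}$. A monomial algebra is an algebra $A=kQ/I$ with $Q$ a finite quiver and $I$ an admissible ideal of the path algebra $kQ$ (i.e. $J^m\subseteq I\subseteq J^2$ for some $m \geq 2$, where $J$ is the ideal generated by the arrows) generated by some paths of length $\ge 2$. For an arrow $a$ let $s(a)$, $e(a)$ be its starting and ending points. A cycle of length $n\geq 1$ in $Q$ is a path $a_1\cdots a_n$ of arrows with $e(a_i)=s(a_{i+1})$ for $1\le i\le n-1$ and $e(a_n)=s(a_1)$. A cycle is proper if it is not a power (with exponent $\ge 2$) of any cycle. Given a cycle $C'=a_1\cdots a_n$ in $Q$, let $C$ be the basic cycle quiver with $n$ vertices (vertices $1,\dots,n$ in cyclic order and one arrow $c_i:i\to i+1$ for each $i$ modulo $n$), with the natural quiver morphism $C\to C'\to Q$, $c_i\mapsto a_i$. Relations on $C$ are defined by pulling back those of $Q$: a path in $C$ is a relation (is zero) if and only if its image in $Q$ is a relation (is zero in $A$). The algebra $Z$ given by the quiver $C$ with these relations is called a cycle algebra overlying $A$. It is minimal if it is not a covering of a smaller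 cycle algebra overlying $A$; the minimal cycle algebras overlying $A$ are exactly the cycle algebras constructed from proper cycles in $Q$, and they are indexed by the orbits of proper cycles under cyclic rotation $a_1\cdots a_{q-1}a_q\mapsto a_qa_1\cdots a_{q-1}$.
   Formalization: As stated it fails for HH_0 and even HC_n (one vertex, no arrows: A=k, no cycles). Proved: HH_n for n≥1, HC_n for n odd as stated; and for all n≥0 both isomorphisms with HH_n, HC_n replaced on each side by the cokernel of the map from the homology of the span of the trivial paths. *)

theory Defs
  imports
    "HOL-Library.Poly_Mapping"
    "HOL-Algebra.Ideal_Product"
    "HOL-Algebra.QuotRing"
    "HOL-Algebra.Module"
    "Graph_Theory.Arc_Walk"
begin

text \<open>
  The ground field is a type \<^typ>\<open>'k::field\<close>. A \<open>k\<close>-algebra is a record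
  \<^typ>\<open>('k, 'a) module\<close> of HOL-Algebra; a \<open>k\<close>-vector space is such a record whose
  \<open>mult\<close> and \<open>one\<close> are irrelevant.
\<close>

section \<open>Vector spaces\<close>

definition pm_scale :: "'k::field \<Rightarrow> ('b \<Rightarrow>\<^sub>0 'k) \<Rightarrow> ('b \<Rightarrow>\<^sub>0 'k)" where
  "pm_scale c x = Poly_Mapping.map (\<lambda>y. c * y) x"

definition lin_ext :: "('b \<Rightarrow> ('c \<Rightarrow>\<^sub>0 'k::field)) \<Rightarrow> ('b \<Rightarrow>\<^sub>0 'k) \<Rightarrow> ('c \<Rightarrow>\<^sub>0 'k)" where
  "lin_ext f x = (\<Sum>l\<in>Poly_Mapping.keys x. pm_scale (Poly_Mapping.lookup x l) (f l))"

definition pm_space :: "('b \<Rightarrow>\<^sub>0 'k::field) set \<Rightarrow> ('k, 'b \<Rightarrow>\<^sub>0 'k) module" where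
  "pm_space V = \<lparr>carrier = V, mult = undefined, one = undefined,
                 zero = 0, add = (+), smult = pm_scale\<rparr>"

text \<open>
  The HOL-Algebra quotient ring, with the induced scalar multiplication. It serves for
  quotients of algebras by ideals and for quotients of vector spaces by subspaces.
\<close>
definition quot_module :: "('k, 'a) module \<Rightarrow> 'a set \<Rightarrow> ('k, 'a set) module" where
  "quot_module M W =
     ring.extend (M Quot W) (module.fields (\<lambda>c X. \<Union>x\<in>X. W +>\<^bsub>M\<^esub> (c \<odot>\<^bsub>M\<^esub> x)))"

definition direct_sum :: "'i set \<Rightarrow> ('i \<Rightarrow> ('k, 'a) module) \<Rightarrow> ('k, 'i \<Rightarrow> 'a) module" where
  "direct_sum T M =
     \<lparr>carrier = {f \<in> (\<Pi>\<^sub>E i\<in>T. carrier (M i)). finite {i \<in> T. f i \<noteq> \<zero>\<^bsub>M i\<^esub>}},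
      mult = undefined, one = undefined,
      zero = (\<lambda>i\<in>T. \<zero>\<^bsub>M i\<^esub>),
      add = (\<lambda>f g. \<lambda>i\<in>T. f i \<oplus>\<^bsub>M i\<^esub> g i),
      smult = (\<lambda>c f. \<lambda>i\<in>T. c \<odot>\<^bsub>M i\<^esub> f i)\<rparr>"

definition isomorphic_spaces ::
    "('k, 'a) module \<Rightarrow> ('k, 'b) module \<Rightarrow> bool"  (infix \<open>\<cong>\<^sub>k\<close> 50) where
  "M \<cong>\<^sub>k N \<longleftrightarrow> (\<exists>h. bij_betw h (carrier M) (carrier N)
     \<and> (\<forall>x\<in>carrier M. \<forall>y\<in>carrier M. h (x \<oplus>\<^bsub>M\<^esub> y) = h x \<oplus>\<^bsub>N\<^esub> h y)
     \<and> (\<forall>c. \<forall>x\<in>carrier M. h (c \<odot>\<^bsub>M\<^esub> x) = c \<odot>\<^bsub>N\<^esub> h x))"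


section \<open>Hochschild and cyclic homology\<close>

text \<open>
  The list \<open>[a\<^sub>0, \<dots>, a\<^sub>n]\<close> stands for the elementary tensor of its entries.
  The tensor power of degree \<open>n + 1\<close> over \<open>k\<close> of \<open>A\<close> is
  \<open>free_chains A {n + 1} / tensor_rel A {n + 1}\<close>, and for a set \<open>L\<close> of lengths
  \<open>free_chains A L / tensor_rel A L\<close> is the direct sum of the tensor powers
  of degrees in \<open>L\<close>.
\<close>
definition free_chains :: "('k::field, 'a) module \<Rightarrow> nat set \<Rightarrow> ('a list \<Rightarrow>\<^sub>0 'k) set" where
  "free_chains A L = {x. Poly_Mapping.keys x \<subseteq> {l. set l \<subseteq> carrier A \<and> length l \<in> L}}"

definition tensor_rel :: "('k::field, 'a) module \<Rightarrow> nat set \<Rightarrow> ('a list \<Rightarrow>\<^sub>0 'k) set" where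
  "tensor_rel A L = module.span pm_scale
     ({Poly_Mapping.single (us @ (x \<oplus>\<^bsub>A\<^esub> y) # vs) 1
         - Poly_Mapping.single (us @ x # vs) 1 - Poly_Mapping.single (us @ y # vs) 1 | us x y vs.
         set us \<subseteq> carrier A \<and> x \<in> carrier A \<and> y \<in> carrier A \<and> set vs \<subseteq> carrier A
         \<and> length us + 1 + length vs \<in> L}
      \<union> {Poly_Mapping.single (us @ (c \<odot>\<^bsub>A\<^esub> x) # vs) 1
           - Poly_Mapping.single (us @ x # vs) c | us c x vs.
         set us \<subseteq> carrier A \<and> x \<in> carrier A \<and> set vs \<subseteq> carrier A
         \<and> length us + 1 + length vs \<in> L})"

text \<open>
  Let \<open>d\<close> be operators on free chains that respect the multilinearity relations, so that
  they induce a differential on the quotient spaces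
  \<open>C n = free_chains A (L n) / tensor_rel A (L n)\<close>.
  The cycles and boundaries below are the preimages in \<open>free_chains A (L n)\<close> of
  those of \<open>C\<close>, whence the quotient is the homology of \<open>C\<close>.
\<close>
definition cycles ::
    "('k::field, 'a) module \<Rightarrow> (nat \<Rightarrow> nat set) \<Rightarrow>
     (nat \<Rightarrow> ('a list \<Rightarrow>\<^sub>0 'k) \<Rightarrow> ('a list \<Rightarrow>\<^sub>0 'k)) \<Rightarrow> nat \<Rightarrow> ('a list \<Rightarrow>\<^sub>0 'k) set" where
  "cycles A L d n = {x \<in> free_chains A (L n). n > 0 \<longrightarrow> d n x \<in> tensor_rel A (L (n - 1))}"

definition boundaries ::
    "('k::field, 'a) module \<Rightarrow> (nat \<Rightarrow> nat set) \<Rightarrow>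
     (nat \<Rightarrow> ('a list \<Rightarrow>\<^sub>0 'k) \<Rightarrow> ('a list \<Rightarrow>\<^sub>0 'k)) \<Rightarrow> nat \<Rightarrow> ('a list \<Rightarrow>\<^sub>0 'k) set" where
  "boundaries A L d n =
     {d (n + 1) x + r | x r. x \<in> free_chains A (L (n + 1)) \<and> r \<in> tensor_rel A (L n)}"

definition homology ::
    "('k::field, 'a) module \<Rightarrow> (nat \<Rightarrow> nat set) \<Rightarrow>
     (nat \<Rightarrow> ('a list \<Rightarrow>\<^sub>0 'k) \<Rightarrow> ('a list \<Rightarrow>\<^sub>0 'k)) \<Rightarrow> nat \<Rightarrow>
     ('k, ('a list \<Rightarrow>\<^sub>0 'k) set) module" where
  "homology A L d n = quot_module (pm_space (cycles A L d n)) (boundaries A L d n)"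

text \<open>
  The cokernel of the map \<open>H\<^sub>n(E) \<rightarrow> H\<^sub>n(A)\<close> induced by the inclusion of a
  subalgebra with carrier \<open>E\<close>.
\<close>
definition homology_coker ::
    "('k::field, 'a) module \<Rightarrow> 'a set \<Rightarrow> (nat \<Rightarrow> nat set) \<Rightarrow>
     (nat \<Rightarrow> ('a list \<Rightarrow>\<^sub>0 'k) \<Rightarrow> ('a list \<Rightarrow>\<^sub>0 'k)) \<Rightarrow> nat \<Rightarrow>
     ('k, ('a list \<Rightarrow>\<^sub>0 'k) set) module" where
  "homology_coker A E L d n = quot_module (pm_space (cycles A L d n))
     {x + y | x y. x \<in> boundaries A L d n \<and> y \<in> cycles (A\<lparr>carrier := E\<rparr>) L d n}"

definition face :: "('k, 'a) module \<Rightarrow> nat \<Rightarrow> 'a list \<Rightarrow> 'a list" where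
  "face A i l =
     (if i + 1 < length l then take i l @ (l ! i \<otimes>\<^bsub>A\<^esub> l ! (i + 1)) # drop (i + 2) l
      else (last l \<otimes>\<^bsub>A\<^esub> hd l) # butlast (tl l))"

definition hoch_b :: "('k::field, 'a) module \<Rightarrow> ('a list \<Rightarrow>\<^sub>0 'k) \<Rightarrow> ('a list \<Rightarrow>\<^sub>0 'k)" where
  "hoch_b A = lin_ext (\<lambda>l. if length l \<le> 1 then 0
     else \<Sum>i<length l. Poly_Mapping.single (face A i l) ((-1) ^ i))"

definition hoch_b' :: "('k::field, 'a) module \<Rightarrow> ('a list \<Rightarrow>\<^sub>0 'k) \<Rightarrow> ('a list \<Rightarrow>\<^sub>0 'k)" where
  "hoch_b' A = lin_ext (\<lambda>l. \<Sum>i<length l - 1. Poly_Mapping.single (face A i l) ((-1) ^ i))"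

definition cyc_t :: "('a list \<Rightarrow>\<^sub>0 'k::field) \<Rightarrow> ('a list \<Rightarrow>\<^sub>0 'k)" where
  "cyc_t = lin_ext (\<lambda>l. Poly_Mapping.single (last l # butlast l) ((-1) ^ (length l - 1)))"

definition cyc_N :: "('a list \<Rightarrow>\<^sub>0 'k::field) \<Rightarrow> ('a list \<Rightarrow>\<^sub>0 'k)" where
  "cyc_N = lin_ext (\<lambda>l. \<Sum>i<length l. (cyc_t ^^ i) (Poly_Mapping.single l 1))"

text \<open>
  Total complex of Loday's first quadrant bicomplex \<open>CC\<^sub>p\<^sub>q(A)\<close>, whose columns
  are \<open>(C(A), b)\<close> for \<open>p\<close> even and \<open>(C(A), -b')\<close> for \<open>p\<close> odd and whose horizontal
  differentials are \<open>1 - t\<close> out of odd columns and \<open>N\<close> out of even columns \<open>p > 0\<close>.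
  In total degree \<open>n\<close> a tensor of length \<open>q + 1\<close> sits in column \<open>p = n - q\<close>, so the
  total space is spanned by the tensors of lengths \<open>1, \<dots>, n + 1\<close>.
\<close>
definition cyc_D :: "('k::field, 'a) module \<Rightarrow> nat \<Rightarrow> ('a list \<Rightarrow>\<^sub>0 'k) \<Rightarrow> ('a list \<Rightarrow>\<^sub>0 'k)" where
  "cyc_D A n = lin_ext (\<lambda>l. let p = n + 1 - length l; x = Poly_Mapping.single l 1 in
     if p = 0 then hoch_b A x
     else if even p then hoch_b A x + cyc_N x
     else - hoch_b' A x + (x - cyc_t x))"

definition HH :: "nat \<Rightarrow> ('k::field, 'a) module \<Rightarrow> ('k, ('a list \<Rightarrow>\<^sub>0 'k) set) module" where
  "HH n A = homology A (\<lambda>n. {n + 1}) (\<lambda>_. hoch_b A) n"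

definition HC :: "nat \<Rightarrow> ('k::field, 'a) module \<Rightarrow> ('k, ('a list \<Rightarrow>\<^sub>0 'k) set) module" where
  "HC n A = homology A (\<lambda>n. {1..n + 1}) (cyc_D A) n"

definition HH_coker ::
    "nat \<Rightarrow> ('k::field, 'a) module \<Rightarrow> 'a set \<Rightarrow> ('k, ('a list \<Rightarrow>\<^sub>0 'k) set) module" where
  "HH_coker n A E = homology_coker A E (\<lambda>n. {n + 1}) (\<lambda>_. hoch_b A) n"

definition HC_coker ::
    "nat \<Rightarrow> ('k::field, 'a) module \<Rightarrow> 'a set \<Rightarrow> ('k, ('a list \<Rightarrow>\<^sub>0 'k) set) module" where
  "HC_coker n A E = homology_coker A E (\<lambda>n. {1..n + 1}) (cyc_D A) n"


section \<open>Quivers, path algebras and monomial ideals\<close>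

text \<open>
  A finite quiver is a \<^locale>\<open>fin_digraph\<close>. A path is a pair of its starting vertex and
  its list of arrows, so that \<open>(v, [])\<close> is the trivial path at \<open>v\<close>. Paths are read from
  left to right.
\<close>
type_synonym ('v, 'e) path = "'v \<times> 'e list"

definition quiver_paths :: "('v, 'e) pre_digraph \<Rightarrow> ('v, 'e) path set" where
  "quiver_paths Q = {(u, p). \<exists>v. pre_digraph.awalk Q u p v}"

definition path_mult ::
    "('v, 'e) pre_digraph \<Rightarrow> ('v, 'e) path \<Rightarrow> ('v, 'e) path \<Rightarrow> (('v, 'e) path \<Rightarrow>\<^sub>0 'k::field)" where
  "path_mult Q w w' =
     (if pre_digraph.awalk Q (fst w) (snd w) (fst w')
      then Poly_Mapping.single (fst w, snd w @ snd w') 1 else 0)"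

definition path_algebra ::
    "('v, 'e) pre_digraph \<Rightarrow> ('k::field, ('v, 'e) path \<Rightarrow>\<^sub>0 'k) module" where
  "path_algebra Q =
     \<lparr>carrier = {x. Poly_Mapping.keys x \<subseteq> quiver_paths Q},
      mult = (\<lambda>x y. lin_ext (\<lambda>w. lin_ext (path_mult Q w) y) x),
      one = (\<Sum>v\<in>verts Q. Poly_Mapping.single (v, []) 1),
      zero = 0, add = (+), smult = pm_scale\<rparr>"

definition arrow_ideal :: "('v, 'e) pre_digraph \<Rightarrow> (('v, 'e) path \<Rightarrow>\<^sub>0 'k::field) set" where
  "arrow_ideal Q = Idl\<^bsub>path_algebra Q\<^esub>
     ((\<lambda>a. Poly_Mapping.single (tail Q a, [a]) 1) ` arcs Q)"

primrec ideal_power :: "('a, 'b) ring_scheme \<Rightarrow> 'a set \<Rightarrow> nat \<Rightarrow> 'a set" where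
  "ideal_power R J 0 = carrier R"
| "ideal_power R J (Suc m) = ideal_prod R J (ideal_power R J m)"

definition admissible_ideal ::
    "('v, 'e) pre_digraph \<Rightarrow> (('v, 'e) path \<Rightarrow>\<^sub>0 'k::field) set \<Rightarrow> bool" where
  "admissible_ideal Q I \<longleftrightarrow> ideal I (path_algebra Q)
     \<and> (\<exists>m\<ge>2. ideal_power (path_algebra Q) (arrow_ideal Q) m \<subseteq> I)
     \<and> I \<subseteq> ideal_power (path_algebra Q) (arrow_ideal Q) 2"

definition monomial_ideal ::
    "('v, 'e) pre_digraph \<Rightarrow> (('v, 'e) path \<Rightarrow>\<^sub>0 'k::field) set \<Rightarrow> bool" where
  "monomial_ideal Q I \<longleftrightarrow> admissible_ideal Q I
     \<and> (\<exists>S. S \<subseteq> {w \<in> quiver_paths Q. length (snd w) \<ge> 2}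
          \<and> I = Idl\<^bsub>path_algebra Q\<^esub> ((\<lambda>w. Poly_Mapping.single w 1) ` S))"

definition quiver_algebra ::
    "('v, 'e) pre_digraph \<Rightarrow> (('v, 'e) path \<Rightarrow>\<^sub>0 'k::field) set \<Rightarrow>
     ('k, (('v, 'e) path \<Rightarrow>\<^sub>0 'k) set) module" where
  "quiver_algebra Q I = quot_module (path_algebra Q) I"

text \<open>
  Carrier of the image of \<open>kQ\<^sub>0\<close> in \<open>kQ/I\<close>. Its homology, a copy of \<open>k\<close> for each vertex
  in degree 0 (in every even degree for cyclic homology), is not compatible with the passage to
  cycle algebras: a vertex of \<open>Q\<close> may lie on no cycle or on several. The cokernels
  \<open>HH_coker\<close> and \<open>HC_coker\<close> for this subalgebra discard it.
\<close>
definition vertex_subalgebra ::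
    "('v, 'e) pre_digraph \<Rightarrow> (('v, 'e) path \<Rightarrow>\<^sub>0 'k::field) set \<Rightarrow>
     (('v, 'e) path \<Rightarrow>\<^sub>0 'k) set set" where
  "vertex_subalgebra Q I =
     (\<lambda>x. I +>\<^bsub>path_algebra Q\<^esub> x) ` {x. Poly_Mapping.keys x \<subseteq> (\<lambda>v. (v, [])) ` verts Q}"


section \<open>Cycle algebras\<close>

definition quiver_cycle :: "('v, 'e) pre_digraph \<Rightarrow> 'e list \<Rightarrow> bool" where
  "quiver_cycle Q c \<longleftrightarrow> c \<noteq> [] \<and> set c \<subseteq> arcs Q
     \<and> (\<forall>i<length c. head Q (c ! i) = tail Q (c ! ((i + 1) mod length c)))"

definition proper_cycle :: "('v, 'e) pre_digraph \<Rightarrow> 'e list \<Rightarrow> bool" where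
  "proper_cycle Q c \<longleftrightarrow> quiver_cycle Q c
     \<and> \<not> (\<exists>c' m. quiver_cycle Q c' \<and> m \<ge> 2 \<and> c = concat (replicate m c'))"

text \<open>The basic cycle with vertices \<open>0, \<dots>, n - 1\<close> and the arrow \<open>i\<close> from \<open>i\<close> to \<open>i + 1\<close> mod \<open>n\<close>.\<close>
definition basic_cycle :: "nat \<Rightarrow> (nat, nat) pre_digraph" where
  "basic_cycle n = \<lparr>verts = {..<n}, arcs = {..<n}, tail = (\<lambda>i. i), head = (\<lambda>i. (i + 1) mod n)\<rparr>"

definition cycle_image ::
    "('v, 'e) pre_digraph \<Rightarrow> 'e list \<Rightarrow> (nat, nat) path \<Rightarrow> ('v, 'e) path" where
  "cycle_image Q c w = (tail Q (c ! fst w), map (\<lambda>i. c ! i) (snd w))"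

definition cycle_ideal ::
    "('v, 'e) pre_digraph \<Rightarrow> (('v, 'e) path \<Rightarrow>\<^sub>0 'k::field) set \<Rightarrow> 'e list \<Rightarrow>
     ((nat, nat) path \<Rightarrow>\<^sub>0 'k) set" where
  "cycle_ideal Q I c = Idl\<^bsub>path_algebra (basic_cycle (length c))\<^esub>
     ((\<lambda>w. Poly_Mapping.single w 1) `
        {w \<in> quiver_paths (basic_cycle (length c)). Poly_Mapping.single (cycle_image Q c w) 1 \<in> I})"

definition cycle_algebra ::
    "('v, 'e) pre_digraph \<Rightarrow> (('v, 'e) path \<Rightarrow>\<^sub>0 'k::field) set \<Rightarrow> 'e list \<Rightarrow>
     ('k, ((nat, nat) path \<Rightarrow>\<^sub>0 'k) set) module" where
  "cycle_algebra Q I c = quiver_algebra (basic_cycle (length c)) (cycle_ideal Q I c)"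

definition cycle_vertices ::
    "('v, 'e) pre_digraph \<Rightarrow> (('v, 'e) path \<Rightarrow>\<^sub>0 'k::field) set \<Rightarrow> 'e list \<Rightarrow>
     ((nat, nat) path \<Rightarrow>\<^sub>0 'k) set set" where
  "cycle_vertices Q I c = vertex_subalgebra (basic_cycle (length c)) (cycle_ideal Q I c)"

text \<open>
  The minimal cycle algebras are indexed by a set of representatives for the orbits of proper
  cycles under rotation.
\<close>
definition proper_cycle_reps :: "('v, 'e) pre_digraph \<Rightarrow> 'e list set \<Rightarrow> bool" where
  "proper_cycle_reps Q T \<longleftrightarrow> T \<subseteq> Collect (proper_cycle Q)
     \<and> (\<forall>c. proper_cycle Q c \<longrightarrow> (\<exists>!c'. c' \<in> T \<and> (\<exists>i. c' = rotate i c)))"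

end

theory Submission
  imports Defs
begin

text \<open>
  Write \<open>A = kQ/I\<close>. The nonzero paths form a basis \<open>B\<close> of \<open>A\<close> in which the product of two
  basis elements is a basis element or zero. Expanding every tensor factor in \<open>B\<close> identifies
  the tensor powers of \<open>A\<close> with the spaces spanned by lists over \<open>B\<close>
  (\<open>Phi_congruent\<close>), and the differentials, being signed sums of faces and rotations, act on
  these lists up to lists that contain a zero (\<open>Phi_op_of\<close>).

  A face of a list of paths that does not vanish neither creates nor destroys composable
  junctions, and it preserves the total length. Hence the Hochschild complex and the cyclic
  bicomplex split into three parts, spanned by the lists that are not cyclically composable, by the
  lists of trivial paths, and by the cyclically composable lists of positive total length.

  The first part contributes nothing. For \<open>b\<close>, inserting a trivial path at the first junction
  that is not composable is a contracting homotopy (\<open>insert_homotopy\<close>); for \<open>b'\<close>, putting a trivial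
  path in front is one (\<open>prepend_homotopy\<close>). As all columns of this part of the bicomplex are exact, its
  total complex is exact (\<open>Non_acyclic_cyc\<close>). The second part is one copy of the complex of \<open>k\<close>
  for each vertex: it is exact in positive degrees for Hochschild homology
  (\<open>Triv_acyclic_hoch\<close>) and in odd degrees for cyclic homology (\<open>Triv_acyclic_cyc\<close>), and
  in every degree it is exactly what the homology of the vertex subalgebra contributes. So in each
  of the four assertions the space in question is the homology of the third part
  (\<open>computes_boundaries\<close>, \<open>computes_coker\<close>).

  The third part decomposes along the covering maps \<open>Z \<rightarrow> A\<close>. Concatenating the entries of a
  cyclically composable list of positive length gives a cycle of \<open>Q\<close> with a chosen starting point,
  which is, up to rotation, a power of exactly one chosen proper cycle \<open>c\<close>
  (\<open>cycle_has_proper_root\<close>, \<open>proper_common_sequence\<close>). The list then lifts to the cycle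
  algebra of \<open>c\<close> once the vertex above the starting point is chosen
  (\<open>cov_chain_lift\<close>), and that vertex is determined, because a proper cycle coincides with none of
  its nontrivial rotations (\<open>proper_phase_unique\<close>). Thus taking images is a bijection from the lists
  of all the cycle algebras to those of \<open>A\<close>; it commutes with faces and rotations
  (\<open>cov_act\<close>), so the complexes themselves correspond (\<open>decompose\<close>).
\<close>


section \<open>Linear maps on spaces of chains\<close>

abbreviation "keys \<equiv> Poly_Mapping.keys"
abbreviation "lookup \<equiv> Poly_Mapping.lookup"
abbreviation "single \<equiv> Poly_Mapping.single"

lemma lookup_pm_scale [simp]: "lookup (pm_scale c x) l = c * lookup x l"
  by (simp add: pm_scale_def Poly_Mapping.map.rep_eq when_def)

interpretation pmv: vector_space "pm_scale :: 'k::field \<Rightarrow> ('b \<Rightarrow>\<^sub>0 'k) \<Rightarrow> ('b \<Rightarrow>\<^sub>0 'k)"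
  by unfold_locales (auto intro!: poly_mapping_eqI simp: lookup_add algebra_simps)

lemma pm_scale_single [simp]: "pm_scale c (single l d) = single l (c * d)"
  by (rule poly_mapping_eqI) (simp add: lookup_single when_def)

definition klin :: "(('b \<Rightarrow>\<^sub>0 'k::field) \<Rightarrow> ('c \<Rightarrow>\<^sub>0 'k)) \<Rightarrow> bool" where
  "klin f \<longleftrightarrow> (\<forall>x y. f (x + y) = f x + f y) \<and> (\<forall>c x. f (pm_scale c x) = pm_scale c (f x))"

lemma klin_plus: "klin f \<Longrightarrow> f (x + y) = f x + f y"
  and klin_scale: "klin f \<Longrightarrow> f (pm_scale c x) = pm_scale c (f x)"
  by (auto simp: klin_def)

lemma klin_zero: "klin f \<Longrightarrow> f 0 = 0"
  using klin_scale[of f 0 0] by simp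

lemma klin_uminus: "klin f \<Longrightarrow> f (- x) = - f x"
  using klin_plus[of f x "- x"] by (simp add: klin_zero eq_neg_iff_add_eq_0 add.commute)

lemma klin_minus: "klin f \<Longrightarrow> f (x - y) = f x - f y"
  using klin_plus[of f x "- y"] by (simp add: klin_uminus)

lemma klin_sum: "klin f \<Longrightarrow> f (\<Sum>i\<in>S. g i) = (\<Sum>i\<in>S. f (g i))"
  by (induction S rule: infinite_finite_induct) (auto simp: klin_zero klin_plus)

lemma klin_sum_list: "klin f \<Longrightarrow> f (\<Sum>i\<leftarrow>xs. g i) = (\<Sum>i\<leftarrow>xs. f (g i))"
  by (induction xs) (auto simp: klin_zero klin_plus)

lemma klin_id [intro!]: "klin (\<lambda>x. x)"
  and klin_const0 [intro!]: "klin (\<lambda>x. 0)"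
  by (auto simp: klin_def)

lemma klin_add [intro!]: "klin f \<Longrightarrow> klin g \<Longrightarrow> klin (\<lambda>x. f x + g x)"
  and klin_diff [intro!]: "klin f \<Longrightarrow> klin g \<Longrightarrow> klin (\<lambda>x. f x - g x)"
  and klin_neg [intro!]: "klin f \<Longrightarrow> klin (\<lambda>x. - f x)"
  by (auto simp: klin_def algebra_simps)

lemma klin_comp: "klin f \<Longrightarrow> klin g \<Longrightarrow> klin (\<lambda>x. f (g x))"
  by (auto simp: klin_def)

lemma lin_ext_superset:
  assumes "finite S" "keys x \<subseteq> S"
  shows "lin_ext f x = (\<Sum>l\<in>S. pm_scale (lookup x l) (f l))"
  unfolding lin_ext_def using assms
  by (intro sum.mono_neutral_left) (auto simp: in_keys_iff)

lemma klin_lin_ext [intro!, simp]: "klin (lin_ext f)"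
proof -
  have "lin_ext f (x + y) = lin_ext f x + lin_ext f y" for x y
  proof -
    let ?S = "keys x \<union> keys y"
    have "keys (x + y) \<subseteq> ?S" by (rule Poly_Mapping.keys_add)
    then show ?thesis
      by (subst (1 2 3) lin_ext_superset[of ?S])
        (auto simp: lookup_add pmv.scale_left_distrib sum.distrib)
  qed
  moreover have "lin_ext f (pm_scale c x) = pm_scale c (lin_ext f x)" for c x
  proof -
    have "keys (pm_scale c x) \<subseteq> keys x" by (auto simp: in_keys_iff)
    then show ?thesis
      by (subst (1 2) lin_ext_superset[of "keys x"])
        (auto simp: pmv.scale_sum_right)
  qed
  ultimately show ?thesis by (simp add: klin_def)
qed

lemma lin_ext_single [simp]: "lin_ext f (single l c) = pm_scale c (f l)"
  by (subst lin_ext_superset[of "{l}"]) auto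

lemma lin_ext_zero [simp]: "lin_ext f 0 = 0"
  and lin_ext_plus: "lin_ext f (x + y) = lin_ext f x + lin_ext f y"
  and lin_ext_minus: "lin_ext f (x - y) = lin_ext f x - lin_ext f y"
  and lin_ext_scale: "lin_ext f (pm_scale c x) = pm_scale c (lin_ext f x)"
  by (auto simp: klin_zero klin_plus klin_minus klin_uminus klin_scale)

lemma sum_single_lookup: "(\<Sum>l\<in>keys x. single l (lookup x l)) = x"
proof (rule poly_mapping_eqI)
  fix k
  have "lookup (\<Sum>l\<in>keys x. single l (lookup x l)) k =
      (\<Sum>l\<in>keys x. if l = k then lookup x k else 0)"
    unfolding lookup_sum by (rule sum.cong) (auto simp: lookup_single when_def)
  then show "lookup (\<Sum>l\<in>keys x. single l (lookup x l)) k
      = lookup x k"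
    by (simp add: in_keys_iff)
qed

lemma klin_expand:
  assumes "klin f"
  shows "f x = lin_ext (\<lambda>l. f (single l 1)) x"
proof -
  have "f x = f (\<Sum>l\<in>keys x. pm_scale (lookup x l) (single l 1))"
    by (simp add: sum_single_lookup)
  then show ?thesis
    by (simp only: klin_sum[OF assms] klin_scale[OF assms] lin_ext_def)
qed

text \<open>
  Linear maps are compared on the elementary tensors; most identities between operators below are
  proved in this way.
\<close>
lemma klin_eqI:
  assumes "klin f" "klin g" "keys x \<subseteq> S"
    and "\<And>l. l \<in> S \<Longrightarrow> f (single l 1) = g (single l 1)"
  shows "f x = g x"
proof -
  have "lin_ext (\<lambda>l. f (single l 1)) x = lin_ext (\<lambda>l. g (single l 1)) x"
    unfolding lin_ext_def using assms(3,4) by (intro sum.cong) auto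
  then show ?thesis by (simp flip: klin_expand[OF assms(1)] klin_expand[OF assms(2)])
qed

lemma klin_mem_subspace:
  assumes "klin f" "pmv.subspace W" "keys x \<subseteq> S"
    and "\<And>l. l \<in> S \<Longrightarrow> f (single l 1) \<in> W"
  shows "f x \<in> W"
proof -
  have "lin_ext (\<lambda>l. f (single l 1)) x \<in> W"
    unfolding lin_ext_def using assms(2-4)
    by (intro pmv.subspace_sum pmv.subspace_scale) auto
  then show ?thesis by (simp flip: klin_expand[OF assms(1)])
qed

lemma subspace_keys: "pmv.subspace {x :: 'b \<Rightarrow>\<^sub>0 'k::field. keys x \<subseteq> S}"
  proof -
  have "keys (x + y) \<subseteq> S" if "keys x \<subseteq> S" "keys y \<subseteq> S" for x y :: "'b \<Rightarrow>\<^sub>0 'k"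
    using that Poly_Mapping.keys_add[of x y] by blast
  then show ?thesis by (auto simp: pmv.subspace_def in_keys_iff)
qed

lemma keys_minusI: "keys x \<subseteq> S \<Longrightarrow> keys y \<subseteq> S \<Longrightarrow> keys (x - y) \<subseteq> S"
  and keys_plusI: "keys x \<subseteq> S \<Longrightarrow> keys y \<subseteq> S \<Longrightarrow> keys (x + y) \<subseteq> S"
  for x y :: "'b \<Rightarrow>\<^sub>0 'k::field"
  using pmv.subspace_diff[OF subspace_keys, of x S y] pmv.subspace_add[OF subspace_keys, of x S y] by auto

lemma keys_lin_ext:
  assumes "keys x \<subseteq> S" "\<And>l. l \<in> S \<Longrightarrow> keys (f l) \<subseteq> S'"
  shows "keys (lin_ext f x) \<subseteq> S'"
  using klin_mem_subspace[OF klin_lin_ext subspace_keys assms(1), of f S'] assms(2) by simp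

lemma subspace_vimage: "klin f \<Longrightarrow> pmv.subspace W \<Longrightarrow> pmv.subspace {x. f x \<in> W}"
  by (auto simp: pmv.subspace_def klin_zero klin_plus klin_scale)

lemma span_vimage:
  assumes "klin f" "pmv.subspace W" "\<And>g. g \<in> G \<Longrightarrow> f g \<in> W" "x \<in> pmv.span G"
  shows "f x \<in> W"
  using pmv.span_minimal[of G "{x. f x \<in> W}"] subspace_vimage[OF assms(1,2)] assms(3,4) by auto

definition restr :: "'b set \<Rightarrow> ('b \<Rightarrow>\<^sub>0 'k::field) \<Rightarrow> ('b \<Rightarrow>\<^sub>0 'k)" where
  "restr S = lin_ext (\<lambda>l. if l \<in> S then single l 1 else 0)"

lemma klin_restr [intro!, simp]: "klin (restr S)"
  by (simp add: restr_def)

lemma lookup_restr: "lookup (restr S x) l = (if l \<in> S then lookup x l else 0)"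
proof -
  have "lookup (restr S x) l =
      (\<Sum>k\<in>keys x. if k = l then (if l \<in> S then lookup x l else 0) else 0)"
    unfolding restr_def lin_ext_def lookup_sum
    by (rule sum.cong) (auto simp: lookup_single when_def)
  then show ?thesis by (auto simp: in_keys_iff)
qed

lemma keys_restr [simp]: "keys (restr S x) = keys x \<inter> S"
  by (auto simp: in_keys_iff lookup_restr split: if_splits)

lemma restr_single: "restr S (single l c) = (if l \<in> S then single l c else 0)"
  by (rule poly_mapping_eqI) (auto simp: lookup_restr lookup_single when_def)

lemma restr_restr [simp]: "restr S (restr S' x) = restr (S \<inter> S') x"
  by (rule poly_mapping_eqI) (auto simp: lookup_restr)

lemma restr_id: "keys x \<subseteq> S \<Longrightarrow> restr S x = x"
  by (rule poly_mapping_eqI) (auto simp: lookup_restr in_keys_iff subset_iff)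

lemma restr_empty: "keys x \<inter> S = {} \<Longrightarrow> restr S x = 0"
  by (rule poly_mapping_eqI) (auto simp: lookup_restr in_keys_iff disjoint_iff)

lemmas restr_plus = klin_plus[OF klin_restr] and restr_minus = klin_minus[OF klin_restr]
  and restr_zero [simp] = klin_zero[OF klin_restr] and restr_uminus = klin_uminus[OF klin_restr]

section \<open>Quotient spaces\<close>

definition coset :: "('b \<Rightarrow>\<^sub>0 'k::field) set \<Rightarrow> ('b \<Rightarrow>\<^sub>0 'k) \<Rightarrow> ('b \<Rightarrow>\<^sub>0 'k) set" where
  "coset W x = (\<lambda>w. w + x) ` W"

lemma a_r_coset_coset: "add R = (+) \<Longrightarrow> W +>\<^bsub>R\<^esub> x = coset W x"
  unfolding coset_def a_r_coset_def r_coset_def by auto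

lemma coset_eq_iff:
  assumes "pmv.subspace W"
  shows "coset W x = coset W y \<longleftrightarrow> x - y \<in> W"
proof
  assume "coset W x = coset W y"
  moreover have "x \<in> coset W x" using pmv.subspace_0[OF assms] by (force simp: coset_def)
  ultimately show "x - y \<in> W" by (auto simp: coset_def)
next
  assume *: "x - y \<in> W"
  have "w + x \<in> coset W y" if "w \<in> W" for w
    using pmv.subspace_add[OF assms that *] unfolding coset_def by (intro image_eqI[of _ _ "w + (x - y)"]) auto
  moreover have "w + y \<in> coset W x" if "w \<in> W" for w
    using pmv.subspace_diff[OF assms that *] unfolding coset_def by (intro image_eqI[of _ _ "w - (x - y)"]) auto
  ultimately show "coset W x = coset W y" by (auto simp: coset_def)
qed

lemma mem_coset_iff: "y \<in> coset W x \<longleftrightarrow> y - x \<in> W"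
  by (force simp: coset_def image_iff intro: bexI[of _ "y - x"])

lemma coset_zero [simp]: "coset W 0 = W"
  by (simp add: coset_def)

lemma coset_set_add:
  assumes "add R = (+)" "pmv.subspace W"
  shows "coset W x <+>\<^bsub>R\<^esub> coset W y = coset W (x + y)"
proof -
  have "z - (x + y) \<in> W \<longleftrightarrow> (\<exists>a b. a - x \<in> W \<and> b - y \<in> W \<and> z = a + b)" for z
  proof
    assume "z - (x + y) \<in> W"
    then show "\<exists>a b. a - x \<in> W \<and> b - y \<in> W \<and> z = a + b"
      by (intro exI[of _ "z - y"] exI[of _ y]) (auto simp: pmv.subspace_0[OF assms(2)] algebra_simps)
  next
    assume "\<exists>a b. a - x \<in> W \<and> b - y \<in> W \<and> z = a + b"
    then obtain a b where "a - x \<in> W" "b - y \<in> W" "z = a + b" by auto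
    then show "z - (x + y) \<in> W"
      using pmv.subspace_add[OF assms(2), of "a - x" "b - y"] by (simp add: algebra_simps)
  qed
  then show ?thesis
    unfolding set_add_def' by (simp add: assms(1) set_eq_iff mem_coset_iff Bex_def)
qed

lemma coset_smult:
  assumes "pmv.subspace W"
  shows "(\<Union>z\<in>coset W x. coset W (pm_scale c z)) = coset W (pm_scale c x)"
proof -
  have "coset W (pm_scale c z) = coset W (pm_scale c x)" if "z \<in> coset W x" for z
    using that pmv.subspace_scale[OF assms, of "z - x" c]
    by (simp add: coset_eq_iff[OF assms] mem_coset_iff pmv.scale_right_diff_distrib)
  moreover have "x \<in> coset W x" by (simp add: mem_coset_iff pmv.subspace_0[OF assms])
  ultimately show ?thesis by blast
qed

lemma quot_module_simps:
  "carrier (quot_module M W) = a_rcosets\<^bsub>M\<^esub> W"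
  "mult (quot_module M W) = rcoset_mult M W"
  "zero (quot_module M W) = W"
  "add (quot_module M W) = set_add M"
  "smult (quot_module M W) = (\<lambda>c X. \<Union>x\<in>X. W +>\<^bsub>M\<^esub> (c \<odot>\<^bsub>M\<^esub> x))"
  by (simp_all add: quot_module_def ring.defs module.defs FactRing_def)

lemma quot_module_coset:
  assumes "add R = (+)" "smult R = pm_scale" "pmv.subspace W"
  shows "carrier (quot_module R W) = coset W ` carrier R"
    and "zero (quot_module R W) = coset W 0"
    and "coset W x \<oplus>\<^bsub>quot_module R W\<^esub> coset W y = coset W (x + y)"
    and "c \<odot>\<^bsub>quot_module R W\<^esub> coset W x = coset W (pm_scale c x)"
  using assms coset_set_add[OF assms(1,3)] coset_smult[OF assms(3)]
  by (auto simp: quot_module_simps A_RCOSETS_def' a_r_coset_coset)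

lemma quot_pm_space:
  assumes "pmv.subspace W"
  shows "carrier (quot_module (pm_space V) W) = coset W ` V"
    and "zero (quot_module (pm_space V) W) = coset W 0"
    and "coset W x \<oplus>\<^bsub>quot_module (pm_space V) W\<^esub> coset W y = coset W (x + y)"
    and "c \<odot>\<^bsub>quot_module (pm_space V) W\<^esub> coset W x = coset W (pm_scale c x)"
  using quot_module_coset[OF _ _ assms, of "pm_space V"] by (auto simp: pm_space_def)

text \<open>
  The maps \<open>f c\<close> together induce a linear map from \<open>V\<close> to the direct sum. Its kernel
  is \<open>W\<close> by \<open>ker\<close>, and it is surjective because \<open>g c\<close> is a section of
  the component \<open>c\<close> and vanishes in the other components, all modulo \<open>W' c\<close>.
\<close>
lemma quotient_iso_direct_sum:
  fixes V W :: "('b \<Rightarrow>\<^sub>0 'k::field) set" and V' W' :: "'i \<Rightarrow> ('c \<Rightarrow>\<^sub>0 'k) set"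
  assumes V: "pmv.subspace V" and W: "pmv.subspace W"
    and V': "\<And>c. c \<in> T \<Longrightarrow> pmv.subspace (V' c)" and W': "\<And>c. c \<in> T \<Longrightarrow> pmv.subspace (W' c)"
    and f: "\<And>c. klin (f c)"
    and fV: "\<And>c x. c \<in> T \<Longrightarrow> x \<in> V \<Longrightarrow> f c x \<in> V' c"
    and fin: "\<And>x. x \<in> V \<Longrightarrow> finite {c \<in> T. f c x \<notin> W' c}"
    and ker: "\<And>x. x \<in> V \<Longrightarrow> (\<forall>c\<in>T. f c x \<in> W' c) \<longleftrightarrow> x \<in> W"
    and gV: "\<And>c y. c \<in> T \<Longrightarrow> y \<in> V' c \<Longrightarrow> g c y \<in> V"
    and fg: "\<And>c y. c \<in> T \<Longrightarrow> y \<in> V' c \<Longrightarrow> f c (g c y) - y \<in> W' c"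
    and fg': "\<And>c c' y. c \<in> T \<Longrightarrow> c' \<in> T \<Longrightarrow> c' \<noteq> c \<Longrightarrow> y \<in> V' c \<Longrightarrow> f c' (g c y) \<in> W' c'"
  shows "quot_module (pm_space V) W \<cong>\<^sub>k direct_sum T (\<lambda>c. quot_module (pm_space (V' c)) (W' c))"
proof -
  let ?M = "quot_module (pm_space V) W" and ?N = "\<lambda>c. quot_module (pm_space (V' c)) (W' c)"
  let ?D = "direct_sum T ?N"
  define k where "k x = (\<lambda>c\<in>T. coset (W' c) (f c x))" for x
  \<comment> \<open>a coset of \<open>W\<close> determines \<open>k\<close> of its representatives in \<open>V\<close>\<close>
  define h where "h X = k (SOME x. x \<in> V \<and> X = coset W x)" for X
  have keq: "k x = k y \<longleftrightarrow> x - y \<in> W" if "x \<in> V" "y \<in> V" for x y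
  proof -
    have "k x = k y \<longleftrightarrow> (\<forall>c\<in>T. f c (x - y) \<in> W' c)"
      unfolding k_def using coset_eq_iff[OF W'] by (auto simp: fun_eq_iff klin_minus[OF f])
    then show ?thesis using ker[OF pmv.subspace_diff[OF V that]] by simp
  qed
  have hk: "h (coset W x) = k x" if "x \<in> V" for x
  proof -
    have "\<exists>y. y \<in> V \<and> coset W x = coset W y" using that by auto
    then have *: "(SOME y. y \<in> V \<and> coset W x = coset W y) \<in> V \<and>
        coset W x = coset W (SOME y. y \<in> V \<and> coset W x = coset W y)"
      by (rule someI_ex)
    then show ?thesis unfolding h_def using keq that coset_eq_iff[OF W] by metis
  qed
  have kD: "k x \<in> carrier ?D" if "x \<in> V" for x
  proof -
    have "{c \<in> T. k x c \<noteq> zero (?N c)} = {c \<in> T. f c x \<notin> W' c}"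
      using coset_eq_iff[OF W', where y = 0] by (auto simp: k_def quot_pm_space[OF W'])
    then show ?thesis
      using fin[OF that] fV that by (auto simp: direct_sum_def k_def quot_pm_space[OF W'])
  qed
  have surj: "\<exists>x\<in>V. k x = F" if F: "F \<in> carrier ?D" for F
  proof -
    have "\<forall>c\<in>T. \<exists>y. y \<in> V' c \<and> F c = coset (W' c) y"
      using F by (auto simp: direct_sum_def quot_pm_space[OF W'] PiE_iff image_iff)
    then obtain y where y: "\<And>c. c \<in> T \<Longrightarrow> y c \<in> V' c \<and> F c = coset (W' c) (y c)" by metis
    define S where "S = {c \<in> T. F c \<noteq> zero (?N c)}"
    have S: "finite S" "S \<subseteq> T" using F by (auto simp: direct_sum_def S_def)
    define x where "x = (\<Sum>c\<in>S. g c (y c))"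
    have xV: "x \<in> V" unfolding x_def using gV y S by (intro pmv.subspace_sum[OF V]) auto
    have "coset (W' c) (f c x) = F c" if c: "c \<in> T" for c
    proof -
      have rest: "(\<Sum>c'\<in>S - {c}. f c (g c' (y c'))) \<in> W' c"
        using fg' y S c by (intro pmv.subspace_sum[OF W'[OF c]]) auto
      have fx: "f c x = (\<Sum>c'\<in>S. f c (g c' (y c')))" by (simp add: x_def klin_sum[OF f])
      show ?thesis
      proof (cases "c \<in> S")
        case True
        have "f c x - y c = (f c (g c (y c)) - y c) + (\<Sum>c'\<in>S - {c}. f c (g c' (y c')))"
          unfolding fx using True S(1) by (simp add: sum.remove)
        then have "f c x - y c \<in> W' c"
          using pmv.subspace_add[OF W'[OF c] fg[OF c, of "y c"] rest] y c by (simp add: algebra_simps)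
        then show ?thesis using y c coset_eq_iff[OF W'[OF c]] by auto
      next
        case False
        then have "F c = W' c" using c by (auto simp: S_def quot_pm_space[OF W'[OF c]])
        moreover have "f c x \<in> W' c" using rest False fx by simp
        ultimately show ?thesis using coset_eq_iff[OF W'[OF c], of "f c x" 0] by simp
      qed
    qed
    then have "k x = F"
      using F by (auto simp: k_def direct_sum_def fun_eq_iff PiE_iff extensional_def)
    with xV show ?thesis by blast
  qed
  have "bij_betw h (carrier ?M) (carrier ?D)"
    unfolding bij_betw_def
  proof
    show "inj_on h (carrier ?M)"
      by (rule inj_onI, unfold quot_pm_space[OF W], elim imageE)
        (simp add: hk keq coset_eq_iff[OF W])
    show "h ` carrier ?M = carrier ?D"
      using kD surj by (auto simp: quot_pm_space[OF W] hk image_image image_iff)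
  qed
  moreover have "h (X \<oplus>\<^bsub>?M\<^esub> Y) = h X \<oplus>\<^bsub>?D\<^esub> h Y" if XY: "X \<in> carrier ?M" "Y \<in> carrier ?M" for X Y
  proof -
    obtain x y where "x \<in> V" "y \<in> V" "X = coset W x" "Y = coset W y"
      using XY by (auto simp: quot_pm_space[OF W])
    moreover have "x + y \<in> V" using calculation pmv.subspace_add[OF V] by blast
    ultimately show ?thesis
      by (simp add: quot_pm_space[OF W] hk)
         (auto simp: k_def direct_sum_def fun_eq_iff klin_plus[OF f] quot_pm_space[OF W'])
  qed
  moreover have "h (c \<odot>\<^bsub>?M\<^esub> X) = c \<odot>\<^bsub>?D\<^esub> h X" if X: "X \<in> carrier ?M" for c X
  proof -
    obtain x where "x \<in> V" "X = coset W x"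
      using X by (auto simp: quot_pm_space[OF W])
    moreover have "pm_scale c x \<in> V" using calculation pmv.subspace_scale[OF V] by blast
    ultimately show ?thesis
      by (simp add: quot_pm_space[OF W] hk)
         (auto simp: k_def direct_sum_def fun_eq_iff klin_scale[OF f] quot_pm_space[OF W'])
  qed
  ultimately show ?thesis unfolding isomorphic_spaces_def by blast
qed

section \<open>Expansion of tensors in a multiplicative basis\<close>

lemma lin_ext_add_fun: "lin_ext (\<lambda>l. f l + g l) x = lin_ext f x + lin_ext g x"
  by (simp add: lin_ext_def pmv.scale_right_distrib sum.distrib)

lemma lin_ext_scale_fun: "lin_ext (\<lambda>l. pm_scale c (f l)) x = pm_scale c (lin_ext f x)"
  by (simp add: lin_ext_def pmv.scale_sum_right mult.commute)

lemma klin_lin_ext_swap: "klin g \<Longrightarrow> g (lin_ext f x) = lin_ext (\<lambda>l. g (f l)) x"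
  by (simp add: lin_ext_def klin_sum klin_scale)

lemma subspace_tensor_rel: "pmv.subspace (tensor_rel A L)"
  by (simp add: tensor_rel_def)

lemma subspace_free_chains: "pmv.subspace (free_chains A L)"
  unfolding free_chains_def by (rule subspace_keys)

lemma tensor_rel_add:
  "set us \<subseteq> carrier A \<Longrightarrow> x \<in> carrier A \<Longrightarrow> y \<in> carrier A \<Longrightarrow> set vs \<subseteq> carrier A \<Longrightarrow>
   length us + 1 + length vs \<in> L \<Longrightarrow>
   single (us @ (x \<oplus>\<^bsub>A\<^esub> y) # vs) 1
     - single (us @ x # vs) 1 - single (us @ y # vs) 1 \<in> tensor_rel A L"
  unfolding tensor_rel_def by (rule pmv.span_base) blast

lemma tensor_rel_smult:
  "set us \<subseteq> carrier A \<Longrightarrow> x \<in> carrier A \<Longrightarrow> set vs \<subseteq> carrier A \<Longrightarrow>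
   length us + 1 + length vs \<in> L \<Longrightarrow>
   single (us @ (c \<odot>\<^bsub>A\<^esub> x) # vs) 1 - single (us @ x # vs) c \<in> tensor_rel A L"
  unfolding tensor_rel_def by (rule pmv.span_base) blast

text \<open>
  A linear map sends the relations into \<open>W\<close> as soon as the corresponding function of an
  elementary tensor is multilinear modulo \<open>W\<close>.
\<close>
lemma tensor_rel_induct:
  assumes "klin f" "pmv.subspace W"
    and "\<And>us x y vs. set us \<subseteq> carrier A \<Longrightarrow> x \<in> carrier A \<Longrightarrow> y \<in> carrier A \<Longrightarrow> set vs \<subseteq> carrier A \<Longrightarrow>
      length us + 1 + length vs \<in> L \<Longrightarrow>
      f (single (us @ (x \<oplus>\<^bsub>A\<^esub> y) # vs) 1)
       - f (single (us @ x # vs) 1) - f (single (us @ y # vs) 1) \<in> W"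
    and "\<And>us c x vs. set us \<subseteq> carrier A \<Longrightarrow> x \<in> carrier A \<Longrightarrow> set vs \<subseteq> carrier A \<Longrightarrow>
      length us + 1 + length vs \<in> L \<Longrightarrow>
      f (single (us @ (c \<odot>\<^bsub>A\<^esub> x) # vs) 1)
       - pm_scale c (f (single (us @ x # vs) 1)) \<in> W"
    and "x \<in> tensor_rel A L"
  shows "f x \<in> W"
proof (rule span_vimage[OF assms(1,2) _ assms(5)[unfolded tensor_rel_def]])
  have sc: "f (single l c) = pm_scale c (f (single l 1))" for l c
    using klin_scale[OF assms(1), of c "single l 1"] by simp
  fix g assume "g \<in> {single (us @ (x \<oplus>\<^bsub>A\<^esub> y) # vs) 1
         - single (us @ x # vs) 1 - single (us @ y # vs) 1 | us x y vs.
         set us \<subseteq> carrier A \<and> x \<in> carrier A \<and> y \<in> carrier A \<and> set vs \<subseteq> carrier A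
         \<and> length us + 1 + length vs \<in> L}
      \<union> {single (us @ (c \<odot>\<^bsub>A\<^esub> x) # vs) 1
           - single (us @ x # vs) c | us c x vs.
         set us \<subseteq> carrier A \<and> x \<in> carrier A \<and> set vs \<subseteq> carrier A
         \<and> length us + 1 + length vs \<in> L}"
  then show "f g \<in> W"
  proof (elim UnE CollectE exE conjE)
    fix us x y vs
    assume g: "g = single (us @ (x \<oplus>\<^bsub>A\<^esub> y) # vs) 1
         - single (us @ x # vs) 1 - single (us @ y # vs) 1"
      and "set us \<subseteq> carrier A" "x \<in> carrier A" "y \<in> carrier A" "set vs \<subseteq> carrier A"
        "length us + 1 + length vs \<in> L"
    then show "f g \<in> W" unfolding g klin_minus[OF assms(1)] by (intro assms(3))
  next
    fix us c x vs
    assume g: "g = single (us @ (c \<odot>\<^bsub>A\<^esub> x) # vs) 1 - single (us @ x # vs) c"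
      and "set us \<subseteq> carrier A" "x \<in> carrier A" "set vs \<subseteq> carrier A" "length us + 1 + length vs \<in> L"
    then show "f g \<in> W" unfolding g klin_minus[OF assms(1)] sc[of _ c] by (intro assms(4))
  qed
qed

text \<open>
  \<open>co x\<close> is the coordinate vector of \<open>x\<close> in the basis \<open>B\<close>. That \<open>B\<close> spans is
  expressed by the induction principle \<open>basis_induct\<close>, which is the form in which it is used.
\<close>
locale multiplicative_basis =
  fixes A :: "('k::field, 'a) module" and B :: "'a set" and co :: "'a \<Rightarrow> ('a \<Rightarrow>\<^sub>0 'k)"
  assumes zero_closed: "\<zero>\<^bsub>A\<^esub> \<in> carrier A"
    and add_closed: "x \<in> carrier A \<Longrightarrow> y \<in> carrier A \<Longrightarrow> x \<oplus>\<^bsub>A\<^esub> y \<in> carrier A"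
    and smult_closed: "x \<in> carrier A \<Longrightarrow> c \<odot>\<^bsub>A\<^esub> x \<in> carrier A"
    and mult_closed: "x \<in> carrier A \<Longrightarrow> y \<in> carrier A \<Longrightarrow> x \<otimes>\<^bsub>A\<^esub> y \<in> carrier A"
    and l_distr: "x \<in> carrier A \<Longrightarrow> y \<in> carrier A \<Longrightarrow> z \<in> carrier A \<Longrightarrow>
      (x \<oplus>\<^bsub>A\<^esub> y) \<otimes>\<^bsub>A\<^esub> z = x \<otimes>\<^bsub>A\<^esub> z \<oplus>\<^bsub>A\<^esub> y \<otimes>\<^bsub>A\<^esub> z"
    and r_distr: "x \<in> carrier A \<Longrightarrow> y \<in> carrier A \<Longrightarrow> z \<in> carrier A \<Longrightarrow>
      z \<otimes>\<^bsub>A\<^esub> (x \<oplus>\<^bsub>A\<^esub> y) = z \<otimes>\<^bsub>A\<^esub> x \<oplus>\<^bsub>A\<^esub> z \<otimes>\<^bsub>A\<^esub> y"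
    and smult_l: "x \<in> carrier A \<Longrightarrow> y \<in> carrier A \<Longrightarrow> (c \<odot>\<^bsub>A\<^esub> x) \<otimes>\<^bsub>A\<^esub> y = c \<odot>\<^bsub>A\<^esub> (x \<otimes>\<^bsub>A\<^esub> y)"
    and smult_r: "x \<in> carrier A \<Longrightarrow> y \<in> carrier A \<Longrightarrow> x \<otimes>\<^bsub>A\<^esub> (c \<odot>\<^bsub>A\<^esub> y) = c \<odot>\<^bsub>A\<^esub> (x \<otimes>\<^bsub>A\<^esub> y)"
    and smult_0: "x \<in> carrier A \<Longrightarrow> 0 \<odot>\<^bsub>A\<^esub> x = \<zero>\<^bsub>A\<^esub>"
    and B_carrier: "B \<subseteq> carrier A"
    and B_mult: "a \<in> B \<Longrightarrow> b \<in> B \<Longrightarrow> a \<otimes>\<^bsub>A\<^esub> b \<in> insert \<zero>\<^bsub>A\<^esub> B"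
    and co_add: "x \<in> carrier A \<Longrightarrow> y \<in> carrier A \<Longrightarrow> co (x \<oplus>\<^bsub>A\<^esub> y) = co x + co y"
    and co_smult: "x \<in> carrier A \<Longrightarrow> co (c \<odot>\<^bsub>A\<^esub> x) = pm_scale c (co x)"
    and co_B: "b \<in> B \<Longrightarrow> co b = single b 1"
    and co_keys: "x \<in> carrier A \<Longrightarrow> keys (co x) \<subseteq> B"
    and basis_induct: "x \<in> carrier A \<Longrightarrow> P \<zero>\<^bsub>A\<^esub> \<Longrightarrow>
      (\<And>c b y. b \<in> B \<Longrightarrow> y \<in> carrier A \<Longrightarrow> P y \<Longrightarrow> P (c \<odot>\<^bsub>A\<^esub> b \<oplus>\<^bsub>A\<^esub> y)) \<Longrightarrow> P x"
begin

text \<open>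
  The tensor of the entries, written in the basis formed by the tensors of elements of \<open>B\<close>.
\<close>
primrec expand :: "'a list \<Rightarrow> ('a list \<Rightarrow>\<^sub>0 'k)" where
  "expand [] = single [] 1"
| "expand (a # l) =
     lin_ext (\<lambda>p. lin_ext (\<lambda>m. single (p # m) 1) (expand l)) (co a)"

definition Phi :: "('a list \<Rightarrow>\<^sub>0 'k) \<Rightarrow> ('a list \<Rightarrow>\<^sub>0 'k)" where
  "Phi = lin_ext expand"

lemma klin_Phi [intro!, simp]: "klin Phi"
  by (simp add: Phi_def)

lemma Phi_single [simp]: "Phi (single l 1) = expand l"
  by (simp add: Phi_def)

lemma zero_mult: "x \<in> carrier A \<Longrightarrow> \<zero>\<^bsub>A\<^esub> \<otimes>\<^bsub>A\<^esub> x = \<zero>\<^bsub>A\<^esub>"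
  using smult_l[OF zero_closed, of x 0] smult_0[OF zero_closed] smult_0[OF mult_closed[OF zero_closed]]
  by simp

lemma mult_zero: "x \<in> carrier A \<Longrightarrow> x \<otimes>\<^bsub>A\<^esub> \<zero>\<^bsub>A\<^esub> = \<zero>\<^bsub>A\<^esub>"
  using smult_r[OF _ zero_closed, of x 0] smult_0[OF zero_closed] smult_0[OF mult_closed[OF _ zero_closed]]
  by simp

lemma co_zero: "co \<zero>\<^bsub>A\<^esub> = 0"
  using co_smult[OF zero_closed, of 0] smult_0[OF zero_closed] by simp

lemma zero_notin_B: "\<zero>\<^bsub>A\<^esub> \<notin> B"
  using co_B[of "\<zero>\<^bsub>A\<^esub>"] co_zero by (metis single_zero lookup_single_eq lookup_zero zero_neq_one)

lemma keys_expand_gen: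
  assumes "\<And>a. a \<in> set l \<Longrightarrow> keys (co a) \<subseteq> U"
  shows "keys (expand l) \<subseteq> {m. set m \<subseteq> U \<and> length m = length l}"
  using assms
proof (induction l)
  case (Cons a l)
  have *: "keys (lin_ext (\<lambda>m. single (p # m) (1::'k)) (expand l))
      \<subseteq> {m. set m \<subseteq> U \<and> length m = length (a # l)}" if "p \<in> U" for p
    by (rule keys_lin_ext[OF Cons.IH]) (use Cons.prems that in auto)
  show ?case
    unfolding expand.simps by (rule keys_lin_ext[of _ U]) (use Cons.prems * in auto)
qed auto

lemma keys_expand:
  "set l \<subseteq> carrier A \<Longrightarrow> keys (expand l) \<subseteq> {m. set m \<subseteq> B \<and> length m = length l}"
  by (rule keys_expand_gen) (use co_keys in auto)

lemma expand_B: "set l \<subseteq> B \<Longrightarrow> expand l = single l 1"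
  by (induction l) (auto simp: co_B)

lemma expand_add:
  "x \<in> carrier A \<Longrightarrow> y \<in> carrier A \<Longrightarrow>
   expand (us @ (x \<oplus>\<^bsub>A\<^esub> y) # vs) = expand (us @ x # vs) + expand (us @ y # vs)"
  by (induction us) (auto simp: co_add lin_ext_plus lin_ext_add_fun)

lemma expand_smult:
  "x \<in> carrier A \<Longrightarrow> expand (us @ (c \<odot>\<^bsub>A\<^esub> x) # vs) = pm_scale c (expand (us @ x # vs))"
  by (induction us) (auto simp: co_smult lin_ext_scale lin_ext_scale_fun)

lemma expand_zero: "\<zero>\<^bsub>A\<^esub> \<in> set l \<Longrightarrow> expand l = 0"
  using expand_smult[OF zero_closed, of _ 0] smult_0[OF zero_closed]
  by (auto simp: in_set_conv_decomp)

lemma Phi_tensor_rel: "x \<in> tensor_rel A L \<Longrightarrow> Phi x = 0"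
  using tensor_rel_induct[of Phi "{0}" A L x]
  by (simp add: expand_add expand_smult pmv.subspace_single_0)

lemma zero_tensor_rel:
  assumes "set l \<subseteq> carrier A" "\<zero>\<^bsub>A\<^esub> \<in> set l" "length l \<in> L"
  shows "single l c \<in> tensor_rel A L"
proof -
  obtain us vs where l: "l = us @ \<zero>\<^bsub>A\<^esub> # vs" using assms(2) by (auto simp: in_set_conv_decomp)
  have "single l 1 \<in> tensor_rel A L"
    using tensor_rel_smult[of us A "\<zero>\<^bsub>A\<^esub>" vs L 0] assms(1,3) smult_0[OF zero_closed]
    by (simp add: l)
  then show ?thesis
    using pmv.subspace_scale[OF subspace_tensor_rel, of "single l 1" A L c] by simp
qed

text \<open>
  Rewriting one factor in the basis changes a tensor by multilinearity relations only; the next lemma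
  does this for all factors, from left to right.
\<close>
lemma expand_slot:
  assumes "x \<in> carrier A" "set us \<subseteq> carrier A" "set vs \<subseteq> carrier A" "length us + 1 + length vs \<in> L"
  shows "single (us @ x # vs) 1
    - lin_ext (\<lambda>p. single (us @ p # vs) 1) (co x) \<in> tensor_rel A L"
  using assms(1)
proof (rule basis_induct)
  show "single (us @ \<zero>\<^bsub>A\<^esub> # vs) 1
    - lin_ext (\<lambda>p. single (us @ p # vs) 1) (co \<zero>\<^bsub>A\<^esub>) \<in> tensor_rel A L"
    using assms zero_closed by (auto simp: co_zero intro!: zero_tensor_rel)
next
  fix c b y
  let ?s = "\<lambda>p. single (us @ p # vs) (1::'k)"
  let ?e = "\<lambda>x. lin_ext ?s (co x)"
  assume b: "b \<in> B" and y: "y \<in> carrier A" and IH: "?s y - ?e y \<in> tensor_rel A L"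
  have bc: "b \<in> carrier A" using b B_carrier by auto
  have 1: "?s (c \<odot>\<^bsub>A\<^esub> b \<oplus>\<^bsub>A\<^esub> y) - ?s (c \<odot>\<^bsub>A\<^esub> b) - ?s y \<in> tensor_rel A L"
    using assms bc y smult_closed by (intro tensor_rel_add) auto
  have 2: "?s (c \<odot>\<^bsub>A\<^esub> b) - single (us @ b # vs) c \<in> tensor_rel A L"
    using assms bc by (intro tensor_rel_smult) auto
  have e: "?e (c \<odot>\<^bsub>A\<^esub> b \<oplus>\<^bsub>A\<^esub> y) = single (us @ b # vs) c + ?e y"
    using bc y smult_closed b by (simp add: co_add co_smult lin_ext_plus lin_ext_scale co_B)
  show "?s (c \<odot>\<^bsub>A\<^esub> b \<oplus>\<^bsub>A\<^esub> y) - ?e (c \<odot>\<^bsub>A\<^esub> b \<oplus>\<^bsub>A\<^esub> y) \<in> tensor_rel A L"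
    unfolding e using pmv.subspace_add[OF subspace_tensor_rel pmv.subspace_add[OF subspace_tensor_rel 1 2] IH]
    by (simp add: algebra_simps)
qed

lemma expand_congruent:
  assumes "set l \<subseteq> carrier A" "set us \<subseteq> carrier A" "length us + length l \<in> L"
  shows "single (us @ l) 1
    - lin_ext (\<lambda>m. single (us @ m) 1) (expand l) \<in> tensor_rel A L"
  using assms
proof (induction l arbitrary: us)
  case Nil
  then show ?case using pmv.subspace_0[OF subspace_tensor_rel] by simp
next
  case (Cons a l)
  let ?P = "\<lambda>us. lin_ext (\<lambda>m. single (us @ m) (1::'k))"
  have pre: "?P us (expand (a # l)) = lin_ext (\<lambda>p. ?P (us @ [p]) (expand l)) (co a)"
    by (simp add: klin_lin_ext_swap)
  have 1: "single (us @ a # l) 1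
    - lin_ext (\<lambda>p. single (us @ p # l) 1) (co a) \<in> tensor_rel A L"
    using Cons.prems by (intro expand_slot) auto
  have 2: "lin_ext (\<lambda>p. single (us @ p # l) 1) (co a)
      - lin_ext (\<lambda>p. ?P (us @ [p]) (expand l)) (co a) \<in> tensor_rel A L"
  proof -
    have "lin_ext (\<lambda>p. single (us @ p # l) 1 + pm_scale (- 1) (?P (us @ [p]) (expand l))) (co a) \<in> tensor_rel A L"
      using subspace_tensor_rel
    proof (rule klin_mem_subspace[OF klin_lin_ext])
      show "keys (co a) \<subseteq> B" using Cons.prems co_keys by auto
      fix p assume "p \<in> B"
      then show "lin_ext (\<lambda>p. single (us @ p # l) 1 + pm_scale (- 1) (?P (us @ [p]) (expand l)))
          (single p 1) \<in> tensor_rel A L"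
        using Cons.IH[of "us @ [p]"] Cons.prems B_carrier by (simp add: subset_iff)
    qed
    then show ?thesis by (simp only: lin_ext_add_fun lin_ext_scale_fun) simp
  qed
  show ?case
    unfolding pre using pmv.subspace_add[OF subspace_tensor_rel 1 2] by simp
qed

text \<open>
  As \<open>Phi\<close> vanishes on the relations, this shows that its kernel on chains consists exactly of the
  relations: \<open>Phi\<close> identifies the tensor power with the span of the lists over \<open>B\<close>.
\<close>
lemma Phi_congruent:
  assumes "x \<in> free_chains A L"
  shows "x - Phi x \<in> tensor_rel A L"
proof (rule klin_mem_subspace[where f = "\<lambda>x. x - Phi x", OF _ subspace_tensor_rel assms[unfolded free_chains_def mem_Collect_eq]])
  fix l assume "l \<in> {l. set l \<subseteq> carrier A \<and> length l \<in> L}"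
  then show "single l 1 - Phi (single l 1) \<in> tensor_rel A L"
    using expand_congruent[of l "[]" L] klin_expand[of "\<lambda>x. x" "expand l"] by (simp add: klin_id)
qed auto

text \<open>
  The basis of the tensor powers.
\<close>
definition G :: "'a list set" where
  "G = {l. set l \<subseteq> B}"

lemma keys_Phi:
  assumes "x \<in> free_chains A L"
  shows "keys (Phi x) \<subseteq> G \<inter> {l. length l \<in> L}"
  unfolding Phi_def
  by (rule keys_lin_ext[OF assms[unfolded free_chains_def mem_Collect_eq]])
    (use keys_expand in \<open>fastforce simp: G_def\<close>)

text \<open>
  A product of basis elements may be zero, so faces lead from lists over \<open>B\<close> to lists over
  \<open>B\<close> and zero. On those, \<open>Phi\<close> just discards the lists that contain a zero.
\<close>
lemma Phi_restr:
  assumes "keys x \<subseteq> {l. set l \<subseteq> insert \<zero>\<^bsub>A\<^esub> B}"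
  shows "Phi x = restr G x"
proof (rule klin_eqI[OF klin_Phi klin_restr assms])
  fix l assume l: "l \<in> {l. set l \<subseteq> insert \<zero>\<^bsub>A\<^esub> B}"
  show "Phi (single l 1) = restr G (single l 1)"
  proof (cases "\<zero>\<^bsub>A\<^esub> \<in> set l")
    case True
    then show ?thesis using zero_notin_B by (auto simp: restr_single expand_zero G_def)
  next
    case False
    then have "set l \<subseteq> B" using l by auto
    then show ?thesis by (auto simp: restr_single expand_B G_def)
  qed
qed

lemma Phi_id: "keys x \<subseteq> G \<Longrightarrow> Phi x = x"
  by (subst Phi_restr) (auto simp: G_def restr_id)

end

section \<open>Operators built from faces and rotations\<close>

text \<open>
  The Hochschild and the cyclic differential are combinations of faces and rotations whose
  coefficients depend on the length of the tensor only. Recording these combinations as data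
  (\<open>ops\<close>, indexed by the length) allows one statement to cover both differentials, and makes it
  evident that the same combination acts for \<open>A\<close> and for its cycle algebras.
\<close>
datatype gen = Face nat | Rot nat

fun act :: "('k, 'a) module \<Rightarrow> gen \<Rightarrow> 'a list \<Rightarrow> 'a list" where
  "act A (Face i) l = face A i l"
| "act A (Rot j) l = rotate j l"

fun valid_gen :: "gen \<Rightarrow> nat \<Rightarrow> bool" where
  "valid_gen (Face i) m \<longleftrightarrow> i < m \<and> 2 \<le> m"
| "valid_gen (Rot j) m \<longleftrightarrow> True"

fun out_length :: "gen \<Rightarrow> nat \<Rightarrow> nat" where
  "out_length (Face i) m = m - 1"
| "out_length (Rot j) m = m"

lemma face_inner: "face A (length us) (us @ a # b # vs) = us @ (a \<otimes>\<^bsub>A\<^esub> b) # vs"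
  by (simp add: face_def nth_append)

lemma face_outer: "face A (Suc (length us)) (a # us @ [z]) = (z \<otimes>\<^bsub>A\<^esub> a) # us"
  by (simp add: face_def)

lemma face_cases:
  assumes "i < length l" "2 \<le> length l"
  obtains us a b vs where "l = us @ a # b # vs" "i = length us"
    | us a z where "l = a # us @ [z]" "i = Suc (length us)"
proof (cases "i + 1 < length l")
  case True
  then have "drop i l = l ! i # l ! (i + 1) # drop (i + 2) l"
    using Cons_nth_drop_Suc[of i l] Cons_nth_drop_Suc[of "i + 1" l] by simp
  then have "l = take i l @ l ! i # l ! (i + 1) # drop (i + 2) l"
    by (metis append_take_drop_id)
  with that(1) True show ?thesis by (metis length_take min.absorb4 assms(1))
next
  case False
  obtain a us z where l: "l = a # us @ [z]"
    using assms(2) by (cases l; cases "tl l" rule: rev_cases) auto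
  then show ?thesis using that(2)[of a us z] False assms(1) by auto
qed

lemma length_act: "valid_gen g (length l) \<Longrightarrow> length (act A g l) = out_length g (length l)"
  by (cases g) (auto simp: face_def)

lemma set_act:
  assumes "valid_gen g (length l)" "\<And>x y. x \<in> set l \<Longrightarrow> y \<in> set l \<Longrightarrow> x \<otimes>\<^bsub>A\<^esub> y \<in> S" "set l \<subseteq> S"
  shows "set (act A g l) \<subseteq> S"
proof (cases g)
  case (Face i)
  then have "i < length l" "2 \<le> length l" using assms(1) by auto
  then show ?thesis
    by (cases rule: face_cases) (use assms in \<open>auto simp: Face face_inner face_outer\<close>)
qed (use assms in auto)

definition linear_on :: "('k::field, 'a) module \<Rightarrow> ('a \<Rightarrow> 'a) \<Rightarrow> bool" where
  "linear_on A \<phi> \<longleftrightarrow> (\<forall>x\<in>carrier A. \<phi> x \<in> carrier A)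
     \<and> (\<forall>x\<in>carrier A. \<forall>y\<in>carrier A. \<phi> (x \<oplus>\<^bsub>A\<^esub> y) = \<phi> x \<oplus>\<^bsub>A\<^esub> \<phi> y)
     \<and> (\<forall>c. \<forall>x\<in>carrier A. \<phi> (c \<odot>\<^bsub>A\<^esub> x) = c \<odot>\<^bsub>A\<^esub> \<phi> x)"

text \<open>
  If all entries but one are fixed, a face or a rotation moves the remaining entry to some slot and
  multiplies it by fixed elements. This is why these operators respect multilinearity.
\<close>
definition slotwise :: "('k::field, 'a) module \<Rightarrow> ('a list \<Rightarrow> 'a list) \<Rightarrow> 'a list \<Rightarrow> 'a list \<Rightarrow> bool" where
  "slotwise A h us vs \<longleftrightarrow> (\<exists>us' vs' \<phi>. set us' \<subseteq> carrier A \<and> set vs' \<subseteq> carrier A \<and> linear_on A \<phi>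
     \<and> (\<forall>x. h (us @ x # vs) = us' @ \<phi> x # vs'))"

lemma slotwiseI:
  "set us' \<subseteq> carrier A \<Longrightarrow> set vs' \<subseteq> carrier A \<Longrightarrow> linear_on A \<phi> \<Longrightarrow>
    (\<And>x. h (us @ x # vs) = us' @ \<phi> x # vs') \<Longrightarrow> slotwise A h us vs"
  unfolding slotwise_def by blast

context multiplicative_basis
begin

lemma linear_on_id: "linear_on A (\<lambda>x. x)"
  by (simp add: linear_on_def)

lemma linear_on_l: "a \<in> carrier A \<Longrightarrow> linear_on A (\<lambda>x. a \<otimes>\<^bsub>A\<^esub> x)"
  and linear_on_r: "a \<in> carrier A \<Longrightarrow> linear_on A (\<lambda>x. x \<otimes>\<^bsub>A\<^esub> a)"
  by (auto simp: linear_on_def mult_closed l_distr r_distr smult_l smult_r)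

lemma slotwise_rotate:
  assumes "set us \<subseteq> carrier A" "set vs \<subseteq> carrier A"
  shows "slotwise A (rotate j) us vs"
proof (induction j)
  case 0
  then show ?case using assms linear_on_id by (intro slotwiseI) auto
next
  case (Suc j)
  then obtain us' vs' \<phi> where *: "set us' \<subseteq> carrier A" "set vs' \<subseteq> carrier A" "linear_on A \<phi>"
    "\<And>x. rotate j (us @ x # vs) = us' @ \<phi> x # vs'"
    unfolding slotwise_def by blast
  show ?case
  proof (cases us')
    case Nil
    then show ?thesis using * by (intro slotwiseI[of vs' _ "[]" \<phi>]) auto
  next
    case (Cons a u)
    then show ?thesis using * by (intro slotwiseI[of u _ "vs' @ [a]" \<phi>]) auto
  qed
qed

lemma slotwise_face:
  assumes us: "set us \<subseteq> carrier A" and vs: "set vs \<subseteq> carrier A"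
    and i: "i < length us + 1 + length vs" "2 \<le> length us + 1 + length vs"
  shows "slotwise A (face A i) us vs"
proof -
  let ?m = "length us + 1 + length vs"
  consider "i + 1 < length us" | "i + 1 = length us" | "i = length us" "i + 1 < ?m"
    | "length us < i" "i + 1 < ?m" | "i + 1 = ?m" "us = []" | "i + 1 = ?m" "vs = []" "us \<noteq> []"
    | "i + 1 = ?m" "vs \<noteq> []" "us \<noteq> []"
    using i by linarith
  then show ?thesis
  proof cases
    case 1
    then obtain u1 a b u2 where u: "us = u1 @ a # b # u2" "i = length u1"
      by (rule_tac face_cases[of i us]) auto
    have f: "face A i (us @ x # vs) = (u1 @ (a \<otimes>\<^bsub>A\<^esub> b) # u2) @ x # vs" for x
      using face_inner[of A u1 a b "u2 @ x # vs"] u by simp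
    show ?thesis
      using us vs u mult_closed linear_on_id f
      by (intro slotwiseI[of "u1 @ (a \<otimes>\<^bsub>A\<^esub> b) # u2" A vs "\<lambda>x. x"]) auto
  next
    case 2
    then obtain u1 a where u: "us = u1 @ [a]" "i = length u1" by (cases us rule: rev_cases) auto
    then show ?thesis
      using us vs face_inner[of A u1 a _ vs] linear_on_l[of a]
      by (intro slotwiseI[of u1 _ vs]) auto
  next
    case 3
    then obtain b v2 where v: "vs = b # v2" by (cases vs) auto
    then show ?thesis
      using us vs face_inner[of A us _ b v2] linear_on_r[of b] 3
      by (intro slotwiseI[of us _ v2]) auto
  next
    case 4
    then obtain v1 a b v2 where v: "vs = v1 @ a # b # v2" "i - length us - 1 = length v1"
      by (rule_tac face_cases[of "i - length us - 1" vs]) auto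
    have i': "i = Suc (length us + length v1)" using v 4 by simp
    have "face A i (us @ x # vs) = us @ x # (v1 @ (a \<otimes>\<^bsub>A\<^esub> b) # v2)" for x
      using face_inner[of A "us @ x # v1" a b v2] v 4 by (simp add: i')
    then show ?thesis
      using us vs v mult_closed linear_on_id
      by (intro slotwiseI[of us A "v1 @ (a \<otimes>\<^bsub>A\<^esub> b) # v2" "\<lambda>x. x"]) auto
  next
    case 5
    then obtain v1 z where v: "vs = v1 @ [z]" using i by (cases vs rule: rev_cases) auto
    then show ?thesis
      using us vs face_outer[of A v1 _ z] linear_on_l[of z] 5
      by (intro slotwiseI[of "[]" _ v1]) auto
  next
    case 6
    then obtain a u where u: "us = a # u" by (cases us) auto
    then show ?thesis
      using us vs face_outer[of A u a] linear_on_r[of a] 6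
      by (intro slotwiseI[of "[]" _ u]) auto
  next
    case 7
    then obtain a u where u: "us = a # u" by (cases us) auto
    from 7 obtain v z where v: "vs = v @ [z]" by (cases vs rule: rev_cases) auto
    have "face A i (us @ x # vs) = ((z \<otimes>\<^bsub>A\<^esub> a) # u) @ x # v" for x
      using face_outer[of A "u @ x # v" a z] 7 by (simp add: u v)
    then show ?thesis
      using us vs u v mult_closed linear_on_id
      by (intro slotwiseI[of "(z \<otimes>\<^bsub>A\<^esub> a) # u" A v "\<lambda>x. x"]) auto
  qed
qed

lemma slotwise_act:
  assumes "set us \<subseteq> carrier A" "set vs \<subseteq> carrier A" "valid_gen g (length us + 1 + length vs)"
  shows "slotwise A (act A g) us vs"
  using assms slotwise_rotate slotwise_face by (cases g) (auto simp: slotwise_def)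

end

definition op_of :: "('k::field, 'a) module \<Rightarrow> (nat \<Rightarrow> ('k \<times> gen) list) \<Rightarrow> ('a list \<Rightarrow>\<^sub>0 'k) \<Rightarrow> ('a list \<Rightarrow>\<^sub>0 'k)" where
  "op_of A ops = lin_ext (\<lambda>l. \<Sum>(c, g)\<leftarrow>ops (length l). single (act A g l) c)"

definition ops_map :: "(nat \<Rightarrow> ('k \<times> gen) list) \<Rightarrow> nat set \<Rightarrow> nat set \<Rightarrow> bool" where
  "ops_map ops L L' \<longleftrightarrow> (\<forall>m\<in>L. \<forall>(c, g)\<in>set (ops m). valid_gen g m \<and> out_length g m \<in> L')"

lemma klin_op_of [intro!, simp]: "klin (op_of A ops)"
  by (simp add: op_of_def)

lemma op_of_single:
  "op_of A ops (single l 1) = (\<Sum>(c, g)\<leftarrow>ops (length l). single (act A g l) c)"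
  by (simp add: op_of_def)

lemma subspace_sum_list:
  "pmv.subspace W \<Longrightarrow> (\<And>x. x \<in> set xs \<Longrightarrow> f x \<in> W) \<Longrightarrow> (\<Sum>x\<leftarrow>xs. f x) \<in> W"
  by (induction xs) (auto simp: pmv.subspace_0 pmv.subspace_add)

lemma keys_op_of_single:
  assumes "\<And>c g. (c, g) \<in> set (ops (length l)) \<Longrightarrow> act A g l \<in> S"
  shows "keys (op_of A ops (single l 1)) \<subseteq> S"
proof -
  have "(\<Sum>(c, g)\<leftarrow>ops (length l). single (act A g l) c) \<in> {x. keys x \<subseteq> S}"
    by (rule subspace_sum_list[OF subspace_keys]) (use assms in \<open>auto split: if_splits\<close>)
  then show ?thesis by (simp add: op_of_single)
qed

lemma keys_op_of:
  assumes "keys x \<subseteq> S" "\<And>l c g. l \<in> S \<Longrightarrow> (c, g) \<in> set (ops (length l)) \<Longrightarrow> act A g l \<in> S'"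
  shows "keys (op_of A ops x) \<subseteq> S'"
proof -
  have "op_of A ops x \<in> {x. keys x \<subseteq> S'}"
    by (rule klin_mem_subspace[OF klin_op_of subspace_keys assms(1)])
      (use keys_op_of_single assms(2) in blast)
  then show ?thesis by simp
qed

context multiplicative_basis
begin

lemma op_of_free_chains:
  assumes "ops_map ops L L'" "x \<in> free_chains A L"
  shows "op_of A ops x \<in> free_chains A L'"
proof -
  have "act A g l \<in> {l. set l \<subseteq> carrier A \<and> length l \<in> L'}"
    if "l \<in> {l. set l \<subseteq> carrier A \<and> length l \<in> L}" "(c, g) \<in> set (ops (length l))" for l c g
    using that assms(1) set_act[of g l A "carrier A"] length_act[of g l A] mult_closed
    unfolding ops_map_def by (fastforce simp: subset_iff)
  then show ?thesis
    using keys_op_of[OF assms(2)[unfolded free_chains_def mem_Collect_eq]]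
    unfolding free_chains_def by blast
qed

lemma op_of_tensor_rel:
  assumes ops: "ops_map ops L L'" and x: "x \<in> tensor_rel A L"
  shows "op_of A ops x \<in> tensor_rel A L'"
proof (rule tensor_rel_induct[OF klin_op_of subspace_tensor_rel _ _ x])
  fix us x y vs
  assume carr: "set us \<subseteq> carrier A" "x \<in> carrier A" "y \<in> carrier A" "set vs \<subseteq> carrier A"
    and len: "length us + 1 + length vs \<in> L"
  let ?m = "length us + 1 + length vs"
  let ?s = "\<lambda>c g z. single (act A g (us @ z # vs)) (c::'k)"
  have one: "?s c g (x \<oplus>\<^bsub>A\<^esub> y) - ?s c g x - ?s c g y \<in> tensor_rel A L'"
    if cg: "(c, g) \<in> set (ops ?m)" for c g
  proof -
    have v: "valid_gen g ?m" "out_length g ?m \<in> L'"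
      using ops len cg by (auto simp: ops_map_def)
    obtain us' vs' \<phi> where *: "set us' \<subseteq> carrier A" "set vs' \<subseteq> carrier A" "linear_on A \<phi>"
      "\<And>x. act A g (us @ x # vs) = us' @ \<phi> x # vs'"
      using slotwise_act[of us vs g] carr v unfolding slotwise_def by auto
    have "length us' + 1 + length vs' \<in> L'"
      using length_act[of g "us @ x # vs" A] *(4) v by simp
    then have "single (us' @ (\<phi> x \<oplus>\<^bsub>A\<^esub> \<phi> y) # vs') 1
      - single (us' @ \<phi> x # vs') 1 - single (us' @ \<phi> y # vs') 1 \<in> tensor_rel A L'"
      using * carr by (intro tensor_rel_add) (auto simp: linear_on_def)
    then show ?thesis
      using pmv.subspace_scale[OF subspace_tensor_rel, of _ A L' c] *(3,4) carr
      by (fastforce simp: linear_on_def pmv.scale_right_diff_distrib)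
  qed
  have "(\<Sum>(c, g)\<leftarrow>ops ?m. ?s c g (x \<oplus>\<^bsub>A\<^esub> y) - ?s c g x - ?s c g y) \<in> tensor_rel A L'"
    by (rule subspace_sum_list[OF subspace_tensor_rel]) (use one in auto)
  then show "op_of A ops (single (us @ (x \<oplus>\<^bsub>A\<^esub> y) # vs) 1)
    - op_of A ops (single (us @ x # vs) 1)
    - op_of A ops (single (us @ y # vs) 1) \<in> tensor_rel A L'"
    by (simp add: op_of_single sum_list_subtractf case_prod_unfold)
next
  fix us c x vs
  assume carr: "set us \<subseteq> carrier A" "x \<in> carrier A" "set vs \<subseteq> carrier A"
    and len: "length us + 1 + length vs \<in> L"
  let ?m = "length us + 1 + length vs"
  let ?s = "\<lambda>d g z. single (act A g (us @ z # vs)) (d::'k)"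
  have one: "?s d g (c \<odot>\<^bsub>A\<^esub> x) - pm_scale c (?s d g x) \<in> tensor_rel A L'"
    if cg: "(d, g) \<in> set (ops ?m)" for d g
  proof -
    have v: "valid_gen g ?m" "out_length g ?m \<in> L'"
      using ops len cg by (auto simp: ops_map_def)
    obtain us' vs' \<phi> where *: "set us' \<subseteq> carrier A" "set vs' \<subseteq> carrier A" "linear_on A \<phi>"
      "\<And>x. act A g (us @ x # vs) = us' @ \<phi> x # vs'"
      using slotwise_act[of us vs g] carr v unfolding slotwise_def by auto
    have "length us' + 1 + length vs' \<in> L'"
      using length_act[of g "us @ x # vs" A] *(4) v by simp
    then have "single (us' @ (c \<odot>\<^bsub>A\<^esub> \<phi> x) # vs') 1
      - single (us' @ \<phi> x # vs') c \<in> tensor_rel A L'"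
      using * carr by (intro tensor_rel_smult) (auto simp: linear_on_def)
    then show ?thesis
      using pmv.subspace_scale[OF subspace_tensor_rel, of _ A L' d] *(3,4) carr
      by (fastforce simp: linear_on_def pmv.scale_right_diff_distrib mult.commute)
  qed
  have "(\<Sum>(d, g)\<leftarrow>ops ?m. ?s d g (c \<odot>\<^bsub>A\<^esub> x) - pm_scale c (?s d g x)) \<in> tensor_rel A L'"
    by (rule subspace_sum_list[OF subspace_tensor_rel]) (use one in auto)
  moreover have "pm_scale c (\<Sum>(d, g)\<leftarrow>xs. ?s d g x) = (\<Sum>(d, g)\<leftarrow>xs. pm_scale c (?s d g x))" for xs
    by (induction xs) (auto simp: pmv.scale_right_distrib)
  ultimately show "op_of A ops (single (us @ (c \<odot>\<^bsub>A\<^esub> x) # vs) 1)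
    - pm_scale c (op_of A ops (single (us @ x # vs) 1)) \<in> tensor_rel A L'"
    by (simp add: op_of_single sum_list_subtractf case_prod_unfold)
qed

lemma op_of_keys_zero:
  assumes "ops_map ops L L'" "keys x \<subseteq> {l. set l \<subseteq> insert \<zero>\<^bsub>A\<^esub> B \<and> length l \<in> L}"
  shows "keys (op_of A ops x) \<subseteq> {l. set l \<subseteq> insert \<zero>\<^bsub>A\<^esub> B \<and> length l \<in> L'}"
proof (rule keys_op_of[OF assms(2)])
  fix l c g assume l: "l \<in> {l. set l \<subseteq> insert \<zero>\<^bsub>A\<^esub> B \<and> length l \<in> L}" "(c, g) \<in> set (ops (length l))"
  then have v: "valid_gen g (length l)" "out_length g (length l) \<in> L'"
    using assms(1) by (auto simp: ops_map_def)
  have "set (act A g l) \<subseteq> insert \<zero>\<^bsub>A\<^esub> B"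
  proof (rule set_act[OF v(1)])
    fix x y assume "x \<in> set l" "y \<in> set l"
    then have "x \<in> insert \<zero>\<^bsub>A\<^esub> B" "y \<in> insert \<zero>\<^bsub>A\<^esub> B" using l by auto
    then show "x \<otimes>\<^bsub>A\<^esub> y \<in> insert \<zero>\<^bsub>A\<^esub> B"
      using B_mult B_carrier zero_closed mult_zero[of x] zero_mult[of y] by blast
  qed (use l in auto)
  then show "act A g l \<in> {l. set l \<subseteq> insert \<zero>\<^bsub>A\<^esub> B \<and> length l \<in> L'}"
    using length_act[OF v(1), of A] v by auto
qed

text \<open>
  Under the identification \<open>Phi\<close>, an operator becomes its restriction to the lists over
  \<open>B\<close> followed by discarding the lists that contain a zero.
\<close>
lemma Phi_op_of:
  assumes ops: "ops_map ops L L'" and x: "x \<in> free_chains A L"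
  shows "Phi (op_of A ops x) = restr G (op_of A ops (Phi x))"
proof -
  have "op_of A ops (x - Phi x) \<in> tensor_rel A L'"
    by (rule op_of_tensor_rel[OF ops Phi_congruent[OF x]])
  then have "Phi (op_of A ops x) = Phi (op_of A ops (Phi x))"
    using Phi_tensor_rel[of "op_of A ops (x - Phi x)" L']
    by (simp add: klin_minus[OF klin_op_of] klin_minus[OF klin_Phi])
  also have "\<dots> = restr G (op_of A ops (Phi x))"
  proof (rule Phi_restr)
    have "keys (Phi x) \<subseteq> {l. set l \<subseteq> insert \<zero>\<^bsub>A\<^esub> B \<and> length l \<in> L}"
      using keys_Phi[OF x] by (auto simp: G_def)
    from op_of_keys_zero[OF ops this]
    show "keys (op_of A ops (Phi x)) \<subseteq> {l. set l \<subseteq> insert \<zero>\<^bsub>A\<^esub> B}" by auto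
  qed
  finally show ?thesis .
qed

end

section \<open>The Hochschild and cyclic differentials\<close>

text \<open>
  The operators \<open>b\<close>, \<open>b'\<close>, \<open>t\<close>, \<open>N\<close> and the
  differential of the total complex. As \<open>t\<close> moves the last entry to the front, it is the
  rotation by \<open>m - 1\<close> in length \<open>m\<close>; \<open>Rot 0\<close> is the identity.
\<close>
definition hoch_ops :: "nat \<Rightarrow> ('k::field \<times> gen) list" where
  "hoch_ops m = (if m \<le> 1 then [] else map (\<lambda>i. ((- 1) ^ i, Face i)) [0..<m])"

definition bar_ops :: "nat \<Rightarrow> ('k::field \<times> gen) list" where
  "bar_ops m = map (\<lambda>i. ((- 1) ^ i, Face i)) [0..<m - 1]"

definition t_ops :: "nat \<Rightarrow> ('k::field \<times> gen) list" where
  "t_ops m = [((- 1) ^ (m - 1), Rot (m - 1))]"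

definition N_ops :: "nat \<Rightarrow> ('k::field \<times> gen) list" where
  "N_ops m = map (\<lambda>i. ((- 1) ^ ((m - 1) * i), Rot ((m - 1) * i))) [0..<m]"

definition neg_ops :: "('k::field \<times> gen) list \<Rightarrow> ('k \<times> gen) list" where
  "neg_ops = map (\<lambda>(c, g). (- c, g))"

definition cyc_ops :: "nat \<Rightarrow> nat \<Rightarrow> ('k::field \<times> gen) list" where
  "cyc_ops n m = (let p = n + 1 - m in
     if p = 0 then hoch_ops m
     else if even p then hoch_ops m @ N_ops m
     else neg_ops (bar_ops m) @ (1, Rot 0) # neg_ops (t_ops m))"

lemma ops_map_hoch: "ops_map hoch_ops {n + 2} {n + 1}"
  by (auto simp: ops_map_def hoch_ops_def)

lemma ops_map_cyc: "ops_map (cyc_ops (n + 1)) {1..n + 2} {1..n + 1}"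
  by (auto simp: ops_map_def cyc_ops_def Let_def hoch_ops_def N_ops_def bar_ops_def neg_ops_def t_ops_def
    split: if_splits)

lemma sum_list_neg_ops:
  "(\<Sum>(c, g)\<leftarrow>neg_ops xs. single (act A g l) (c::'k::field))
    = - (\<Sum>(c, g)\<leftarrow>xs. single (act A g l) c)"
  by (induction xs) (auto simp: neg_ops_def single_uminus)

lemma sum_list_upt: "(\<Sum>i\<leftarrow>[0..<m]. f i) = (\<Sum>i<m. f i)"
  by (simp add: interv_sum_list_conv_sum_set_nat atLeast0LessThan)

lemma hoch_single:
  "op_of A hoch_ops (single l 1) = (if length l \<le> 1 then 0
     else \<Sum>i<length l. single (face A i l) ((- 1) ^ i))"
  by (simp add: op_of_single hoch_ops_def comp_def sum_list_upt)

lemma bar_single: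
  "op_of A bar_ops (single l 1)
     = (\<Sum>i<length l - 1. single (face A i l) ((- 1) ^ i))"
  by (simp add: op_of_single bar_ops_def comp_def sum_list_upt)

lemma t_single:
  "op_of A t_ops (single l 1)
     = single (rotate (length l - 1) l) ((- 1) ^ (length l - 1))"
  by (simp add: op_of_single t_ops_def)

lemma N_single:
  "op_of A N_ops (single l 1)
     = (\<Sum>i<length l. single (rotate ((length l - 1) * i) l) ((- 1) ^ ((length l - 1) * i)))"
  by (simp add: op_of_single N_ops_def comp_def sum_list_upt)

lemma hoch_b_eq: "hoch_b A = op_of A hoch_ops"
  unfolding hoch_b_def op_of_def
  by (rule arg_cong[where f = lin_ext], rule ext)
    (simp add: hoch_ops_def comp_def sum_list_upt)

lemma hoch_b'_eq: "hoch_b' A = op_of A bar_ops"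
  unfolding hoch_b'_def op_of_def
  by (rule arg_cong[where f = lin_ext], rule ext)
    (simp add: bar_ops_def comp_def sum_list_upt)

lemma rotate_last: "l \<noteq> [] \<Longrightarrow> rotate (length l - 1) l = last l # butlast l"
  using rotate_append[of "butlast l" "[last l]"] by simp

lemma cyc_t_single:
  "l \<noteq> [] \<Longrightarrow> cyc_t (single l c)
    = single (rotate (length l - 1) l) (c * (- 1) ^ (length l - 1))"
  by (simp add: cyc_t_def rotate_last del: One_nat_def)

lemma cyc_t_power_single:
  "l \<noteq> [] \<Longrightarrow> (cyc_t ^^ i) (single l 1)
    = single (rotate ((length l - 1) * i) l) ((- 1) ^ ((length l - 1) * i))"
  by (induction i) (simp_all add: cyc_t_single rotate_rotate power_add mult.commute)

lemma cyc_N_single: "l \<noteq> [] \<Longrightarrow> cyc_N (single l 1) = op_of A N_ops (single l 1)"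
  by (simp add: cyc_N_def cyc_t_power_single N_single)

lemma cyc_ops_single:
  "op_of A (cyc_ops n) (single l 1) = (let p = n + 1 - length l; x = single l 1 in
     if p = 0 then op_of A hoch_ops x
     else if even p then op_of A hoch_ops x + op_of A N_ops x
     else - op_of A bar_ops x + (x - op_of A t_ops x))"
  by (simp add: cyc_ops_def Let_def op_of_single sum_list_neg_ops)

lemma cyc_D_eq:
  assumes "keys x \<subseteq> {l. l \<noteq> []}"
  shows "cyc_D A n x = op_of A (cyc_ops n) x"
proof (rule klin_eqI[OF _ klin_op_of assms])
  fix l :: "'a list" assume "l \<in> {l. l \<noteq> []}"
  then have "l \<noteq> []" by simp
  then show "cyc_D A n (single l 1) = op_of A (cyc_ops n) (single l 1)"
    unfolding cyc_ops_single
    by (simp add: cyc_D_def Let_def hoch_b_eq hoch_b'_eq cyc_N_single cyc_t_single t_single)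
qed (simp add: cyc_D_def)

lemma klin_if: "klin f \<Longrightarrow> klin g \<Longrightarrow> klin (\<lambda>x. if P then f x else g x)"
  by (cases P) auto

lemma cyc_op_pure:
  assumes "keys x \<subseteq> {l. length l = m}"
  shows "op_of A (cyc_ops n) x = (let p = n + 1 - m in
     if p = 0 then op_of A hoch_ops x
     else if even p then op_of A hoch_ops x + op_of A N_ops x
     else - op_of A bar_ops x + (x - op_of A t_ops x))"
proof (rule klin_eqI[where g = "\<lambda>x. let p = n + 1 - m in
     if p = 0 then op_of A hoch_ops x
     else if even p then op_of A hoch_ops x + op_of A N_ops x
     else - op_of A bar_ops x + (x - op_of A t_ops x)", OF klin_op_of _ assms])
  show "klin (\<lambda>x. let p = n + 1 - m in
     if p = 0 then op_of A hoch_ops x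
     else if even p then op_of A hoch_ops x + op_of A N_ops x
     else - op_of A bar_ops x + (x - op_of A t_ops x))"
    unfolding Let_def by (intro klin_if klin_add klin_diff klin_neg klin_op_of klin_id)
qed (auto simp: cyc_ops_single Let_def)

subsection \<open>Commutation of faces with rotations\<close>

lemma face_0_rotate:
  assumes "2 \<le> length l"
  shows "face A 0 (rotate (length l - 1) l) = face A (length l - 1) l"
proof -
  obtain a us z where l: "l = a # us @ [z]"
    using assms by (cases l; cases "tl l" rule: rev_cases) auto
  then show ?thesis
    using rotate_last[of l] face_outer[of A us a z] face_inner[of A "[]" z a us] by simp
qed

lemma face_Suc_rotate:
  assumes "Suc i < length l"
  shows "face A (Suc i) (rotate (length l - 1) l) = rotate (length l - 2) (face A i l)"
proof -
  have ne: "l \<noteq> []" "2 \<le> length l" using assms by auto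
  have r: "rotate (length l - 2) (face A i l) = last (face A i l) # butlast (face A i l)"
    using rotate_last[of "face A i l"] length_act[of "Face i" l A] assms
    by (cases "face A i l = []") (auto simp: numeral_2_eq_2)
  obtain l' z where l: "l = l' @ [z]" using ne by (cases l rule: rev_cases) auto
  have rl: "rotate (length l - 1) l = z # l'" using rotate_last[OF ne(1)] l by simp
  have il: "i < length l" using assms by simp
  consider (1) us a b vs where "l = us @ a # b # vs" "i = length us"
    | (2) us a z where "l = a # us @ [z]" "i = Suc (length us)"
    using face_cases[OF il ne(2)] by metis
  then show ?thesis
  proof cases
    case 1
    show ?thesis
    proof (cases vs rule: rev_cases)
      case Nil
      then have "l' = us @ [a]" "b = z" using l 1 by auto
      then show ?thesis
        unfolding r rl using 1 Nil face_inner[of A us a b vs] face_outer[of A us z a] by simp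
    next
      case (snoc vs' w)
      then have "l' = us @ a # b # vs'" "w = z" using l 1 by auto
      then show ?thesis
        unfolding r rl using 1 snoc face_inner[of A us a b vs] face_inner[of A "z # us" a b vs']
        by (simp add: butlast_append)
    qed
  next
    case 2
    then show ?thesis using assms by simp
  qed
qed

lemma length_face: "i < length l \<Longrightarrow> 2 \<le> length l \<Longrightarrow> length (face A i l) = length l - 1"
  using length_act[of "Face i" l A] by simp

lemma face_rotate_power:
  assumes "i < length l" "k \<le> i" "2 \<le> length l"
  shows "face A i (rotate ((length l - 1) * k) l) = rotate ((length l - 2) * k) (face A (i - k) l)"
  using assms(1,2)
proof (induction k arbitrary: i)
  case (Suc k)
  let ?m = "length l"
  let ?r = "rotate ((length l - 1) * k) l"
  obtain i' where i: "i = Suc i'" using Suc.prems by (cases i) auto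
  have "face A i (rotate ((?m - 1) * Suc k) l) = face A (Suc i') (rotate (length ?r - 1) ?r)"
    by (simp add: rotate_rotate i)
  also have "\<dots> = rotate (length ?r - 2) (face A i' ?r)"
    using Suc.prems i by (intro face_Suc_rotate) auto
  also have "face A i' ?r = rotate ((?m - 2) * k) (face A (i' - k) l)"
    using Suc.prems i by (intro Suc.IH) auto
  finally show ?case by (simp add: rotate_rotate i)
qed simp

subsection \<open>The identities of the cyclic bicomplex\<close>

text \<open>
  With signed faces \<open>d\<^sub>i\<close> one has \<open>d\<^sub>i t = t d\<^sub>i\<^sub>-\<^sub>1\<close> for \<open>i > 0\<close>
  and \<open>d\<^sub>0 t = d\<^sub>n\<close>, where \<open>d\<^sub>n\<close> is the last face. So \<open>b t\<close> is
  \<open>d\<^sub>n\<close> plus \<open>t b'\<close>, and \<open>b\<close> is \<open>b'\<close> plus \<open>d\<^sub>n\<close>.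
\<close>
lemma b_t_identity:
  assumes "keys x \<subseteq> {l. 2 \<le> length l}"
  shows "op_of A hoch_ops (x - op_of A t_ops x) = op_of A bar_ops x - op_of A t_ops (op_of A bar_ops x)"
proof (rule klin_eqI[where f = "\<lambda>x. op_of A hoch_ops (x - op_of A t_ops x)"
      and g = "\<lambda>x. op_of A bar_ops x - op_of A t_ops (op_of A bar_ops x)", OF _ _ assms])
  fix l :: "'a list" assume "l \<in> {l. 2 \<le> length l}"
  then obtain n where n: "length l = n + 1" "1 \<le> n" by (cases "length l") auto
  let ?s = "\<lambda>i l. single (face A i l) ((- 1) ^ i :: 'b)"
  let ?r = "rotate n l"
  have b: "op_of A hoch_ops (single l 1) = (\<Sum>i<n. ?s i l) + ?s n l"
    using n by (simp add: hoch_single)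
  have b': "op_of A bar_ops (single l 1) = (\<Sum>i<n. ?s i l)"
    using n by (simp add: bar_single)
  have t: "op_of A t_ops (single l 1) = pm_scale ((- 1) ^ n) (single ?r 1)"
    using n by (simp add: t_single)
  have bt: "op_of A hoch_ops (single ?r 1) = ?s 0 ?r + (\<Sum>i<n. ?s (Suc i) ?r)"
    using n sum.lessThan_Suc_shift[of "\<lambda>i. ?s i ?r" n] by (simp add: hoch_single)
  have r0: "pm_scale ((- 1) ^ n) (?s 0 ?r) = ?s n l"
    using face_0_rotate[of l A] n by simp
  have tb': "op_of A t_ops (\<Sum>i<n. ?s i l) = (\<Sum>i<n. pm_scale ((- 1) ^ n) (?s (Suc i) ?r))"
  proof -
    have "op_of A t_ops (?s i l) = pm_scale ((- 1) ^ n) (?s (Suc i) ?r)" if i: "i < n" for i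
    proof -
      have len: "length (face A i l) = n" using length_face[of i l A] n i by simp
      have "op_of A t_ops (?s i l) = pm_scale ((- 1) ^ i) (op_of A t_ops (single (face A i l) 1))"
        by (simp flip: klin_scale[OF klin_op_of])
      also have "\<dots> = single (rotate (n - 1) (face A i l)) ((- 1) ^ (i + (n - 1)))"
        by (simp add: t_single len power_add)
      also have "rotate (n - 1) (face A i l) = face A (Suc i) ?r"
        using face_Suc_rotate[of i l A] n i by simp
      finally show ?thesis using n
        by (cases n) (auto simp: power_add mult.commute)
    qed
    then show ?thesis by (simp add: klin_sum[OF klin_op_of])
  qed
  show "op_of A hoch_ops (single l 1 - op_of A t_ops (single l 1)) =
    op_of A bar_ops (single l 1) - op_of A t_ops (op_of A bar_ops (single l 1))"
    unfolding klin_minus[OF klin_op_of] t klin_scale[OF klin_op_of] b bt b' tb' pmv.scale_right_distrib r0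
      pmv.scale_sum_right by simp
qed (intro klin_comp[OF klin_op_of] klin_diff klin_id klin_op_of)+

lemma rotate_full: "rotate (length l * k) l = l"
  by (simp add: rotate_drop_take)

text \<open>
  Signs included, the rotation has order the length \<open>m\<close> of the tensor, since
  \<open>m (m - 1)\<close> is even.
\<close>
lemma N_t_identity:
  assumes "keys x \<subseteq> {l. l \<noteq> []}"
  shows "op_of A N_ops (x - op_of A t_ops x) = 0" "op_of A N_ops x - op_of A t_ops (op_of A N_ops x) = 0"
proof -
  have *: "op_of A N_ops (single l 1 - op_of A t_ops (single l 1)) = 0
      \<and> op_of A N_ops (single l 1) - op_of A t_ops (op_of A N_ops (single l 1)) = 0"
    if l: "l \<noteq> []" for l :: "'a list"
  proof -
    obtain n where n: "length l = Suc n" using l by (cases l) auto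
    let ?s = "\<lambda>i. single (rotate (n * i) l) ((- 1) ^ (n * i) :: 'b)"
    have N: "op_of A N_ops (single l 1) = (\<Sum>i<Suc n. ?s i)"
      using n by (simp add: N_single del: sum.lessThan_Suc)
    have Nt: "op_of A N_ops (op_of A t_ops (single l 1)) = (\<Sum>i<Suc n. ?s (Suc i))"
    proof -
      have "op_of A N_ops (op_of A t_ops (single l 1))
          = pm_scale ((- 1) ^ n) (op_of A N_ops (single (rotate n l) 1))"
        using n by (simp add: t_single flip: klin_scale[OF klin_op_of])
      then show ?thesis
        using n by (simp add: N_single rotate_rotate pmv.scale_sum_right power_add add.commute del: sum.lessThan_Suc)
    qed
    have tN: "op_of A t_ops (\<Sum>i<Suc n. ?s i) = (\<Sum>i<Suc n. ?s (Suc i))"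
    proof -
      have "op_of A t_ops (?s i) = ?s (Suc i)" for i
      proof -
        have "op_of A t_ops (?s i) = pm_scale ((- 1) ^ (n * i)) (op_of A t_ops (single (rotate (n * i) l) 1))"
          by (simp flip: klin_scale[OF klin_op_of])
        then show ?thesis using n by (simp add: t_single rotate_rotate power_add mult.commute)
      qed
      then show ?thesis by (simp add: klin_sum[OF klin_op_of] del: sum.lessThan_Suc)
    qed
    have last: "?s (Suc n) = ?s 0"
    proof -
      have "rotate (n * Suc n) l = l" using rotate_full[of l n] n by (simp add: mult.commute)
      moreover have "even (n * Suc n)" by simp
      ultimately show ?thesis by simp
    qed
    have shift: "(\<Sum>i<Suc n. ?s (Suc i)) = (\<Sum>i<Suc n. ?s i)"
      using sum.lessThan_Suc_shift[of ?s "Suc n"] last sum.lessThan_Suc[of ?s "Suc n"]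
      by (simp del: sum.lessThan_Suc add: add.commute)
    show ?thesis unfolding klin_minus[OF klin_op_of] N Nt tN shift by simp
  qed
  show "op_of A N_ops (x - op_of A t_ops x) = 0"
    by (rule klin_eqI[where f = "\<lambda>x. op_of A N_ops (x - op_of A t_ops x)", OF _ klin_const0 assms])
      (use * in \<open>auto intro!: klin_comp[OF klin_op_of]\<close>)
  show "op_of A N_ops x - op_of A t_ops (op_of A N_ops x) = 0"
    by (rule klin_eqI[where f = "\<lambda>x. op_of A N_ops x - op_of A t_ops (op_of A N_ops x)", OF _ klin_const0 assms])
      (use * in \<open>auto intro!: klin_comp[OF klin_op_of]\<close>)
qed

text \<open>
  Both sides are the sum of all \<open>t\<^sup>a d\<^sub>k\<close>: a face of index \<open>i\<close> passes
  \<open>j \<le> i\<close> rotations and becomes the face of index \<open>i - j\<close>; if \<open>j > i\<close>, it becomes the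
  first face after \<open>i\<close> rotations, the next rotation turns this into the last face, and the
  remaining \<open>j - i - 1\<close> rotations lower the index again.
\<close>
lemma b_N_identity:
  assumes "keys x \<subseteq> {l. 2 \<le> length l}"
  shows "op_of A bar_ops (op_of A N_ops x) = op_of A N_ops (op_of A hoch_ops x)"
proof (rule klin_eqI[where f = "\<lambda>x. op_of A bar_ops (op_of A N_ops x)"
      and g = "\<lambda>x. op_of A N_ops (op_of A hoch_ops x)", OF _ _ assms])
  fix l :: "'a list" assume "l \<in> {l. 2 \<le> length l}"
  then obtain n where n: "length l = n + 1" "1 \<le> n" by (cases "length l") auto
  let ?S = "\<lambda>l c. single l (c::'b)"
  have "op_of A bar_ops (op_of A N_ops (single l 1))
      = (\<Sum>j<n + 1. pm_scale ((- 1) ^ (n * j)) (op_of A bar_ops (?S (rotate (n * j) l) 1)))"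
    using n by (simp add: N_single klin_sum[OF klin_op_of] flip: klin_scale[OF klin_op_of] del: sum.lessThan_Suc)
  also have "\<dots> = (\<Sum>j<n + 1. \<Sum>i<n. ?S (face A i (rotate (n * j) l)) ((- 1) ^ (n * j + i)))"
    using n by (simp add: bar_single pmv.scale_sum_right power_add del: sum.lessThan_Suc)
  also have "\<dots> = (\<Sum>(j, i)\<in>{..<n + 1} \<times> {..<n}. ?S (face A i (rotate (n * j) l)) ((- 1) ^ (n * j + i)))"
    by (simp add: sum.cartesian_product)
  also have "\<dots> = (\<Sum>(k, a)\<in>{..<n + 1} \<times> {..<n}. ?S (rotate ((n - 1) * a) (face A k l)) ((- 1) ^ ((n - 1) * a + k)))"
  proof (rule sum.reindex_bij_witness[where
        i = "\<lambda>(k, a). if a + k < n then (a, a + k) else (a + 1, a + k - n)"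
        and j = "\<lambda>(j, i). if j \<le> i then (i - j, j) else (n + i + 1 - j, j - 1)"])
    fix p assume p: "p \<in> {..<n + 1} \<times> {..<n}"
    obtain j i where ji: "p = (j, i)" by (cases p)
    have i: "i < n" and j: "j \<le> n" using p ji by auto
    show "(case case p of (j, i) \<Rightarrow> if j \<le> i then (i - j, j) else (n + i + 1 - j, j - 1) of
        (k, a) \<Rightarrow> ?S (rotate ((n - 1) * a) (face A k l)) ((- 1) ^ ((n - 1) * a + k)))
      = (case p of (j, i) \<Rightarrow> ?S (face A i (rotate (n * j) l)) ((- 1) ^ (n * j + i)))"
    proof (cases "j \<le> i")
      case True
      have f: "face A i (rotate (n * j) l) = rotate ((n - 1) * j) (face A (i - j) l)"
        using face_rotate_power[of i l j A] True i n by simp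
      have "even ((n - 1) * j + (i - j)) = even (n * j + i)"
        using True n(2) by (simp add: diff_mult_distrib) (cases n; auto)
      then have "(- 1 :: 'b) ^ ((n - 1) * j + (i - j)) = (- 1) ^ (n * j + i)"
        by (simp add: minus_one_power_iff)
      then show ?thesis using True f ji by simp
    next
      case False
      define k where "k = j - i - 1"
      have k: "j = i + (k + 1)" "k \<le> n" using False j by (auto simp: k_def)
      have "face A i (rotate (n * j) l) = face A i (rotate (n * i) (rotate (n * (k + 1)) l))"
        by (simp add: k rotate_rotate distrib_left add.left_commute)
      also have "\<dots> = rotate ((n - 1) * i) (face A 0 (rotate (n * (k + 1)) l))"
        using face_rotate_power[of i "rotate (n * (k + 1)) l" i A] i n by simp
      also have "face A 0 (rotate (n * (k + 1)) l) = face A n (rotate (n * k) l)"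
        using face_0_rotate[of "rotate (n * k) l" A] n by (simp add: rotate_rotate)
      also have "\<dots> = rotate ((n - 1) * k) (face A (n - k) l)"
        using face_rotate_power[of n l k A] n k by simp
      finally have f: "face A i (rotate (n * j) l) = rotate ((n - 1) * (j - 1)) (face A (n + i + 1 - j) l)"
        using k by (simp add: rotate_rotate distrib_left)
      have "even ((n - 1) * (j - 1) + (n + i + 1 - j)) = even (n * j + i)"
      proof -
        obtain n' j' where "n = Suc n'" "j = Suc j'" using n(2) k by (cases n; cases j) auto
        then show ?thesis using j by auto
      qed
      then have "(- 1 :: 'b) ^ ((n - 1) * (j - 1) + (n + i + 1 - j)) = (- 1) ^ (n * j + i)"
        by (simp add: minus_one_power_iff)
      then show ?thesis using False f ji by simp
    qed
  qed (auto split: if_splits)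
  also have "\<dots> = (\<Sum>k<n + 1. \<Sum>a<n. ?S (rotate ((n - 1) * a) (face A k l)) ((- 1) ^ ((n - 1) * a + k)))"
    by (simp add: sum.cartesian_product)
  also have "\<dots> = (\<Sum>k<n + 1. op_of A N_ops (?S (face A k l) ((- 1) ^ k)))"
  proof (rule sum.cong[OF refl])
    fix k assume "k \<in> {..<n + 1}"
    then have len: "length (face A k l) = n" using length_face[of k l A] n by simp
    have "op_of A N_ops (?S (face A k l) ((- 1) ^ k)) = pm_scale ((- 1) ^ k) (op_of A N_ops (?S (face A k l) 1))"
      by (simp flip: klin_scale[OF klin_op_of])
    then show "(\<Sum>a<n. ?S (rotate ((n - 1) * a) (face A k l)) ((- 1) ^ ((n - 1) * a + k)))
        = op_of A N_ops (?S (face A k l) ((- 1) ^ k))"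
      by (simp add: N_single len pmv.scale_sum_right power_add mult.commute)
  qed
  also have "\<dots> = op_of A N_ops (op_of A hoch_ops (single l 1))"
    using n by (simp add: hoch_single klin_sum[OF klin_op_of] del: sum.lessThan_Suc)
  finally show "op_of A bar_ops (op_of A N_ops (single l 1))
      = op_of A N_ops (op_of A hoch_ops (single l 1))" .
qed (intro klin_comp[OF klin_op_of] klin_op_of)+

section \<open>Bases graded by a category\<close>

text \<open>
  The basis elements are arrows of a category with objects \<open>V0\<close>: products are zero unless the
  arrows are composable, and the length \<open>len\<close> is additive on nonzero products and zero on the
  identities \<open>unit v\<close> only. The set \<open>E\<close> contains the identities and lies in their span.
\<close>
locale graded_basis = multiplicative_basis A B co
  for A :: "('k::field, 'a) module" and B :: "'a set" and co :: "'a \<Rightarrow> ('a \<Rightarrow>\<^sub>0 'k)" +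
  fixes V0 :: "'v set" and src tgt :: "'a \<Rightarrow> 'v" and len :: "'a \<Rightarrow> nat" and unit :: "'v \<Rightarrow> 'a"
    and E :: "'a set"
  assumes ends_V0: "b \<in> B \<Longrightarrow> src b \<in> V0" "b \<in> B \<Longrightarrow> tgt b \<in> V0"
    and unit_B: "v \<in> V0 \<Longrightarrow> unit v \<in> B"
    and unit_ends: "v \<in> V0 \<Longrightarrow> src (unit v) = v" "v \<in> V0 \<Longrightarrow> tgt (unit v) = v"
    and unit_len: "v \<in> V0 \<Longrightarrow> len (unit v) = 0"
    and len_0: "b \<in> B \<Longrightarrow> len b = 0 \<Longrightarrow> b = unit (src b)"
    and mult_apart: "a \<in> B \<Longrightarrow> b \<in> B \<Longrightarrow> tgt a \<noteq> src b \<Longrightarrow> a \<otimes>\<^bsub>A\<^esub> b = \<zero>\<^bsub>A\<^esub>"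
    and mult_ends: "a \<in> B \<Longrightarrow> b \<in> B \<Longrightarrow> a \<otimes>\<^bsub>A\<^esub> b \<in> B \<Longrightarrow> src (a \<otimes>\<^bsub>A\<^esub> b) = src a"
      "a \<in> B \<Longrightarrow> b \<in> B \<Longrightarrow> a \<otimes>\<^bsub>A\<^esub> b \<in> B \<Longrightarrow> tgt (a \<otimes>\<^bsub>A\<^esub> b) = tgt b"
    and mult_len: "a \<in> B \<Longrightarrow> b \<in> B \<Longrightarrow> a \<otimes>\<^bsub>A\<^esub> b \<in> B \<Longrightarrow> len (a \<otimes>\<^bsub>A\<^esub> b) = len a + len b"
    and unit_l: "b \<in> B \<Longrightarrow> unit (src b) \<otimes>\<^bsub>A\<^esub> b = b"
    and unit_r: "b \<in> B \<Longrightarrow> b \<otimes>\<^bsub>A\<^esub> unit (tgt b) = b"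
    and E_units: "unit ` V0 \<subseteq> E" "E \<subseteq> carrier A"
    and E_co: "a \<in> E \<Longrightarrow> keys (co a) \<subseteq> unit ` V0"
begin

lemma mult_B_tgt: "a \<in> B \<Longrightarrow> b \<in> B \<Longrightarrow> a \<otimes>\<^bsub>A\<^esub> b \<in> B \<Longrightarrow> tgt a = src b"
  using mult_apart zero_notin_B by metis

primrec chain :: "'v \<Rightarrow> 'a list \<Rightarrow> 'v \<Rightarrow> bool" where
  "chain u [] w \<longleftrightarrow> u = w"
| "chain u (a # l) w \<longleftrightarrow> src a = u \<and> chain (tgt a) l w"

lemma chain_append: "chain u (l @ l') w \<longleftrightarrow> (\<exists>v. chain u l v \<and> chain v l' w)"
  by (induction l arbitrary: u) auto

definition cyc :: "'a list \<Rightarrow> bool" where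
  "cyc l \<longleftrightarrow> l \<noteq> [] \<and> (\<exists>v. chain v l v)"

lemma cyc_append_commute: "cyc (l @ l') \<longleftrightarrow> cyc (l' @ l)"
  unfolding cyc_def chain_append by auto

lemma cyc_rotate: "cyc (rotate n l) \<longleftrightarrow> cyc l"
  unfolding rotate_drop_take by (subst cyc_append_commute) simp

definition size_of :: "'a list \<Rightarrow> nat" where
  "size_of l = (\<Sum>a\<leftarrow>l. len a)"

text \<open>
  Invariance of a class of lists under all faces and rotations whose value is again a list of basis
  elements. The operators then preserve the span of the class and that of its complement.
\<close>
definition stable :: "'a list set \<Rightarrow> bool" where
  "stable K \<longleftrightarrow> (\<forall>l g. l \<in> G \<and> valid_gen g (length l) \<and> act A g l \<in> G \<longrightarrow> (act A g l \<in> K \<longleftrightarrow> l \<in> K))"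

text \<open>
  Up to rotation every face merges the first two entries.
\<close>
lemma stableI:
  assumes rot: "\<And>l j. l \<in> G \<Longrightarrow> rotate j l \<in> K \<longleftrightarrow> l \<in> K"
    and merge: "\<And>a b r. a # b # r \<in> G \<Longrightarrow> (a \<otimes>\<^bsub>A\<^esub> b) # r \<in> G \<Longrightarrow> (a \<otimes>\<^bsub>A\<^esub> b) # r \<in> K \<longleftrightarrow> a # b # r \<in> K"
  shows "stable K"
  unfolding stable_def
proof (intro allI impI; elim conjE)
  fix l g assume l: "l \<in> G" and v: "valid_gen g (length l)" and al: "act A g l \<in> G"
  show "act A g l \<in> K \<longleftrightarrow> l \<in> K"
  proof (cases g)
    case (Rot j)
    then show ?thesis using rot l by simp
  next
    case (Face i)
    then have i: "i < length l" "2 \<le> length l" using v by auto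
    consider (1) us a b vs where "l = us @ a # b # vs" "i = length us"
      | (2) us a z where "l = a # us @ [z]" "i = Suc (length us)"
      using face_cases[OF i] by metis
    then show ?thesis
    proof cases
      case 1
      then have f: "act A g l = us @ (a \<otimes>\<^bsub>A\<^esub> b) # vs" using Face face_inner by auto
      have "us @ (a \<otimes>\<^bsub>A\<^esub> b) # vs \<in> K \<longleftrightarrow> (a \<otimes>\<^bsub>A\<^esub> b) # vs @ us \<in> K"
        using rot[OF al, of "length us"] by (simp add: f rotate_append)
      also have "\<dots> \<longleftrightarrow> a # b # vs @ us \<in> K"
        using l al[unfolded f] 1(1) by (intro merge) (auto simp: G_def)
      also have "\<dots> \<longleftrightarrow> l \<in> K"
        using rot[OF l, of "length us"] by (simp add: 1 rotate_append)
      finally show ?thesis by (simp add: f)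
    next
      case 2
      then have f: "act A g l = (z \<otimes>\<^bsub>A\<^esub> a) # us" using Face face_outer[of A us a z] by auto
      have "(z \<otimes>\<^bsub>A\<^esub> a) # us \<in> K \<longleftrightarrow> z # a # us \<in> K"
        using l al[unfolded f] 2(1) by (intro merge) (auto simp: G_def)
      also have "\<dots> \<longleftrightarrow> l \<in> K"
        using rot[OF l, of "length (a # us)"] rotate_append[of "a # us" "[z]"] by (simp add: 2)
      finally show ?thesis by (simp add: f)
    qed
  qed
qed

lemma stable_cyc: "stable {l. cyc l}"
proof (rule stableI)
  fix a b r assume "a # b # r \<in> G" "(a \<otimes>\<^bsub>A\<^esub> b) # r \<in> G"
  then show "(a \<otimes>\<^bsub>A\<^esub> b) # r \<in> {l. cyc l} \<longleftrightarrow> a # b # r \<in> {l. cyc l}"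
    using mult_B_tgt[of a b] mult_ends[of a b] by (auto simp: G_def cyc_def)
qed (simp add: cyc_rotate)

lemma stable_size: "stable {l. size_of l = 0}"
proof (rule stableI)
  fix a b r assume "a # b # r \<in> G" "(a \<otimes>\<^bsub>A\<^esub> b) # r \<in> G"
  then show "(a \<otimes>\<^bsub>A\<^esub> b) # r \<in> {l. size_of l = 0} \<longleftrightarrow> a # b # r \<in> {l. size_of l = 0}"
    using mult_len[of a b] by (auto simp: G_def size_of_def)
next
  fix l :: "'a list" and j
  show "rotate j l \<in> {l. size_of l = 0} \<longleftrightarrow> l \<in> {l. size_of l = 0}"
    by (auto simp: size_of_def)
qed

lemma stable_Int: "stable K \<Longrightarrow> stable K' \<Longrightarrow> stable (K \<inter> K')"
  and stable_Compl: "stable K \<Longrightarrow> stable (- K)"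
  by (auto simp: stable_def)

text \<open>
  The three classes along which the complexes split.
\<close>
definition Non :: "'a list set" where "Non = - {l. cyc l}"
definition Triv :: "'a list set" where "Triv = {l. cyc l} \<inter> {l. size_of l = 0}"
definition Pos :: "'a list set" where "Pos = {l. cyc l} \<inter> - {l. size_of l = 0}"

lemma stable_classes: "stable Non" "stable Triv" "stable Pos"
  unfolding Non_def Triv_def Pos_def by (intro stable_Int stable_Compl stable_cyc stable_size)+

text \<open>
  The operator on the span of the lists over \<open>B\<close> that corresponds to \<open>op_of A ops\<close>
  under \<open>Phi\<close>.
\<close>
definition dB :: "(nat \<Rightarrow> ('k \<times> gen) list) \<Rightarrow> ('a list \<Rightarrow>\<^sub>0 'k) \<Rightarrow> ('a list \<Rightarrow>\<^sub>0 'k)" where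
  "dB ops x = restr G (op_of A ops x)"

lemma klin_dB [intro!, simp]: "klin (dB ops)"
  unfolding dB_def by (rule klin_comp) auto

lemma dB_keys_stable:
  assumes "stable K" "ops_map ops L L'" "keys x \<subseteq> G \<inter> K \<inter> {l. length l \<in> L}"
  shows "keys (dB ops x) \<subseteq> G \<inter> K \<inter> {l. length l \<in> L'}"
proof -
  have "keys (op_of A ops x) \<subseteq> - G \<union> (G \<inter> K \<inter> {l. length l \<in> L'})"
  proof (rule keys_op_of[OF assms(3)])
    fix l c g assume l: "l \<in> G \<inter> K \<inter> {l. length l \<in> L}" and cg: "(c, g) \<in> set (ops (length l))"
    then have "valid_gen g (length l)" "out_length g (length l) \<in> L'"
      using assms(2) by (auto simp: ops_map_def)
    then show "act A g l \<in> - G \<union> (G \<inter> K \<inter> {l. length l \<in> L'})"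
      using assms(1) l length_act[of g l A] by (auto simp: stable_def)
  qed
  then show ?thesis by (auto simp: dB_def)
qed

lemma restr_dB:
  assumes K: "stable K" and ops: "ops_map ops L L'" and x: "keys x \<subseteq> G \<inter> {l. length l \<in> L}"
  shows "restr K (dB ops x) = dB ops (restr K x)"
proof (rule klin_eqI[where f = "\<lambda>x. restr K (dB ops x)" and g = "\<lambda>x. dB ops (restr K x)", OF _ _ x])
  fix l assume l: "l \<in> G \<inter> {l. length l \<in> L}"
  show "restr K (dB ops (single l 1)) = dB ops (restr K (single l 1))"
  proof (cases "l \<in> K")
    case True
    then have "keys (dB ops (single l 1)) \<subseteq> K"
      using dB_keys_stable[OF K ops, of "single l 1"] l by auto
    then show ?thesis using True by (simp add: restr_single restr_id)
  next
    case False
    then have "keys (dB ops (single l 1)) \<inter> K = {}"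
      using dB_keys_stable[OF stable_Compl[OF K] ops, of "single l 1"] l by auto
    then show ?thesis using False by (simp add: restr_single restr_empty klin_zero)
  qed
qed (rule klin_comp[OF klin_restr klin_dB], rule klin_comp[OF klin_dB klin_restr])

text \<open>
  Discarding the lists with a zero in between makes no difference, because the operators respect the
  multilinearity relations. So identities between operators on all tensors carry over.
\<close>
lemma dB_dB:
  assumes "ops_map ops L L'" "ops_map ops' L' L''" "keys x \<subseteq> G \<inter> {l. length l \<in> L}"
  shows "dB ops' (dB ops x) = restr G (op_of A ops' (op_of A ops x))"
proof -
  have x: "x \<in> free_chains A L" using assms(3) B_carrier by (fastforce simp: free_chains_def G_def)
  have Gz: "keys x \<subseteq> {l. set l \<subseteq> insert \<zero>\<^bsub>A\<^esub> B \<and> length l \<in> L}"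
    using assms(3) by (auto simp: G_def)
  have k1: "keys (op_of A ops x) \<subseteq> {l. set l \<subseteq> insert \<zero>\<^bsub>A\<^esub> B \<and> length l \<in> L'}"
    by (rule op_of_keys_zero[OF assms(1) Gz])
  have k2: "keys (op_of A ops' (op_of A ops x)) \<subseteq> {l. set l \<subseteq> insert \<zero>\<^bsub>A\<^esub> B \<and> length l \<in> L''}"
    by (rule op_of_keys_zero[OF assms(2) k1])
  have "Phi (op_of A ops' (op_of A ops x)) = restr G (op_of A ops' (Phi (op_of A ops x)))"
    by (rule Phi_op_of[OF assms(2) op_of_free_chains[OF assms(1) x]])
  moreover have "Phi (op_of A ops x) = restr G (op_of A ops x)"
    by (rule Phi_restr) (use k1 in auto)
  moreover have "Phi (op_of A ops' (op_of A ops x)) = restr G (op_of A ops' (op_of A ops x))"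
    by (rule Phi_restr) (use k2 in auto)
  ultimately show ?thesis by (simp add: dB_def)
qed

subsection \<open>Contracting the tensors that are not cyclically composable\<close>

text \<open>
  \<open>z\<close> is the entry in front of the first junction of \<open>r @ z # q\<close> that is not
  composable. If \<open>q\<close> is empty, this is the junction between the last entry and the first one.
\<close>
definition split :: "'a list \<Rightarrow> 'a \<Rightarrow> 'a list \<Rightarrow> bool" where
  "split r z q \<longleftrightarrow> (\<exists>u. chain u r (src z)) \<and> src (hd (q @ r @ [z])) \<noteq> tgt z"

text \<open>
  If the second decomposition cut later, its initial part would be composable across the junction at
  which the first one cuts.
\<close>
lemma split_le:
  assumes "r @ z # q = r' @ z' # q'" "split r z q" "split r' z' q'"
  shows "length r' \<le> length r"
proof (rule ccontr)
  assume *: "\<not> length r' \<le> length r"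
  then have t: "take (length r) r' = r"
    using arg_cong[OF assms(1), of "take (length r)"] by simp
  define y where "y = drop (Suc (length r)) r'"
  have "drop (length r) r' = r' ! length r # y"
    using * by (simp add: y_def Cons_nth_drop_Suc)
  moreover have "r' ! length r = z"
    using arg_cong[OF assms(1), of "\<lambda>l. l ! length r"] * by (simp add: nth_append)
  ultimately have r': "r' = r @ z # y"
    using append_take_drop_id[of "length r" r'] t by simp
  then have q: "q = y @ z' # q'" using assms(1) by simp
  obtain u where "chain u r' (src z')" using assms(3) by (auto simp: split_def)
  then have "src (hd (y @ [z'])) = tgt z" by (cases y) (auto simp: r' chain_append)
  then show False using assms(2) by (cases y) (auto simp: split_def q)
qed

lemma split_unique:
  assumes "r @ z # q = r' @ z' # q'" "split r z q" "split r' z' q'"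
  shows "r = r' \<and> z = z' \<and> q = q'"
proof -
  have "length r = length r'"
    using split_le[OF assms] split_le[OF assms(1)[symmetric] assms(3,2)] by simp
  then show ?thesis using assms(1) by simp
qed

lemma split_exists:
  assumes "l \<noteq> []" "\<not> cyc l"
  obtains r z q where "l = r @ z # q" "split r z q"
proof -
  have "(\<exists>u w. chain u l w) \<or>
      (\<exists>r z d q u. l = r @ z # d # q \<and> chain u r (src z) \<and> tgt z \<noteq> src d)" for l
  proof (induction l)
    case (Cons a l)
    show ?case
    proof (cases l)
      case (Cons b l')
      from Cons.IH consider u w where "chain u l w"
        | r z d q u where "l = r @ z # d # q" "chain u r (src z)" "tgt z \<noteq> src d" by auto
      then show ?thesis
      proof cases
        case 1
        show ?thesis
        proof (cases "tgt a = u")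
          case True
          with 1 have "chain (src a) (a # l) w" by simp
          then show ?thesis by blast
        next
          case False
          with 1 Cons have "a # l = [] @ a # b # l' \<and> chain (src a) [] (src a) \<and> tgt a \<noteq> src b" by auto
          then show ?thesis by blast
        qed
      next
        case 2
        show ?thesis
        proof (cases "tgt a = src b")
          case True
          have "chain (src a) (a # r) (src z)"
            using 2 True Cons by (cases r) auto
          with 2 have "a # l = (a # r) @ z # d # q \<and> chain (src a) (a # r) (src z) \<and> tgt z \<noteq> src d" by simp
          then show ?thesis by blast
        next
          case False
          with Cons have "a # l = [] @ a # b # l' \<and> chain (src a) [] (src a) \<and> tgt a \<noteq> src b" by auto
          then show ?thesis by blast
        qed
      qed
    qed auto
  qed auto
  then consider u w where "chain u l w"
    | r z d q u where "l = r @ z # d # q" "chain u r (src z)" "tgt z \<noteq> src d" by blast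
  then show thesis
  proof cases
    case 1
    obtain r z where l: "l = r @ [z]" using assms(1) by (cases l rule: rev_cases) auto
    have c: "chain u r (src z)" "tgt z = w" using 1 by (auto simp: l chain_append)
    have "u \<noteq> w" using assms 1 by (auto simp: cyc_def)
    then have "src (hd (r @ [z])) \<noteq> tgt z" using c by (cases r) auto
    then show thesis using that[of r z "[]"] l c by (auto simp: split_def)
  next
    case 2
    then show thesis using that[of r z "d # q"] by (auto simp: split_def)
  qed
qed

text \<open>
  The contracting homotopy for \<open>b\<close>: insert the identity behind the first junction that is not
  composable.
\<close>
definition insert_unit :: "'a list \<Rightarrow> ('a list \<Rightarrow>\<^sub>0 'k)" where
  "insert_unit l = (case (SOME (r, z, q). l = r @ z # q \<and> split r z q) of
     (r, z, q) \<Rightarrow> single (r @ z # unit (tgt z) # q) ((- 1) ^ length r))"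

lemma insert_unit_split:
  assumes "split r z q"
  shows "insert_unit (r @ z # q) = single (r @ z # unit (tgt z) # q) ((- 1) ^ length r)"
proof -
  have "(SOME (r', z', q'). r @ z # q = r' @ z' # q' \<and> split r' z' q') = (r, z, q)"
  proof (rule some_equality)
    fix p :: "'a list \<times> 'a \<times> 'a list"
    assume p: "case p of (r', z', q') \<Rightarrow> r @ z # q = r' @ z' # q' \<and> split r' z' q'"
    obtain r' z' q' where p': "p = (r', z', q')" by (cases p)
    show "p = (r, z, q)" using split_unique[OF _ assms, of r' z' q'] p by (simp add: p')
  qed (use assms in simp)
  then show ?thesis by (simp add: insert_unit_def)
qed

abbreviation nonzero_part :: "'a list \<Rightarrow> ('a list \<Rightarrow>\<^sub>0 'k)" where
  "nonzero_part l \<equiv> restr G (single l 1)"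

lemma nonzero_part_G: "l \<in> G \<Longrightarrow> nonzero_part l = single l 1"
  and nonzero_part_not_G: "l \<notin> G \<Longrightarrow> nonzero_part l = 0"
  by (auto simp: restr_single)

lemma restr_G_scale:
  "restr G (single l ((- 1) ^ i)) = pm_scale ((- 1) ^ i) (nonzero_part l)"
  by (simp flip: klin_scale[OF klin_restr])

lemma zero_not_G: "\<zero>\<^bsub>A\<^esub> \<in> set l \<Longrightarrow> l \<notin> G"
  using zero_notin_B by (auto simp: G_def)

text \<open>
  The inserted identity merges with the entry on its left to give \<open>l\<close> back and has zero product with
  the entry on its right. Every other face either leaves the inserted identity and its junction
  alone, so that it commutes with the insertion up to a shift of the index, or vanishes.
\<close>
lemma insert_unit_faces:
  fixes r z q
  defines "l \<equiv> r @ z # q" and "L \<equiv> r @ z # unit (tgt z) # q" and "H \<equiv> lin_ext insert_unit"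
  assumes l: "l \<in> G" and sp: "split r z q"
  shows "i < length r \<Longrightarrow> nonzero_part (face A i L) = pm_scale ((- 1) ^ (length r - 1)) (H (nonzero_part (face A i l)))" (is "_ \<Longrightarrow> ?A")
    and "face A (length r) L = l"
    and "nonzero_part (face A (Suc (length r)) L) = 0"
    and "2 \<le> length l \<Longrightarrow> nonzero_part (face A (length r) l) = 0"
    and "length r < i \<Longrightarrow> i < length l \<Longrightarrow>
      nonzero_part (face A (Suc i) L) = pm_scale ((- 1) ^ length r) (H (nonzero_part (face A i l)))"
proof -
  let ?e = "unit (tgt z)"
  have inB: "set r \<subseteq> B" "z \<in> B" "set q \<subseteq> B" using l by (auto simp: G_def l_def)
  have e: "?e \<in> B" "src ?e = tgt z" "tgt ?e = tgt z"
    using unit_B unit_ends ends_V0 inB by auto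
  obtain u where u: "chain u r (src z)" using sp by (auto simp: split_def)
  have bad: "src (hd (q @ r @ [z])) \<noteq> tgt z" using sp by (simp add: split_def)
  have sgn: "pm_scale ((- 1) ^ k) (single m ((- 1) ^ k)) = single m (1::'k)" for k m
    by (simp flip: power_add add: minus_one_power_iff)
  have main: "nonzero_part f = pm_scale ((- 1) ^ length r') (H (nonzero_part f'))"
    if "f' = r' @ z' # q'" "f = r' @ z' # ?e # q'" "f' \<in> G \<Longrightarrow> split r' z' q' \<and> tgt z' = tgt z"
    for f f' r' z' q'
  proof (cases "f' \<in> G")
    case True
    then have "f \<in> G" using that e by (auto simp: G_def)
    then show ?thesis using True that(3)[OF True] insert_unit_split[of r' z' q'] that(1,2)
      by (simp add: nonzero_part_G H_def sgn)
  next
    case False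
    then have "f \<notin> G" using that e by (auto simp: G_def)
    then show ?thesis using False by (simp add: nonzero_part_not_G H_def)
  qed
  {
    assume i: "i < length r"
    show ?A
    proof (cases "Suc i < length r")
      case True
      then obtain u1 a b u2 where r: "r = u1 @ a # b # u2" "i = length u1"
        by (rule_tac face_cases[of i r]) auto
      have f: "face A i l = (u1 @ (a \<otimes>\<^bsub>A\<^esub> b) # u2) @ z # q"
        "face A i L = (u1 @ (a \<otimes>\<^bsub>A\<^esub> b) # u2) @ z # ?e # q"
        using face_inner[of A u1 a b "u2 @ z # q"] face_inner[of A u1 a b "u2 @ z # ?e # q"]
        by (simp_all add: l_def L_def r)
      have "split (u1 @ (a \<otimes>\<^bsub>A\<^esub> b) # u2) z q" if "face A i l \<in> G"
      proof -
        have ab: "a \<in> B" "b \<in> B" "a \<otimes>\<^bsub>A\<^esub> b \<in> B" using that[unfolded f(1)] inB by (auto simp: G_def r(1))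
        have "chain u (u1 @ (a \<otimes>\<^bsub>A\<^esub> b) # u2) (src z)"
          using u mult_ends[OF ab] by (auto simp: r chain_append)
        moreover have "src (hd (q @ (u1 @ (a \<otimes>\<^bsub>A\<^esub> b) # u2) @ [z])) = src (hd (q @ r @ [z]))"
          using mult_ends[OF ab] by (cases q; cases u1) (auto simp: r)
        ultimately show ?thesis using bad by (auto simp: split_def)
      qed
      then show ?thesis using main[OF f] by (simp add: r)
    next
      case False
      then obtain u1 a where r: "r = u1 @ [a]" "i = length u1" using i by (cases r rule: rev_cases) auto
      have f: "face A i l = u1 @ (a \<otimes>\<^bsub>A\<^esub> z) # q"
        "face A i L = u1 @ (a \<otimes>\<^bsub>A\<^esub> z) # ?e # q"
        using face_inner[of A u1 a z q] face_inner[of A u1 a z "?e # q"]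
        by (simp_all add: l_def L_def r)
      have "split u1 (a \<otimes>\<^bsub>A\<^esub> z) q \<and> tgt (a \<otimes>\<^bsub>A\<^esub> z) = tgt z" if "face A i l \<in> G"
      proof -
        have az: "a \<in> B" "z \<in> B" "a \<otimes>\<^bsub>A\<^esub> z \<in> B" using that[unfolded f(1)] inB by (auto simp: G_def r(1))
        have "chain u u1 (src (a \<otimes>\<^bsub>A\<^esub> z))"
          using u mult_ends[OF az] by (auto simp: r chain_append)
        moreover have "src (hd (q @ u1 @ [a \<otimes>\<^bsub>A\<^esub> z])) = src (hd (q @ r @ [z]))"
          using mult_ends[OF az] by (cases q; cases u1) (auto simp: r)
        ultimately show ?thesis using bad mult_ends[OF az] by (auto simp: split_def)
      qed
      then show ?thesis using main[OF f] by (simp add: r)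
    qed
  }
  show "face A (length r) L = l"
    using face_inner[of A r z ?e q] unit_r[OF inB(2)] by (simp add: L_def l_def)
  show "nonzero_part (face A (Suc (length r)) L) = 0"
  proof (rule nonzero_part_not_G, rule zero_not_G)
    show "\<zero>\<^bsub>A\<^esub> \<in> set (face A (Suc (length r)) L)"
    proof (cases q)
      case Nil
      have "?e \<otimes>\<^bsub>A\<^esub> hd (r @ [z]) = \<zero>\<^bsub>A\<^esub>"
        using bad Nil e inB by (intro mult_apart) (cases r; auto)+
      then show ?thesis
        using Nil face_outer[of A "tl (r @ [z])" "hd (r @ [z])" ?e] by (cases r) (auto simp: L_def)
    next
      case (Cons d q')
      then have "?e \<otimes>\<^bsub>A\<^esub> d = \<zero>\<^bsub>A\<^esub>" using bad e inB by (intro mult_apart) auto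
      then show ?thesis using Cons face_inner[of A "r @ [z]" ?e d q'] by (simp add: L_def)
    qed
  qed
  {
    assume len: "2 \<le> length l"
    show "nonzero_part (face A (length r) l) = 0"
    proof (rule nonzero_part_not_G, rule zero_not_G)
      show "\<zero>\<^bsub>A\<^esub> \<in> set (face A (length r) l)"
      proof (cases q)
        case Nil
        then obtain a r' where r: "r = a # r'" using len by (cases r) (auto simp: l_def)
        have "z \<otimes>\<^bsub>A\<^esub> a = \<zero>\<^bsub>A\<^esub>" using bad Nil inB r by (intro mult_apart) auto
        then show ?thesis using Nil face_outer[of A r' a z] by (simp add: l_def r)
      next
        case (Cons d q')
        then have "z \<otimes>\<^bsub>A\<^esub> d = \<zero>\<^bsub>A\<^esub>" using bad inB by (intro mult_apart) auto
        then show ?thesis using Cons face_inner[of A r z d q'] by (simp add: l_def)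
      qed
    qed
  }
  {
    assume i: "length r < i" "i < length l"
    show "nonzero_part (face A (Suc i) L) = pm_scale ((- 1) ^ length r) (H (nonzero_part (face A i l)))"
    proof (cases "Suc i < length l")
      case True
      define t where "t = i - length r - 1"
      have "t < length q" "2 \<le> length q" "Suc t < length q" using True i by (auto simp: t_def l_def)
      then obtain v1 a b v2 where q: "q = v1 @ a # b # v2" "t = length v1"
        by (rule_tac face_cases[of t q]) auto
      have it: "i = Suc (length r + length v1)" using q i by (simp add: t_def)
      have f: "face A i l = r @ z # (v1 @ (a \<otimes>\<^bsub>A\<^esub> b) # v2)"
        "face A (Suc i) L = r @ z # ?e # (v1 @ (a \<otimes>\<^bsub>A\<^esub> b) # v2)"
        using face_inner[of A "r @ z # v1" a b v2] face_inner[of A "r @ z # ?e # v1" a b v2]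
        by (simp_all add: l_def L_def q(1) it)
      have "split r z (v1 @ (a \<otimes>\<^bsub>A\<^esub> b) # v2)" if "face A i l \<in> G"
      proof -
        have ab: "a \<in> B" "b \<in> B" "a \<otimes>\<^bsub>A\<^esub> b \<in> B" using that[unfolded f(1)] inB by (auto simp: G_def q)
        have "src (hd (v1 @ (a \<otimes>\<^bsub>A\<^esub> b) # v2)) = src (hd (q @ r @ [z]))"
          using mult_ends[OF ab] by (cases v1) (auto simp: q)
        then show ?thesis using bad u by (cases v1) (auto simp: split_def)
      qed
      then show ?thesis using main[OF f] by simp
    next
      case False
      then obtain v x where q: "q = v @ [x]" using i by (cases q rule: rev_cases) (auto simp: l_def)
      have il: "i = Suc (length r + length v)" using False i by (simp add: l_def q)
      show ?thesis
      proof (cases r)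
        case Nil
        have f: "face A i l = [] @ (x \<otimes>\<^bsub>A\<^esub> z) # v" "face A (Suc i) L = [] @ (x \<otimes>\<^bsub>A\<^esub> z) # ?e # v"
          using face_outer[of A v z x] face_outer[of A "?e # v" z x] by (simp_all add: l_def L_def Nil q il)
        have "split [] (x \<otimes>\<^bsub>A\<^esub> z) v \<and> tgt (x \<otimes>\<^bsub>A\<^esub> z) = tgt z" if "face A i l \<in> G"
        proof -
          have xz: "x \<in> B" "z \<in> B" "x \<otimes>\<^bsub>A\<^esub> z \<in> B" using that[unfolded f(1)] inB by (auto simp: G_def q)
          have "src (hd (v @ [x \<otimes>\<^bsub>A\<^esub> z])) = src (hd (q @ r @ [z]))"
            using mult_ends[OF xz] by (cases v) (auto simp: q)
          then show ?thesis using bad mult_ends[OF xz] by (auto simp: split_def)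
        qed
        then show ?thesis using main[OF f] Nil by simp
      next
        case (Cons a r')
        have f: "face A i l = ((x \<otimes>\<^bsub>A\<^esub> a) # r') @ z # v" "face A (Suc i) L = ((x \<otimes>\<^bsub>A\<^esub> a) # r') @ z # ?e # v"
          using face_outer[of A "r' @ z # v" a x] face_outer[of A "r' @ z # ?e # v" a x]
          by (simp_all add: l_def L_def Cons q il)
        have "split ((x \<otimes>\<^bsub>A\<^esub> a) # r') z v" if "face A i l \<in> G"
        proof -
          have xa: "x \<in> B" "a \<in> B" "x \<otimes>\<^bsub>A\<^esub> a \<in> B" using that[unfolded f(1)] inB by (auto simp: G_def q Cons)
          have "src (hd (v @ ((x \<otimes>\<^bsub>A\<^esub> a) # r') @ [z])) = src (hd (q @ r @ [z]))"
            using mult_ends[OF xa] by (cases v) (auto simp: q)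
          moreover have "chain (src x) ((x \<otimes>\<^bsub>A\<^esub> a) # r') (src z)"
            using u mult_ends[OF xa] by (auto simp: Cons)
          ultimately show ?thesis using bad by (auto simp: split_def)
        qed
        then show ?thesis using main[OF f] Cons by simp
      qed
    qed
  }
qed

lemma sum_lessThan_split: "(\<Sum>i<a + (b::nat). f i) = (\<Sum>i<a. f i) + (\<Sum>i<b. f (a + i) :: 'a list \<Rightarrow>\<^sub>0 'k)"
  by (induction b) (auto simp: add.assoc)

lemma insert_homotopy:
  assumes "keys x \<subseteq> G \<inter> Non \<inter> {l. l \<noteq> []}"
  shows "dB hoch_ops (lin_ext insert_unit x) + lin_ext insert_unit (dB hoch_ops x) = x"
proof (rule klin_eqI[where f = "\<lambda>x. dB hoch_ops (lin_ext insert_unit x) + lin_ext insert_unit (dB hoch_ops x)", OF _ klin_id assms])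
  fix l assume l: "l \<in> G \<inter> Non \<inter> {l. l \<noteq> []}"
  then obtain r z q where rzq: "l = r @ z # q" and sp: "split r z q"
    using split_exists[of l] by (auto simp: Non_def)
  define L where "L = r @ z # unit (tgt z) # q"
  let ?H = "lin_ext insert_unit" and ?j = "length r" and ?t = "length q"
  let ?f = "\<lambda>i. pm_scale ((- 1) ^ i) (nonzero_part (face A i L))"
  let ?g = "\<lambda>i. pm_scale ((- 1) ^ i) (?H (nonzero_part (face A i l)))"
  note faces = insert_unit_faces[OF _ sp, folded rzq L_def]
  have lG: "l \<in> G" using l by auto
  have len: "length l = ?j + 1 + ?t" "length L = ?j + (2 + ?t)" by (auto simp: rzq L_def)
  have HL: "?H (single l 1) = pm_scale ((- 1) ^ ?j) (single L 1)"
    using insert_unit_split[OF sp] by (simp add: rzq L_def)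
  have "dB hoch_ops (single L 1) = (\<Sum>i<length L. ?f i)"
  proof -
    have "\<not> length L \<le> 1" using len by simp
    then show ?thesis
      by (simp only: dB_def hoch_single if_False klin_sum[OF klin_restr] restr_G_scale)
  qed
  also have "\<dots> = (\<Sum>i<?j. ?f i) + (?f ?j + ?f (Suc ?j) + (\<Sum>i<?t. ?f (?j + (2 + i))))"
    unfolding len sum_lessThan_split by (simp add: numeral_2_eq_2)
  also have "?f ?j = pm_scale ((- 1) ^ ?j) (single l 1)"
    using faces(2)[OF lG] lG by (simp add: nonzero_part_G)
  also have "?f (Suc ?j) = 0" using faces(3)[OF lG] by simp
  also have "(\<Sum>i<?j. ?f i) = - pm_scale ((- 1) ^ ?j) (\<Sum>i<?j. ?g i)"
  proof -
    have "?f i = - pm_scale ((- 1) ^ ?j) (?g i)" if "i < ?j" for i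
      using faces(1)[OF lG that] that by (cases ?j) (auto simp: mult.commute)
    then show ?thesis by (simp add: sum_negf pmv.scale_sum_right)
  qed
  also have "(\<Sum>i<?t. ?f (?j + (2 + i))) = - pm_scale ((- 1) ^ ?j) (\<Sum>i<?t. ?g (?j + 1 + i))"
  proof -
    have "?f (?j + (2 + i)) = - pm_scale ((- 1) ^ ?j) (?g (?j + 1 + i))" if "i < ?t" for i
      using faces(5)[OF lG, of "?j + 1 + i"] that by (simp add: len mult.commute)
    then show ?thesis by (simp add: sum_negf pmv.scale_sum_right)
  qed
  finally have dL: "dB hoch_ops (single L 1) =
      pm_scale ((- 1) ^ ?j) (single l 1 - ((\<Sum>i<?j. ?g i) + (\<Sum>i<?t. ?g (?j + 1 + i))))"
    by (simp add: pmv.scale_right_diff_distrib pmv.scale_right_distrib)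
  have sq: "pm_scale ((- 1) ^ ?j) (pm_scale ((- 1) ^ ?j) x) = x" for x :: "'a list \<Rightarrow>\<^sub>0 'k"
    by (simp flip: power_add add: minus_one_power_iff)
  have Hd: "?H (dB hoch_ops (single l 1)) = (\<Sum>i<?j. ?g i) + (\<Sum>i<?t. ?g (?j + 1 + i))"
  proof (cases "length l \<le> 1")
    case True
    then show ?thesis using len by (simp add: dB_def hoch_single)
  next
    case False
    have "?H (dB hoch_ops (single l 1)) = (\<Sum>i<length l. ?g i)"
      using False by (simp add: dB_def hoch_single klin_sum[OF klin_restr] klin_sum[OF klin_lin_ext]
          restr_G_scale lin_ext_scale)
    also have "\<dots> = (\<Sum>i<?j. ?g i) + ?g ?j + (\<Sum>i<?t. ?g (?j + 1 + i))"
      unfolding len sum_lessThan_split by simp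
    also have "?g ?j = 0" using faces(4)[OF lG] False by simp
    finally show ?thesis by simp
  qed
  show "dB hoch_ops (?H (single l 1)) + ?H (dB hoch_ops (single l 1))
      = single l 1"
    unfolding HL klin_scale[OF klin_dB] dL sq Hd by simp
qed (rule klin_add[OF klin_comp[OF klin_dB klin_lin_ext] klin_comp[OF klin_lin_ext klin_dB]])

text \<open>
  The usual contracting homotopy for \<open>b'\<close>, with the unit of the algebra replaced by the
  identity at the source of the first entry; so it does not mix the classes of lists.
\<close>
definition prepend_unit :: "'a list \<Rightarrow> ('a list \<Rightarrow>\<^sub>0 'k)" where
  "prepend_unit l = single (unit (src (hd l)) # l) 1"

lemma prepend_homotopy:
  assumes "keys x \<subseteq> G \<inter> {l. l \<noteq> []}"
  shows "dB bar_ops (lin_ext prepend_unit x) + lin_ext prepend_unit (dB bar_ops x) = x"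
proof (rule klin_eqI[where f = "\<lambda>x. dB bar_ops (lin_ext prepend_unit x) + lin_ext prepend_unit (dB bar_ops x)", OF _ klin_id assms])
  fix l assume l: "l \<in> G \<inter> {l. l \<noteq> []}"
  let ?e = "unit (src (hd l))"
  have hd: "hd l \<in> B" using l by (cases l) (auto simp: G_def)
  have e: "?e \<in> B" using hd unit_B ends_V0 by blast
  obtain n where n: "length l = Suc n" using l by (cases l) auto
  have f0: "face A 0 (?e # l) = l"
    using l face_inner[of A "[]" ?e "hd l" "tl l"] unit_l[OF hd] by simp
  have fS: "nonzero_part (face A (Suc i) (?e # l)) = lin_ext prepend_unit (nonzero_part (face A i l))" if i: "i < n" for i
  proof -
    obtain us a b vs where s: "l = us @ a # b # vs" "i = length us"
      using i n by (rule_tac face_cases[of i l]) auto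
    have f: "face A i l = us @ (a \<otimes>\<^bsub>A\<^esub> b) # vs" "face A (Suc i) (?e # l) = ?e # us @ (a \<otimes>\<^bsub>A\<^esub> b) # vs"
      using face_inner[of A us a b vs] face_inner[of A "?e # us" a b vs] s by simp_all
    show ?thesis
    proof (cases "face A i l \<in> G")
      case True
      then have ab: "a \<in> B" "b \<in> B" "a \<otimes>\<^bsub>A\<^esub> b \<in> B" using l True[unfolded f(1)] by (auto simp: G_def s(1))
      then have "src (hd (face A i l)) = src (hd l)"
        unfolding f(1) unfolding s(1) using mult_ends[OF ab] by (cases us) auto
      moreover have "face A (Suc i) (?e # l) \<in> G" using True e by (auto simp: G_def f)
      ultimately show ?thesis using True by (simp add: nonzero_part_G prepend_unit_def) (simp add: f)
    next
      case False
      then have "face A (Suc i) (?e # l) \<notin> G" by (auto simp: G_def f)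
      then show ?thesis using False by (simp add: nonzero_part_not_G)
    qed
  qed
  have "dB bar_ops (lin_ext prepend_unit (single l 1)) =
      (\<Sum>i<Suc n. pm_scale ((- 1) ^ i) (nonzero_part (face A i (?e # l))))"
    using n by (simp add: dB_def prepend_unit_def bar_single klin_sum[OF klin_restr] restr_G_scale del: sum.lessThan_Suc)
  also have "\<dots> = single l 1 - (\<Sum>i<n. pm_scale ((- 1) ^ i) (lin_ext prepend_unit (nonzero_part (face A i l))))"
    unfolding sum.lessThan_Suc_shift using f0 l fS by (simp add: nonzero_part_G sum_negf)
  also have "(\<Sum>i<n. pm_scale ((- 1) ^ i) (lin_ext prepend_unit (nonzero_part (face A i l)))) = lin_ext prepend_unit (dB bar_ops (single l 1))"
    using n by (simp add: dB_def bar_single klin_sum[OF klin_restr] klin_sum[OF klin_lin_ext] restr_G_scale lin_ext_scale)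
  finally show "dB bar_ops (lin_ext prepend_unit (single l 1)) + lin_ext prepend_unit (dB bar_ops (single l 1))
    = single l 1" by simp
qed (rule klin_add[OF klin_comp[OF klin_dB klin_lin_ext] klin_comp[OF klin_lin_ext klin_dB]])

lemma keys_insert_unit:
  assumes "keys x \<subseteq> G \<inter> Non \<inter> {l. length l = m}" "1 \<le> m"
  shows "keys (lin_ext insert_unit x) \<subseteq> G \<inter> Non \<inter> {l. length l = Suc m}"
proof (rule keys_lin_ext[OF assms(1)])
  fix l assume l: "l \<in> G \<inter> Non \<inter> {l. length l = m}"
  then have "l \<noteq> []" "\<not> cyc l" using assms(2) by (auto simp: Non_def)
  then obtain r z q where rzq: "l = r @ z # q" and sp: "split r z q"
    using split_exists by blast
  let ?L = "r @ z # unit (tgt z) # q"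
  have "z \<in> B" using l by (auto simp: G_def rzq)
  then have L: "?L \<in> G" using l unit_B ends_V0 by (auto simp: G_def rzq)
  moreover have "act A (Face (length r)) ?L = l"
    using insert_unit_faces(2)[OF _ sp] l rzq by auto
  ultimately have "?L \<in> Non"
    using l stable_classes(1)[unfolded stable_def, rule_format, of ?L "Face (length r)"] by auto
  then show "keys (insert_unit l) \<subseteq> G \<inter> Non \<inter> {l. length l = Suc m}"
    using L insert_unit_split[OF sp] l rzq by auto
qed

lemma keys_prepend_unit:
  assumes "keys x \<subseteq> G \<inter> Non \<inter> {l. length l = m}" "1 \<le> m"
  shows "keys (lin_ext prepend_unit x) \<subseteq> G \<inter> Non \<inter> {l. length l = Suc m}"
proof (rule keys_lin_ext[OF assms(1)])
  fix l assume l: "l \<in> G \<inter> Non \<inter> {l. length l = m}"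
  let ?L = "unit (src (hd l)) # l"
  have hd: "hd l \<in> B" "l \<noteq> []" using l assms(2) by (cases l; auto simp: G_def)+
  then have L: "?L \<in> G" using l unit_B ends_V0 by (auto simp: G_def)
  have "act A (Face 0) ?L = l"
    using face_inner[of A "[]" "unit (src (hd l))" "hd l" "tl l"] unit_l[OF hd(1)] hd(2) by simp
  moreover have "1 \<le> length l" using hd(2) by (simp add: Suc_le_eq)
  ultimately have "?L \<in> Non"
    using l L stable_classes(1)[unfolded stable_def, rule_format, of ?L "Face 0"] by auto
  then show "keys (prepend_unit l) \<subseteq> G \<inter> Non \<inter> {l. length l = Suc m}"
    using L l by (auto simp: prepend_unit_def)
qed

end

section \<open>The homology is carried by cyclically composable tensors of positive length\<close>

context graded_basis
begin

lemma hoch_length_1: "keys x \<subseteq> {l. length l = 1} \<Longrightarrow> op_of A hoch_ops x = 0"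
  and bar_length_1: "keys x \<subseteq> {l. length l = 1} \<Longrightarrow> op_of A bar_ops x = 0"
  by (rule klin_eqI[OF klin_op_of klin_const0], assumption, simp add: hoch_single bar_single)+

lemma Non_acyclic_hoch:
  assumes x: "keys x \<subseteq> G \<inter> Non \<inter> {l. length l = Suc n}" and z: "n > 0 \<longrightarrow> dB hoch_ops x = 0"
  shows "\<exists>y. keys y \<subseteq> G \<inter> Non \<inter> {l. length l = Suc (Suc n)} \<and> dB hoch_ops y = x"
proof (intro exI conjI)
  show "keys (lin_ext insert_unit x) \<subseteq> G \<inter> Non \<inter> {l. length l = Suc (Suc n)}"
    by (rule keys_insert_unit[OF x]) simp
  have "dB hoch_ops x = 0"
  proof (cases "n = 0")
    case True
    then show ?thesis using hoch_length_1[of x] x by (auto simp: dB_def)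
  qed (use z in simp)
  moreover have "keys x \<subseteq> G \<inter> Non \<inter> {l. l \<noteq> []}" using x by auto
  ultimately show "dB hoch_ops (lin_ext insert_unit x) = x" using insert_homotopy[of x] by simp
qed

text \<open>
  The differential of column \<open>p\<close> of the cyclic bicomplex.
\<close>
definition vert :: "nat \<Rightarrow> ('a list \<Rightarrow>\<^sub>0 'k) \<Rightarrow> ('a list \<Rightarrow>\<^sub>0 'k)" where
  "vert p x = (if even p then op_of A hoch_ops x else - op_of A bar_ops x)"

definition vert_h :: "nat \<Rightarrow> ('a list \<Rightarrow>\<^sub>0 'k) \<Rightarrow> ('a list \<Rightarrow>\<^sub>0 'k)" where
  "vert_h p x = (if even p then lin_ext insert_unit x else - lin_ext prepend_unit x)"

lemma klin_vert [intro!, simp]: "klin (vert p)"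
  unfolding vert_def by (rule klin_if) auto

lemma vert_homotopy:
  assumes x: "keys x \<subseteq> G \<inter> Non \<inter> {l. length l = m}" "1 \<le> m"
    and z: "restr G (vert p x) = 0"
  shows "keys (vert_h p x) \<subseteq> G \<inter> Non \<inter> {l. length l = Suc m}"
    and "restr G (vert p (vert_h p x)) = x"
proof -
  have ne: "keys x \<subseteq> G \<inter> Non \<inter> {l. l \<noteq> []}" "keys x \<subseteq> G \<inter> {l. l \<noteq> []}"
    using x by auto
  show "keys (vert_h p x) \<subseteq> G \<inter> Non \<inter> {l. length l = Suc m}"
    using keys_insert_unit[OF x] keys_prepend_unit[OF x] by (auto simp: vert_h_def)
  show "restr G (vert p (vert_h p x)) = x"
    using insert_homotopy[OF ne(1)] prepend_homotopy[OF ne(2)] z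
    by (auto simp: vert_def vert_h_def dB_def klin_uminus[OF klin_op_of] restr_uminus)
qed

lemma cyc_op_vert:
  assumes "keys x \<subseteq> {l. length l = m}"
  obtains y where "op_of A (cyc_ops n) x = vert (n + 1 - m) x + y" "keys y \<subseteq> {l. length l = m}"
proof -
  have t: "keys (op_of A t_ops x) \<subseteq> {l. length l = m}"
    by (rule keys_op_of[OF assms]) (auto simp: t_ops_def)
  have N: "keys (op_of A N_ops x) \<subseteq> {l. length l = m}"
    by (rule keys_op_of[OF assms]) (auto simp: N_ops_def)
  have xt: "keys (x - op_of A t_ops x) \<subseteq> {l. length l = m}"
    using assms t by (rule keys_minusI)
  consider "n + 1 - m = 0" | "n + 1 - m \<noteq> 0" "even (n + 1 - m)" | "odd (n + 1 - m)"
    by blast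
  then show thesis
  proof cases
    case 1
    then show thesis using that[of 0] by (simp add: cyc_op_pure[OF assms] vert_def Let_def)
  next
    case 2
    then show thesis using that[of "op_of A N_ops x", OF _ N]
      by (simp only: cyc_op_pure[OF assms] vert_def Let_def) simp
  next
    case 3
    then have "n + 1 - m \<noteq> 0" by (metis even_zero)
    then show thesis using 3 that[of "x - op_of A t_ops x", OF _ xt]
      by (simp only: cyc_op_pure[OF assms] vert_def Let_def) simp
  qed
qed

lemma vert_keys:
  assumes "keys x \<subseteq> {l. length l = Suc m}"
  shows "keys (vert p x) \<subseteq> {l. length l = m}"
proof -
  have "keys (op_of A hoch_ops x) \<subseteq> {l. length l = m}"
    by (rule keys_op_of[OF assms]) (auto simp: hoch_ops_def length_face split: if_splits)
  moreover have "keys (op_of A bar_ops x) \<subseteq> {l. length l = m}"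
    by (rule keys_op_of[OF assms]) (auto simp: bar_ops_def length_face)
  ultimately show ?thesis by (simp add: vert_def)
qed

text \<open>
  In the square of the total differential the horizontal and the mixed terms cancel by the identities
  of the bicomplex; what is left is the square of the vertical differential.
\<close>
lemma cyc_cyc_pure:
  assumes y: "keys y \<subseteq> {l. length l = Suc m}" and m: "1 \<le> m" "m \<le> n + 1"
  shows "op_of A (cyc_ops n) (op_of A (cyc_ops (n + 1)) y) = vert (n + 1 - m) (vert (n + 1 - m) y)"
proof -
  let ?p = "n + 1 - m"
  let ?b = "op_of A hoch_ops" and ?b' = "op_of A bar_ops" and ?N = "op_of A N_ops" and ?t = "op_of A t_ops"
  have yne: "keys y \<subseteq> {l. l \<noteq> []}" and y2: "keys y \<subseteq> {l. 2 \<le> length l}"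
    using y m by auto
  have len: "keys (?b y) \<subseteq> {l. length l = m}" "keys (?b' y) \<subseteq> {l. length l = m}"
    using vert_keys[OF y, of 0] vert_keys[OF y, of 1] by (auto simp: vert_def)
  have t: "keys (?t y) \<subseteq> {l. length l = Suc m}"
    by (rule keys_op_of[OF y]) (auto simp: t_ops_def)
  have N: "keys (?N y) \<subseteq> {l. length l = Suc m}"
    by (rule keys_op_of[OF y]) (auto simp: N_ops_def)
  have yt: "keys (y - ?t y) \<subseteq> {l. length l = Suc m}"
    using y t by (rule keys_minusI)
  note lin = klin_plus[OF klin_op_of] klin_minus[OF klin_op_of] klin_uminus[OF klin_op_of]
  note pure = cyc_op_pure[OF y, of A "n + 1"] cyc_op_pure[OF len(1), of A n] cyc_op_pure[OF len(2), of A n]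
    cyc_op_pure[OF N, of A n] cyc_op_pure[OF yt, of A n]
  note ids = b_t_identity[OF y2, of A] N_t_identity[OF yne, of A] b_N_identity[OF y2, of A]
  have ids': "?t (?N y) = ?N y" using ids(3) by simp
  consider "?p = 0" | "?p > 0" "even ?p" | "odd ?p" by fastforce
  then show ?thesis
  proof cases
    case 1
    then have D: "op_of A (cyc_ops (n + 1)) y = ?b y" and "m = n + 1"
      using pure(1) m by auto
    then show ?thesis using pure(2) by (simp add: vert_def)
  next
    case 2
    then have D: "op_of A (cyc_ops (n + 1)) y = ?b y + ?N y"
      and Db: "op_of A (cyc_ops n) (?b y) = ?b (?b y) + ?N (?b y)"
      using pure(1,2) m by (auto simp: Let_def)
    have "odd (n + 1 - Suc m)" using 2 m by auto
    then have DN: "op_of A (cyc_ops n) (?N y) = - ?b' (?N y) + (?N y - ?t (?N y))"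
      using pure(4) by (auto simp: Let_def)
    show ?thesis unfolding D lin Db DN using 2 ids(4) ids' by (simp add: vert_def)
  next
    case 3
    then have D: "op_of A (cyc_ops (n + 1)) y = - ?b' y + (y - ?t y)"
      and Db: "op_of A (cyc_ops n) (?b' y) = - ?b' (?b' y) + (?b' y - ?t (?b' y))"
      using pure(1,3) m by (auto simp: Let_def)
    have "even (n + 1 - Suc m)" using 3 m by auto
    then have DT: "op_of A (cyc_ops n) (y - ?t y) = ?b (y - ?t y)"
      using pure(5) ids(2) by (auto simp: Let_def)
    show ?thesis
      unfolding D klin_plus[OF klin_op_of, of A _ "- ?b' y"] klin_uminus[OF klin_op_of] Db DT
      using 3 ids(1) by (simp add: vert_def klin_uminus[OF klin_op_of])
  qed
qed

lemma ops_map_cyc': "ops_map (cyc_ops (Suc n)) {1..Suc (Suc n)} {1..Suc n}"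
  using ops_map_cyc[of n] by simp

text \<open>
  The component of least length \<open>m\<close> of a cycle lies in the last nonzero column
  \<open>n + 1 - m\<close>. The horizontal differentials lead to smaller columns, so this component is a cycle
  for the vertical differential and hence a vertical boundary. Subtracting the total boundary of a
  vertical preimage leaves a cycle with lengths at least \<open>m + 1\<close>, and lengths are bounded by
  \<open>n + 1\<close>.
\<close>
lemma Non_acyclic_cyc:
  assumes "keys x \<subseteq> G \<inter> Non \<inter> {l. length l \<in> {m..Suc n}}"
    and "n > 0 \<longrightarrow> dB (cyc_ops n) x = 0" "1 \<le> m" "m \<le> n + 2"
  shows "\<exists>y. keys y \<subseteq> G \<inter> Non \<inter> {l. length l \<in> {1..Suc (Suc n)}} \<and> dB (cyc_ops (Suc n)) y = x"
  using assms
proof (induction "n + 2 - m" arbitrary: m x)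
  case 0
  then have "keys x \<subseteq> {}" by force
  then have "x = 0" by simp
  then show ?case by (intro exI[of _ 0]) (simp add: klin_zero)
next
  case (Suc k)
  have m: "1 \<le> m" "m \<le> n + 1" using Suc by auto
  let ?p = "n + 1 - m"
  define x0 where "x0 = restr {l. length l = m} x"
  have x0: "keys x0 \<subseteq> G \<inter> Non \<inter> {l. length l = m}" using Suc.prems(1) by (auto simp: x0_def)
  have v0: "restr G (vert ?p x0) = 0"
  proof (cases "m = 1")
    case True
    then have "vert ?p x0 = 0" using hoch_length_1[of x0] bar_length_1[of x0] x0 by (auto simp: vert_def)
    then show ?thesis by simp
  next
    case False
    have "restr {l. length l = m - 1} (op_of A (cyc_ops n) x)
        = restr {l. length l = m - 1} (vert ?p (restr {l. length l = m} x))"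
    proof (rule klin_eqI[where f = "\<lambda>x. restr {l. length l = m - 1} (op_of A (cyc_ops n) x)"
          and g = "\<lambda>x. restr {l. length l = m - 1} (vert ?p (restr {l. length l = m} x))"
          and S = "{l. m \<le> length l}"])
      fix l :: "'a list" assume "l \<in> {l. m \<le> length l}"
      then have l: "m \<le> length l" by simp
      let ?s = "single l (1::'k)"
      obtain z where z: "op_of A (cyc_ops n) ?s = vert (n + 1 - length l) ?s + z"
        "keys z \<subseteq> {l'. length l' = length l}"
        by (rule cyc_op_vert[of ?s "length l" n]) auto
      have rz: "restr {l. length l = m - 1} z = 0"
        by (rule restr_empty) (use z(2) l m in force)
      show "restr {l. length l = m - 1} (op_of A (cyc_ops n) ?s)
          = restr {l. length l = m - 1} (vert ?p (restr {l. length l = m} ?s))"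
      proof (cases "length l = m")
        case True
        then show ?thesis using z(1) rz by (simp add: restr_plus restr_single)
      next
        case neq: False
        have "keys (vert (n + 1 - length l) ?s) \<subseteq> {l'. length l' = length l - 1}"
          using vert_keys[of ?s "length l - 1"] l m by simp
        then have "restr {l. length l = m - 1} (vert (n + 1 - length l) ?s) = 0"
          using neq l m False by (intro restr_empty) force
        then show ?thesis
          using z(1) rz neq by (simp add: restr_plus restr_single klin_zero)
      qed
    next
      show "keys x \<subseteq> {l. m \<le> length l}" using Suc.prems(1) by auto
    qed (rule klin_comp[OF klin_restr klin_op_of],
        rule klin_comp[OF klin_restr klin_comp[OF klin_vert klin_restr]])
    moreover have "restr {l. length l = m - 1} (vert ?p x0) = vert ?p x0"
      by (rule restr_id, rule vert_keys) (use x0 False m in auto)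
    ultimately have "restr G (vert ?p x0) = restr {l. length l = m - 1} (dB (cyc_ops n) x)"
      by (simp add: x0_def dB_def Int_commute) (metis restr_restr Int_commute)
    moreover have "n > 0" using False m by simp
    ultimately show ?thesis using Suc.prems(2) by simp
  qed
  \<comment> \<open>\<open>y\<close> has length \<open>m + 1\<close> and total degree \<open>n + 1\<close>, so it lies in the same column \<open>?p\<close> as \<open>x0\<close>\<close>
  define y where "y = vert_h ?p x0"
  have y: "keys y \<subseteq> G \<inter> Non \<inter> {l. length l = Suc m}" and vy: "restr G (vert ?p y) = x0"
    using vert_homotopy[OF x0 m(1) v0] by (simp_all add: y_def)
  have yL: "keys y \<subseteq> G \<inter> Non \<inter> {l. length l \<in> {1..Suc (Suc n)}}" using y m by fastforce
  define x' where "x' = x - dB (cyc_ops (Suc n)) y"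
  have Dy: "keys (dB (cyc_ops (Suc n)) y) \<subseteq> G \<inter> Non \<inter> {l. length l \<in> {1..Suc n}}"
    by (rule dB_keys_stable[OF stable_classes(1) ops_map_cyc' yL])
  obtain w where w: "op_of A (cyc_ops (Suc n)) y = vert (Suc n + 1 - Suc m) y + w"
    "keys w \<subseteq> {l. length l = Suc m}"
    using cyc_op_vert[of y "Suc m" "Suc n"] y by blast
  have Dyw: "dB (cyc_ops (Suc n)) y = x0 + restr G w" using w vy by (simp add: dB_def restr_plus)
  have x'1: "keys x' \<subseteq> G \<inter> Non \<inter> {l. length l \<in> {1..Suc n}}"
  proof -
    have "keys x \<subseteq> G \<inter> Non \<inter> {l. length l \<in> {1..Suc n}}" using Suc.prems(1) m by auto
    then show ?thesis unfolding x'_def using Dy by (rule keys_minusI)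
  qed
  have "keys (x - x0 - restr G w) \<subseteq> {l. Suc m \<le> length l}"
  proof -
    have "keys (x - x0) \<subseteq> {l. Suc m \<le> length l}"
    proof
      fix l assume l: "l \<in> keys (x - x0)"
      then have "length l \<noteq> m" by (auto simp: x0_def in_keys_iff lookup_minus lookup_restr)
      moreover have "l \<in> keys x"
        using l by (auto simp: x0_def in_keys_iff lookup_minus lookup_restr split: if_splits)
      ultimately show "l \<in> {l. Suc m \<le> length l}" using Suc.prems(1) by fastforce
    qed
    moreover have "keys (restr G w) \<subseteq> {l. Suc m \<le> length l}" using w(2) by auto
    ultimately show ?thesis by (rule keys_minusI)
  qed
  then have x'2: "keys x' \<subseteq> {l. Suc m \<le> length l}" by (simp add: x'_def Dyw diff_diff_eq)
  have DDy: "n > 0 \<longrightarrow> dB (cyc_ops n) (dB (cyc_ops (Suc n)) y) = 0"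
  proof
    assume "n > 0"
    then obtain n' where n': "n = Suc n'" by (cases n) auto
    have "dB (cyc_ops n) (dB (cyc_ops (Suc n)) y) = restr G (op_of A (cyc_ops n) (op_of A (cyc_ops (Suc n)) y))"
      using dB_dB[OF ops_map_cyc'[of n] ops_map_cyc'[of n', folded n'], of y] yL by auto
    also have "\<dots> = restr G (vert ?p (vert ?p y))"
      using cyc_cyc_pure[of y m n] y m by auto
    also have "\<dots> = restr G (vert ?p (restr G (vert ?p y)))"
    proof (cases "even ?p")
      case True
      have o: "ops_map hoch_ops {Suc m} {m}" "ops_map hoch_ops {m} {m - 1}"
        using ops_map_hoch[of "m - 1"] m by (auto simp: ops_map_def hoch_ops_def)
      show ?thesis using dB_dB[OF o, of y] y True by (auto simp: vert_def dB_def)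
    next
      case False
      have o: "ops_map bar_ops {Suc m} {m}" "ops_map bar_ops {m} {m - 1}"
        using m by (auto simp: ops_map_def bar_ops_def)
      show ?thesis using dB_dB[OF o, of y] y False
        by (auto simp: vert_def dB_def restr_uminus klin_uminus[OF klin_op_of])
    qed
    finally show "dB (cyc_ops n) (dB (cyc_ops (Suc n)) y) = 0" using v0 unfolding vy by simp
  qed
  have "\<exists>y'. keys y' \<subseteq> G \<inter> Non \<inter> {l. length l \<in> {1..Suc (Suc n)}} \<and> dB (cyc_ops (Suc n)) y' = x'"
  proof (rule Suc.hyps(1)[of "Suc m"])
    show "k = n + 2 - Suc m" using Suc.hyps(2) by simp
    show "keys x' \<subseteq> G \<inter> Non \<inter> {l. length l \<in> {Suc m..Suc n}}" using x'1 x'2 by fastforce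
    show "n > 0 \<longrightarrow> dB (cyc_ops n) x' = 0"
      using Suc.prems(2) DDy by (auto simp: x'_def klin_minus[OF klin_dB])
  qed (use m in auto)
  then obtain y' where y': "keys y' \<subseteq> G \<inter> Non \<inter> {l. length l \<in> {1..Suc (Suc n)}}"
    "dB (cyc_ops (Suc n)) y' = x'" by auto
  show ?case
  proof (intro exI conjI)
    show "keys (y + y') \<subseteq> G \<inter> Non \<inter> {l. length l \<in> {1..Suc (Suc n)}}"
      using yL y'(1) by (rule keys_plusI)
    show "dB (cyc_ops (Suc n)) (y + y') = x" using y' by (simp add: klin_plus[OF klin_dB] x'_def)
  qed
qed

subsection \<open>Tensors of trivial paths\<close>

text \<open>
  A composable list of identities is constant.
\<close>
lemma Triv_replicate:
  assumes "l \<in> G" "l \<in> Triv"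
  obtains v m where "v \<in> V0" "l = replicate (Suc m) (unit v)"
proof -
  have "chain u l w \<Longrightarrow> set l \<subseteq> B \<Longrightarrow> size_of l = 0 \<Longrightarrow> l = replicate (length l) (unit u)" for u w l
  proof (induction l arbitrary: u)
    case (Cons a l)
    have a: "a = unit u" using len_0[of a] Cons.prems by (auto simp: size_of_def)
    moreover have "u \<in> V0" using Cons.prems ends_V0 by auto
    ultimately have "tgt a = u" using unit_ends by simp
    then show ?case using Cons a by (simp add: size_of_def)
  qed simp
  moreover obtain v where "chain v l v" "l \<noteq> []" "size_of l = 0" "set l \<subseteq> B"
    using assms by (auto simp: Triv_def cyc_def G_def)
  moreover have "v \<in> V0"
    using \<open>chain v l v\<close> \<open>l \<noteq> []\<close> \<open>set l \<subseteq> B\<close> ends_V0 by (cases l) auto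
  ultimately have "v \<in> V0" "l = replicate (Suc (length l - 1)) (unit v)" by (metis, metis Suc_diff_1 length_greater_0_conv)
  then show thesis using that by blast
qed

lemma replicate_Triv:
  assumes "v \<in> V0"
  shows "replicate (Suc m) (unit v) \<in> G" "replicate (Suc m) (unit v) \<in> Triv"
proof -
  have "chain v (replicate m (unit v)) v" for m
    using assms by (induction m) (auto simp: unit_ends)
  from this[of "Suc m"] show "replicate (Suc m) (unit v) \<in> Triv"
    using assms by (auto simp: Triv_def cyc_def size_of_def unit_len sum_list_replicate simp del: replicate_Suc)
  show "replicate (Suc m) (unit v) \<in> G" using unit_B[OF assms] by (auto simp: G_def)
qed

lemma act_replicate:
  assumes "v \<in> V0" "valid_gen g m"
  shows "act A g (replicate m (unit v)) = replicate (out_length g m) (unit v)"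
proof (rule replicate_eqI)
  have "unit v \<otimes>\<^bsub>A\<^esub> unit v = unit v" using unit_l[OF unit_B[OF assms(1)]] unit_ends assms by simp
  then have "set (act A g (replicate m (unit v))) \<subseteq> {unit v}"
    using assms by (intro set_act) (auto split: if_splits)
  then show "y = unit v" if "y \<in> set (act A g (replicate m (unit v)))" for y using that by auto
qed (use length_act[of g "replicate m (unit v)" A] assms in simp)

lemma op_of_Triv:
  assumes "ops_map ops L L'" "keys x \<subseteq> G \<inter> Triv \<inter> {l. length l \<in> L}"
  shows "keys (op_of A ops x) \<subseteq> G"
proof (rule keys_op_of[OF assms(2)])
  fix l c g assume l: "l \<in> G \<inter> Triv \<inter> {l. length l \<in> L}" and cg: "(c, g) \<in> set (ops (length l))"
  then have v: "valid_gen g (length l)" using assms(1) by (auto simp: ops_map_def)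
  obtain v m where vm: "v \<in> V0" "l = replicate (Suc m) (unit v)" using Triv_replicate[of l] l by auto
  have "act A g l = replicate (out_length g (Suc m)) (unit v)"
    using act_replicate[OF vm(1), of g "Suc m"] v by (simp add: vm del: replicate_Suc)
  then show "act A g l \<in> G" using unit_B[OF vm(1)] by (auto simp: G_def)
qed

lemma alternating_sum: "(\<Sum>i<m. (- 1) ^ i :: 'k) = (if odd m then 1 else 0)"
  by (induction m) (auto simp: minus_one_power_iff)

lemma sum_single: "(\<Sum>i\<in>I. single l (f i :: 'k)) = single l (sum f I)"
  by (induction I rule: infinite_finite_induct) (auto simp: single_add)

lemma hoch_replicate:
  assumes "v \<in> V0" "2 \<le> m"
  shows "op_of A hoch_ops (single (replicate m (unit v)) 1)
    = (if odd m then single (replicate (m - 1) (unit v)) 1 else 0)"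
proof -
  have "face A i (replicate m (unit v)) = replicate (m - 1) (unit v)" if "i < m" for i
    using act_replicate[OF assms(1), of "Face i" m] that assms(2) by simp
  then have "op_of A hoch_ops (single (replicate m (unit v)) 1)
      = (\<Sum>i<m. single (replicate (m - 1) (unit v)) ((- 1) ^ i))"
    using assms(2) by (simp add: hoch_single)
  then show ?thesis unfolding sum_single alternating_sum by simp
qed

lemma bar_replicate:
  assumes "v \<in> V0" "2 \<le> m"
  shows "op_of A bar_ops (single (replicate m (unit v)) 1)
    = (if even m then single (replicate (m - 1) (unit v)) 1 else 0)"
proof -
  have "face A i (replicate m (unit v)) = replicate (m - 1) (unit v)" if "i < m" for i
    using act_replicate[OF assms(1), of "Face i" m] that assms(2) by simp
  then have "op_of A bar_ops (single (replicate m (unit v)) 1)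
      = (\<Sum>i<m - 1. single (replicate (m - 1) (unit v)) ((- 1) ^ i))"
    by (simp add: bar_single)
  then show ?thesis unfolding sum_single alternating_sum using assms(2) by simp
qed

text \<open>
  For \<open>m \<ge> 2\<close> the differential of the constant list of length \<open>m\<close> is the constant list of length \<open>m - 1\<close> if
  \<open>m\<close> is odd, and zero if \<open>m\<close> is even. Hence repeating the first entry is a contracting homotopy.
\<close>
lemma Triv_acyclic_hoch:
  assumes x: "keys x \<subseteq> G \<inter> Triv \<inter> {l. length l = Suc n}" and z: "dB hoch_ops x = 0" and n: "n \<ge> 1"
  shows "\<exists>y. keys y \<subseteq> G \<inter> Triv \<inter> {l. length l = Suc (Suc n)} \<and> dB hoch_ops y = x"
proof -
  let ?T = "lin_ext (\<lambda>l. single (hd l # l) (1::'k))"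
  have "dB hoch_ops (?T x) + ?T (dB hoch_ops x) = x"
  proof (rule klin_eqI[where f = "\<lambda>x. dB hoch_ops (?T x) + ?T (dB hoch_ops x)", OF _ klin_id x])
    fix l assume l: "l \<in> G \<inter> Triv \<inter> {l. length l = Suc n}"
    then obtain v m where "v \<in> V0" "l = replicate (Suc m) (unit v)" using Triv_replicate[of l] by auto
    then have v: "v \<in> V0" "l = replicate (Suc n) (unit v)" using l by auto
    have T: "?T (single (replicate (Suc k) (unit v)) 1)
        = single (replicate (Suc (Suc k)) (unit v)) 1" for k by simp
    have d1: "dB hoch_ops (single l 1) = (if odd (Suc n) then single (replicate n (unit v)) 1 else 0)"
      using hoch_replicate[OF v(1), of "Suc n"] n replicate_Triv(1)[OF v(1), of "n - 1"]
      by (simp add: v dB_def restr_single del: replicate_Suc)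
    have d2: "dB hoch_ops (single (replicate (Suc (Suc n)) (unit v)) 1)
        = (if even (Suc n) then single l 1 else 0)"
      using hoch_replicate[OF v(1), of "Suc (Suc n)"] replicate_Triv(1)[OF v(1), of n]
      by (simp add: v dB_def restr_single del: replicate_Suc)
    show "dB hoch_ops (?T (single l 1)) + ?T (dB hoch_ops (single l 1)) = single l 1"
      unfolding d1 using d2 T[of n] T[of "n - 1"] n by (auto simp: v simp del: replicate_Suc lin_ext_single)
  qed (rule klin_add[OF klin_comp[OF klin_dB klin_lin_ext] klin_comp[OF klin_lin_ext klin_dB]])
  then have "dB hoch_ops (?T x) = x" using z by simp
  moreover have "keys (?T x) \<subseteq> G \<inter> Triv \<inter> {l. length l = Suc (Suc n)}"
  proof (rule keys_lin_ext[OF x])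
    fix l assume l: "l \<in> G \<inter> Triv \<inter> {l. length l = Suc n}"
    then obtain v m where "v \<in> V0" "l = replicate (Suc m) (unit v)" using Triv_replicate[of l] by auto
    then show "keys (single (hd l # l) (1::'k)) \<subseteq> G \<inter> Triv \<inter> {l. length l = Suc (Suc n)}"
      using l replicate_Triv[of v "Suc m"] by auto
  qed
  ultimately show ?thesis by blast
qed

text \<open>
  For odd \<open>n\<close>, the total differential sends the constant list of length \<open>m + 1\<close> to plus or
  minus the one of length \<open>m\<close> plus a multiple of itself, and for \<open>m = n + 1\<close> this multiple is zero.
  So all constant lists are boundaries, by descending induction on the length.
\<close>
lemma Triv_acyclic_cyc:
  assumes x: "keys x \<subseteq> G \<inter> Triv \<inter> {l. length l \<in> {1..Suc n}}" and n: "odd n"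
  shows "\<exists>y. keys y \<subseteq> G \<inter> Triv \<inter> {l. length l \<in> {1..Suc (Suc n)}} \<and> dB (cyc_ops (Suc n)) y = x"
proof -
  define Y :: "('a list \<Rightarrow>\<^sub>0 'k) set" where "Y = {y. keys y \<subseteq> G \<inter> Triv \<inter> {l. length l \<in> {1..Suc (Suc n)}}}"
  define W where "W = dB (cyc_ops (Suc n)) ` Y"
  have Y: "pmv.subspace Y" unfolding Y_def by (rule subspace_keys)
  have W: "pmv.subspace W"
    unfolding W_def pmv.subspace_def
  proof (intro conjI ballI allI)
    show "0 \<in> dB (cyc_ops (Suc n)) ` Y"
      using pmv.subspace_0[OF Y] klin_zero[OF klin_dB] by (metis image_eqI)
    show "a + b \<in> dB (cyc_ops (Suc n)) ` Y" if "a \<in> dB (cyc_ops (Suc n)) ` Y" "b \<in> dB (cyc_ops (Suc n)) ` Y" for a b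
      using that pmv.subspace_add[OF Y] by (auto simp flip: klin_plus[OF klin_dB])
    show "pm_scale c a \<in> dB (cyc_ops (Suc n)) ` Y" if "a \<in> dB (cyc_ops (Suc n)) ` Y" for a c
      using that pmv.subspace_scale[OF Y] by (auto simp flip: klin_scale[OF klin_dB])
  qed
  have rep: "single (replicate m (unit v)) 1 \<in> W" if v: "v \<in> V0" and m: "1 \<le> m" "m \<le> Suc n" for m v
    using m
  proof (induction "Suc n - m" arbitrary: m rule: less_induct)
    case less
    let ?s = "\<lambda>k. single (replicate k (unit v)) (1::'k)"
    have G: "replicate k (unit v) \<in> G" for k using unit_B[OF v] by (auto simp: G_def)
    obtain y where y: "op_of A (cyc_ops (Suc n)) (?s (Suc m)) = y + pm_scale (if even m then 1 else - 1) (?s m)"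
      "\<exists>c. y = pm_scale c (?s (Suc m))" "m = Suc n \<longrightarrow> y = 0"
    proof -
      have r: "rotate k (replicate (Suc m) (unit v)) = replicate (Suc m) (unit v)" for k
        using act_replicate[OF v, of "Rot k" "Suc m"] by simp
      have N: "op_of A N_ops (?s (Suc m)) = pm_scale (\<Sum>i<Suc m. (- 1) ^ (m * i)) (?s (Suc m))"
        by (simp add: N_single r sum_single del: replicate_Suc sum.lessThan_Suc)
      have t: "?s (Suc m) - op_of A t_ops (?s (Suc m)) = pm_scale (1 - (- 1) ^ m) (?s (Suc m))"
        by (simp add: t_single r pmv.scale_left_diff_distrib del: replicate_Suc pm_scale_single)
          (simp del: replicate_Suc)
      have pure: "op_of A (cyc_ops (Suc n)) (?s (Suc m)) = (let p = Suc n + 1 - Suc m in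
         if p = 0 then op_of A hoch_ops (?s (Suc m))
         else if even p then op_of A hoch_ops (?s (Suc m)) + op_of A N_ops (?s (Suc m))
         else - op_of A bar_ops (?s (Suc m)) + (?s (Suc m) - op_of A t_ops (?s (Suc m))))"
        by (rule cyc_op_pure) simp
      have hb: "op_of A hoch_ops (?s (Suc m)) = (if even m then ?s m else 0)"
        "op_of A bar_ops (?s (Suc m)) = (if odd m then ?s m else 0)"
        using hoch_replicate[OF v, of "Suc m"] bar_replicate[OF v, of "Suc m"] less.prems
        by (simp_all del: replicate_Suc)
      show thesis
      proof (cases "even m")
        case True
        then have ev: "even (Suc n + 1 - Suc m)" using n less.prems by simp
        show ?thesis
        proof (cases "m = Suc n")
          case eq: True
          have "\<exists>c. 0 = pm_scale c (?s (Suc m))" by (rule exI[of _ 0]) simp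
          then show ?thesis using that[of 0] pure True hb eq by (auto simp: Let_def)
        next
          case False
          then show ?thesis
            using that[of "op_of A N_ops (?s (Suc m))"] pure True hb ev less.prems N
            by (auto simp: Let_def add.commute simp del: replicate_Suc pm_scale_single)
        qed
      next
        case False
        then have od: "odd (Suc n + 1 - Suc m)" "m \<noteq> Suc n" using n less.prems by auto
        show ?thesis
          using that[of "?s (Suc m) - op_of A t_ops (?s (Suc m))"] pure False hb od less.prems t
          by (auto simp: Let_def simp del: replicate_Suc pm_scale_single)
      qed
    qed
    have inW: "dB (cyc_ops (Suc n)) (?s (Suc m)) \<in> W"
      using replicate_Triv[OF v, of m] less.prems by (auto simp: W_def Y_def)
    have "restr G y = y" using y(2) G by (auto intro!: restr_id simp del: replicate_Suc split: if_splits)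
    then have d: "dB (cyc_ops (Suc n)) (?s (Suc m)) = y + pm_scale (if even m then 1 else - 1) (?s m)"
      using y(1) G by (simp add: dB_def restr_plus restr_single del: replicate_Suc)
    have yW: "y \<in> W"
    proof (cases "m = Suc n")
      case True
      then show ?thesis using y(3) pmv.subspace_0[OF W] by simp
    next
      case False
      then have "?s (Suc m) \<in> W" using less by (intro less.hyps) auto
      then show ?thesis using y(2) pmv.subspace_scale[OF W] by blast
    qed
    have "pm_scale (if even m then 1 else - 1) (?s m) \<in> W"
      using pmv.subspace_diff[OF W inW yW] unfolding d by simp
    then have "pm_scale (if even m then 1 else - 1) (pm_scale (if even m then 1 else - 1) (?s m)) \<in> W"
      by (rule pmv.subspace_scale[OF W])
    then show "?s m \<in> W" by (simp split: if_splits)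
  qed
  have "x \<in> W"
  proof (rule klin_mem_subspace[OF klin_id W x])
    fix l assume l: "l \<in> G \<inter> Triv \<inter> {l. length l \<in> {1..Suc n}}"
    then obtain v m where "v \<in> V0" "l = replicate (Suc m) (unit v)" using Triv_replicate[of l] by auto
    then show "single l 1 \<in> W" using rep[of v "Suc m"] l by simp
  qed
  then show ?thesis by (auto simp: W_def Y_def)
qed

end

subsection \<open>Detecting classes by their composable part of positive length\<close>

text \<open>
  \<open>V\<close> and \<open>W\<close> are the cycles and boundaries of a complex on free chains, possibly with further
  chains added to \<open>W\<close>. The projection \<open>\<pi>\<close> identifies \<open>V/W\<close> with the homology of
  the smaller complex spanned by \<open>C1\<close>, \<open>C\<close> in two consecutive degrees, with differentials
  \<open>d1\<close> into \<open>C\<close> and \<open>d0\<close> out of \<open>C\<close>.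
\<close>
definition computes ::
  "('b \<Rightarrow>\<^sub>0 'k::field) set \<Rightarrow> ('b \<Rightarrow>\<^sub>0 'k) set \<Rightarrow> 'b set \<Rightarrow> 'b set \<Rightarrow>
   (('b \<Rightarrow>\<^sub>0 'k) \<Rightarrow> ('b \<Rightarrow>\<^sub>0 'k)) \<Rightarrow> (('b \<Rightarrow>\<^sub>0 'k) \<Rightarrow> ('b \<Rightarrow>\<^sub>0 'k)) \<Rightarrow> (('b \<Rightarrow>\<^sub>0 'k) \<Rightarrow> ('b \<Rightarrow>\<^sub>0 'k)) \<Rightarrow> bool" where
  "computes V W C C1 d0 d1 \<pi> \<longleftrightarrow> pmv.subspace V \<and> pmv.subspace W \<and> klin \<pi>
     \<and> (\<forall>x\<in>V. keys (\<pi> x) \<subseteq> C \<and> d0 (\<pi> x) = 0)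
     \<and> (\<forall>y. keys y \<subseteq> C \<and> d0 y = 0 \<longrightarrow> y \<in> V \<and> \<pi> y = y)
     \<and> (\<forall>x\<in>V. x \<in> W \<longleftrightarrow> (\<exists>u. keys u \<subseteq> C1 \<and> d1 u = \<pi> x))"

lemma subspace_image: "klin f \<Longrightarrow> pmv.subspace S \<Longrightarrow> pmv.subspace (f ` S)"
proof -
  assume f: "klin f" and S: "pmv.subspace S"
  have "0 \<in> f ` S" using pmv.subspace_0[OF S] klin_zero[OF f] by (metis image_eqI)
  then show ?thesis
    unfolding pmv.subspace_def using pmv.subspace_add[OF S] pmv.subspace_scale[OF S]
    by (auto simp flip: klin_plus[OF f] klin_scale[OF f])
qed

definition chain_ops :: "(nat \<Rightarrow> nat set) \<Rightarrow> (nat \<Rightarrow> nat \<Rightarrow> ('k::field \<times> gen) list) \<Rightarrow> bool" where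
  "chain_ops L ops \<longleftrightarrow> (\<forall>n. ops_map (ops (Suc n)) (L (Suc n)) (L n))"

lemma subspace_cycles:
  "pmv.subspace (cycles A L (\<lambda>n. op_of A' (ops n)) n)"
proof -
  have "cycles A L (\<lambda>n. op_of A' (ops n)) n = free_chains A L' \<inter> (if n = 0 then UNIV else {x. op_of A' (ops n) x \<in> tensor_rel A (L (n - 1))})"
    if "L' = L n" for L'
    using that by (auto simp: cycles_def)
  then show ?thesis
    using subspace_free_chains subspace_vimage[OF klin_op_of subspace_tensor_rel] pmv.subspace_UNIV
    by (auto intro!: pmv.subspace_inter)
qed

lemma subspace_boundaries: "pmv.subspace (boundaries A L (\<lambda>n. op_of A (ops n)) n)"
proof -
  have "boundaries A L (\<lambda>n. op_of A (ops n)) n =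
      {x + y | x y. x \<in> op_of A (ops (n + 1)) ` free_chains A (L (n + 1)) \<and> y \<in> tensor_rel A (L n)}"
    by (auto simp: boundaries_def)
  then show ?thesis
    using pmv.subspace_sums[OF subspace_image[OF klin_op_of subspace_free_chains] subspace_tensor_rel] by simp
qed

context graded_basis
begin

abbreviation Cyc :: "(nat \<Rightarrow> nat set) \<Rightarrow> (nat \<Rightarrow> nat \<Rightarrow> ('k \<times> gen) list) \<Rightarrow> nat \<Rightarrow> ('a list \<Rightarrow>\<^sub>0 'k) set" where
  "Cyc L ops n \<equiv> cycles A L (\<lambda>n. op_of A (ops n)) n"

abbreviation Bdr :: "(nat \<Rightarrow> nat set) \<Rightarrow> (nat \<Rightarrow> nat \<Rightarrow> ('k \<times> gen) list) \<Rightarrow> nat \<Rightarrow> ('a list \<Rightarrow>\<^sub>0 'k) set" where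
  "Bdr L ops n \<equiv> boundaries A L (\<lambda>n. op_of A (ops n)) n"

text \<open>
  Degree 0 is an exception because every chain of degree 0 is a cycle, whatever \<open>ops 0\<close> is.
\<close>
definition d_in :: "(nat \<Rightarrow> nat \<Rightarrow> ('k \<times> gen) list) \<Rightarrow> nat \<Rightarrow> ('a list \<Rightarrow>\<^sub>0 'k) \<Rightarrow> ('a list \<Rightarrow>\<^sub>0 'k)" where
  "d_in ops n x = (if n = 0 then 0 else dB (ops n) x)"

definition acyclic :: "(nat \<Rightarrow> nat set) \<Rightarrow> (nat \<Rightarrow> nat \<Rightarrow> ('k \<times> gen) list) \<Rightarrow> nat \<Rightarrow> 'a list set \<Rightarrow> bool" where
  "acyclic L ops n K \<longleftrightarrow> (\<forall>x. keys x \<subseteq> G \<inter> K \<inter> {l. length l \<in> L n} \<and> d_in ops n x = 0 \<longrightarrow>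
     (\<exists>y. keys y \<subseteq> G \<inter> K \<inter> {l. length l \<in> L (Suc n)} \<and> dB (ops (Suc n)) y = x))"

lemma G_free_chains: "keys x \<subseteq> G \<inter> {l. length l \<in> L} \<Longrightarrow> x \<in> free_chains A L"
  using B_carrier by (auto simp: free_chains_def G_def subset_iff)

lemma Phi_zero_iff:
  assumes "x \<in> free_chains A L"
  shows "x \<in> tensor_rel A L \<longleftrightarrow> Phi x = 0"
  using Phi_congruent[OF assms] Phi_tensor_rel by auto

lemma klin_d_in: "klin (d_in ops n)"
  unfolding d_in_def by (rule klin_if) auto

lemma Cyc_iff:
  assumes "chain_ops L ops"
  shows "x \<in> Cyc L ops n \<longleftrightarrow> x \<in> free_chains A (L n) \<and> d_in ops n (Phi x) = 0"
proof (cases n)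
  case 0
  then show ?thesis by (auto simp: cycles_def d_in_def)
next
  case (Suc m)
  have o: "ops_map (ops (Suc m)) (L (Suc m)) (L m)" using assms by (simp add: chain_ops_def)
  show ?thesis
    using Phi_zero_iff[OF op_of_free_chains[OF o, of x]] Phi_op_of[OF o, of x]
    by (auto simp: cycles_def d_in_def dB_def Suc)
qed

lemma op_of_congruent:
  assumes "ops_map ops L L'" "keys u \<subseteq> G \<inter> {l. length l \<in> L}"
  shows "op_of A ops u - dB ops u \<in> tensor_rel A L'"
proof -
  have u: "u \<in> free_chains A L" using G_free_chains assms(2) by blast
  have "Phi u = u" by (rule Phi_id) (use assms(2) in auto)
  then show ?thesis
    using Phi_congruent[OF op_of_free_chains[OF assms(1) u]] Phi_op_of[OF assms(1) u] by (simp add: dB_def)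
qed

lemma restr_d_in:
  assumes "chain_ops L ops" "stable K" "keys x \<subseteq> G \<inter> {l. length l \<in> L n}"
  shows "d_in ops n (restr K x) = restr K (d_in ops n x)"
proof (cases n)
  case (Suc m)
  have o: "ops_map (ops (Suc m)) (L (Suc m)) (L m)" using assms by (simp add: chain_ops_def)
  show ?thesis using restr_dB[OF assms(2) o, of x] assms(3) by (simp add: d_in_def Suc)
qed (simp add: d_in_def)

lemma classes_decompose: "x = restr Non x + restr Triv x + restr Pos x"
  by (rule poly_mapping_eqI) (auto simp: lookup_add lookup_restr Non_def Triv_def Pos_def)

lemma computesI:
  assumes L: "chain_ops L ops" and W: "pmv.subspace W"
    and detect: "\<And>x. x \<in> Cyc L ops n \<Longrightarrow> x \<in> W \<longleftrightarrow>
      (\<exists>u. keys u \<subseteq> G \<inter> Pos \<inter> {l. length l \<in> L (Suc n)} \<and> dB (ops (Suc n)) u = restr Pos (Phi x))"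
  shows "computes (Cyc L ops n) W (G \<inter> Pos \<inter> {l. length l \<in> L n}) (G \<inter> Pos \<inter> {l. length l \<in> L (Suc n)})
    (d_in ops n) (dB (ops (Suc n))) (\<lambda>x. restr Pos (Phi x))"
  unfolding computes_def
proof (intro conjI ballI allI impI)
  show "pmv.subspace (Cyc L ops n)" by (rule subspace_cycles)
  show "klin (\<lambda>x. restr Pos (Phi x))" by (rule klin_comp) auto
  fix x assume x: "x \<in> Cyc L ops n"
  have k: "keys (Phi x) \<subseteq> G \<inter> {l. length l \<in> L n}"
    using keys_Phi[of x "L n"] x by (simp add: Cyc_iff[OF L])
  then show "keys (restr Pos (Phi x)) \<subseteq> G \<inter> Pos \<inter> {l. length l \<in> L n}" by auto
  show "d_in ops n (restr Pos (Phi x)) = 0"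
    using restr_d_in[OF L stable_classes(3) k] x by (simp add: Cyc_iff[OF L])
next
  fix y assume y: "keys y \<subseteq> G \<inter> Pos \<inter> {l. length l \<in> L n} \<and> d_in ops n y = 0"
  then have "Phi y = y" by (intro Phi_id) auto
  moreover have "y \<in> free_chains A (L n)" using y by (intro G_free_chains) auto
  ultimately show "y \<in> Cyc L ops n" "restr Pos (Phi y) = y"
    using y by (auto simp: Cyc_iff[OF L] intro!: restr_id)
qed (use W detect in auto)

text \<open>
  The three components of \<open>Phi x\<close> are cycles. The component of class \<open>Non\<close> is a boundary by
  exactness, the one of class \<open>Pos\<close> by assumption, and \<open>x\<close> differs from \<open>Phi x\<close> by
  multilinearity relations.
\<close>
lemma cycle_mod_boundary:
  assumes L: "chain_ops L ops" and ac: "acyclic L ops n Non" and x: "x \<in> Cyc L ops n"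
    and u: "keys u \<subseteq> G \<inter> Pos \<inter> {l. length l \<in> L (Suc n)}" "dB (ops (Suc n)) u = restr Pos (Phi x)"
  shows "x - restr Triv (Phi x) \<in> Bdr L ops n"
proof -
  have o: "ops_map (ops (Suc n)) (L (Suc n)) (L n)" using L by (simp add: chain_ops_def)
  have k: "keys (Phi x) \<subseteq> G \<inter> {l. length l \<in> L n}"
    using keys_Phi[of x "L n"] x by (simp add: Cyc_iff[OF L])
  have "d_in ops n (restr Non (Phi x)) = 0"
    using restr_d_in[OF L stable_classes(1) k] x by (simp add: Cyc_iff[OF L])
  then obtain w where w: "keys w \<subseteq> G \<inter> Non \<inter> {l. length l \<in> L (Suc n)}"
    "dB (ops (Suc n)) w = restr Non (Phi x)"
    using ac[unfolded acyclic_def, rule_format, of "restr Non (Phi x)"] k by auto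
  have uw: "keys (u + w) \<subseteq> G \<inter> {l. length l \<in> L (Suc n)}"
    using u(1) w(1) by (intro keys_plusI) auto
  define r where "r = (x - Phi x) - (op_of A (ops (Suc n)) (u + w) - dB (ops (Suc n)) (u + w))"
  have "r \<in> tensor_rel A (L n)"
    unfolding r_def
    by (rule pmv.subspace_diff[OF subspace_tensor_rel Phi_congruent op_of_congruent[OF o uw]])
      (use x in \<open>simp add: Cyc_iff[OF L]\<close>)
  moreover have "x - restr Triv (Phi x) = op_of A (ops (Suc n)) (u + w) + r"
    using classes_decompose[of "Phi x"] u(2) w(2) by (simp add: r_def klin_plus[OF klin_dB] algebra_simps)
  moreover have "u + w \<in> free_chains A (L (Suc n))" by (rule G_free_chains[OF uw])
  ultimately show ?thesis by (auto simp: boundaries_def)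
qed

lemma Phi_boundary:
  assumes L: "chain_ops L ops" and x: "x \<in> Bdr L ops n"
  obtains u where "keys u \<subseteq> G \<inter> {l. length l \<in> L (Suc n)}" "dB (ops (Suc n)) u = Phi x"
proof -
  have o: "ops_map (ops (Suc n)) (L (Suc n)) (L n)" using L by (simp add: chain_ops_def)
  obtain z r where z: "x = op_of A (ops (Suc n)) z + r" "z \<in> free_chains A (L (Suc n))" "r \<in> tensor_rel A (L n)"
    using x by (auto simp: boundaries_def)
  then have "Phi x = dB (ops (Suc n)) (Phi z)"
    using Phi_op_of[OF o z(2)] Phi_tensor_rel by (simp add: klin_plus[OF klin_Phi] dB_def)
  then show thesis using that[of "Phi z"] keys_Phi[OF z(2)] by simp
qed

lemma Pos_boundary:
  assumes L: "chain_ops L ops" and u: "keys u \<subseteq> G \<inter> {l. length l \<in> L (Suc n)}"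
  shows "keys (restr Pos u) \<subseteq> G \<inter> Pos \<inter> {l. length l \<in> L (Suc n)}
    \<and> dB (ops (Suc n)) (restr Pos u) = restr Pos (dB (ops (Suc n)) u)"
  using restr_dB[OF stable_classes(3) L[unfolded chain_ops_def, rule_format, of n] u] u by auto

lemma computes_boundaries:
  assumes L: "chain_ops L ops" and ac: "acyclic L ops n Non" "acyclic L ops n Triv"
  shows "computes (Cyc L ops n) (Bdr L ops n) (G \<inter> Pos \<inter> {l. length l \<in> L n}) (G \<inter> Pos \<inter> {l. length l \<in> L (Suc n)})
    (d_in ops n) (dB (ops (Suc n))) (\<lambda>x. restr Pos (Phi x))"
proof (rule computesI[OF L subspace_boundaries])
  fix x assume x: "x \<in> Cyc L ops n"
  have o: "ops_map (ops (Suc n)) (L (Suc n)) (L n)" using L by (simp add: chain_ops_def)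
  have k: "keys (Phi x) \<subseteq> G \<inter> {l. length l \<in> L n}"
    using keys_Phi[of x "L n"] x by (simp add: Cyc_iff[OF L])
  have "d_in ops n (restr Triv (Phi x)) = 0"
    using restr_d_in[OF L stable_classes(2) k] x by (simp add: Cyc_iff[OF L])
  then obtain w where w: "keys w \<subseteq> G \<inter> Triv \<inter> {l. length l \<in> L (Suc n)}"
    "dB (ops (Suc n)) w = restr Triv (Phi x)"
    using ac(2)[unfolded acyclic_def, rule_format, of "restr Triv (Phi x)"] k by auto
  have wG: "keys w \<subseteq> G \<inter> {l. length l \<in> L (Suc n)}" using w by auto
  have triv: "restr Triv (Phi x) \<in> Bdr L ops n"
  proof -
    have "restr Triv (Phi x) = op_of A (ops (Suc n)) w + - (op_of A (ops (Suc n)) w - dB (ops (Suc n)) w)"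
      by (simp add: w(2))
    then show ?thesis
      using G_free_chains[OF wG] pmv.subspace_neg[OF subspace_tensor_rel op_of_congruent[OF o wG]]
      unfolding boundaries_def mem_Collect_eq Suc_eq_plus1[symmetric] by blast
  qed
  show "x \<in> Bdr L ops n \<longleftrightarrow>
      (\<exists>u. keys u \<subseteq> G \<inter> Pos \<inter> {l. length l \<in> L (Suc n)} \<and> dB (ops (Suc n)) u = restr Pos (Phi x))"
  proof
    assume "x \<in> Bdr L ops n"
    then obtain u where "keys u \<subseteq> G \<inter> {l. length l \<in> L (Suc n)}" "dB (ops (Suc n)) u = Phi x"
      using Phi_boundary[OF L] by blast
    then show "\<exists>u. keys u \<subseteq> G \<inter> Pos \<inter> {l. length l \<in> L (Suc n)} \<and> dB (ops (Suc n)) u = restr Pos (Phi x)"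
      using Pos_boundary[OF L, of u] by metis
  next
    assume "\<exists>u. keys u \<subseteq> G \<inter> Pos \<inter> {l. length l \<in> L (Suc n)} \<and> dB (ops (Suc n)) u = restr Pos (Phi x)"
    then have "x - restr Triv (Phi x) \<in> Bdr L ops n" using cycle_mod_boundary[OF L ac(1) x] by blast
    then show "x \<in> Bdr L ops n"
      using pmv.subspace_add[OF subspace_boundaries _ triv, of "x - restr Triv (Phi x)"] by simp
  qed
qed

text \<open>
  Chains of \<open>E\<close> expand into lists of identities, so they are invisible in the component of class
  \<open>Pos\<close>. Conversely, the component of class \<open>Triv\<close> of a cycle is itself a cycle of
  \<open>E\<close>: on lists of equal identities all products are nonzero, so its differential vanishes on the
  nose and not only modulo the relations of \<open>A\<close>.
\<close>
lemma computes_coker: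
  assumes L: "chain_ops L ops" and ac: "acyclic L ops n Non"
  shows "computes (Cyc L ops n)
    {x + y | x y. x \<in> Bdr L ops n \<and> y \<in> cycles (A\<lparr>carrier := E\<rparr>) L (\<lambda>n. op_of A (ops n)) n}
    (G \<inter> Pos \<inter> {l. length l \<in> L n}) (G \<inter> Pos \<inter> {l. length l \<in> L (Suc n)})
    (d_in ops n) (dB (ops (Suc n))) (\<lambda>x. restr Pos (Phi x))"
proof (rule computesI[OF L pmv.subspace_sums[OF subspace_boundaries subspace_cycles]])
  fix x assume x: "x \<in> Cyc L ops n"
  let ?E = "A\<lparr>carrier := E\<rparr>"
  let ?ZE = "cycles ?E L (\<lambda>n. op_of A (ops n)) n"
  have k: "keys (Phi x) \<subseteq> G \<inter> {l. length l \<in> L n}"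
    using keys_Phi[of x "L n"] x by (simp add: Cyc_iff[OF L])
  have posE: "restr Pos (Phi e) = 0" if "e \<in> ?ZE" for e
  proof -
    have "keys e \<subseteq> {l. set l \<subseteq> E}" using that by (auto simp: cycles_def free_chains_def)
    then have "keys (Phi e) \<subseteq> {m. set m \<subseteq> unit ` V0}"
      unfolding Phi_def
    proof (rule keys_lin_ext)
      fix l assume "l \<in> {l. set l \<subseteq> E}"
      then have "keys (expand l) \<subseteq> {m. set m \<subseteq> unit ` V0 \<and> length m = length l}"
        by (intro keys_expand_gen E_co) auto
      then show "keys (expand l) \<subseteq> {m. set m \<subseteq> unit ` V0}" by blast
    qed
    moreover have "{m. set m \<subseteq> unit ` V0} \<inter> Pos = {}"
    proof -
      have "size_of m = 0" if "set m \<subseteq> unit ` V0" for m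
        using that unit_len by (auto simp: size_of_def)
      then show ?thesis by (auto simp: Pos_def)
    qed
    ultimately show ?thesis by (intro restr_empty) blast
  qed
  show "x \<in> {x + y | x y. x \<in> Bdr L ops n \<and> y \<in> ?ZE} \<longleftrightarrow>
      (\<exists>u. keys u \<subseteq> G \<inter> Pos \<inter> {l. length l \<in> L (Suc n)} \<and> dB (ops (Suc n)) u = restr Pos (Phi x))"
  proof
    assume "x \<in> {x + y | x y. x \<in> Bdr L ops n \<and> y \<in> ?ZE}"
    then obtain b e where be: "x = b + e" "b \<in> Bdr L ops n" "e \<in> ?ZE" by auto
    obtain u where "keys u \<subseteq> G \<inter> {l. length l \<in> L (Suc n)}" "dB (ops (Suc n)) u = Phi b"
      using Phi_boundary[OF L be(2)] by blast
    then show "\<exists>u. keys u \<subseteq> G \<inter> Pos \<inter> {l. length l \<in> L (Suc n)} \<and> dB (ops (Suc n)) u = restr Pos (Phi x)"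
      using Pos_boundary[OF L, of u n] posE[OF be(3)] be(1)
      by (intro exI[of _ "restr Pos u"]) (simp add: klin_plus[OF klin_Phi] restr_plus)
  next
    assume "\<exists>u. keys u \<subseteq> G \<inter> Pos \<inter> {l. length l \<in> L (Suc n)} \<and> dB (ops (Suc n)) u = restr Pos (Phi x)"
    then have 1: "x - restr Triv (Phi x) \<in> Bdr L ops n" using cycle_mod_boundary[OF L ac x] by blast
    let ?e = "restr Triv (Phi x)"
    have ek: "keys ?e \<subseteq> G \<inter> Triv \<inter> {l. length l \<in> L n}" using k by auto
    have "?e \<in> free_chains ?E (L n)"
    proof -
      have "set l \<subseteq> E" if l: "l \<in> G" "l \<in> Triv" for l
      proof -
        obtain v m where "v \<in> V0" "l = replicate (Suc m) (unit v)" by (rule Triv_replicate[OF l])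
        then show ?thesis using E_units by auto
      qed
      then show ?thesis using ek by (auto simp: free_chains_def)
    qed
    moreover have "n > 0 \<longrightarrow> op_of A (ops n) ?e \<in> tensor_rel ?E (L (n - 1))"
    proof
      assume "n > 0"
      then obtain m where m: "n = Suc m" by (cases n) auto
      have o: "ops_map (ops n) (L n) (L m)" using L by (simp add: chain_ops_def m)
      have "op_of A (ops n) ?e = dB (ops n) ?e"
        using op_of_Triv[OF o ek] by (simp add: dB_def restr_id)
      also have "\<dots> = d_in ops n ?e" using m by (simp add: d_in_def)
      also have "\<dots> = 0"
        using restr_d_in[OF L stable_classes(2) k] x by (simp add: Cyc_iff[OF L])
      finally show "op_of A (ops n) ?e \<in> tensor_rel ?E (L (n - 1))"
        using pmv.subspace_0[OF subspace_tensor_rel] by simp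
    qed
    ultimately have "?e \<in> ?ZE" by (simp add: cycles_def)
    with 1 show "x \<in> {x + y | x y. x \<in> Bdr L ops n \<and> y \<in> ?ZE}"
      unfolding mem_Collect_eq by (intro exI[of _ "x - ?e"] exI[of _ ?e] conjI) simp_all
  qed
qed

lemma acyclic_hoch:
  "acyclic (\<lambda>n. {n + 1}) (\<lambda>_. hoch_ops) n Non"
  "n \<ge> 1 \<Longrightarrow> acyclic (\<lambda>n. {n + 1}) (\<lambda>_. hoch_ops) n Triv"
  using Non_acyclic_hoch[of _ n] Triv_acyclic_hoch[of _ n]
  by (auto simp: acyclic_def d_in_def)

lemma acyclic_cyc:
  "acyclic (\<lambda>n. {1..n + 1}) cyc_ops n Non"
  "odd n \<Longrightarrow> acyclic (\<lambda>n. {1..n + 1}) cyc_ops n Triv"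
  using Non_acyclic_cyc[of _ 1 n] Triv_acyclic_cyc[of _ n]
  by (auto simp: acyclic_def d_in_def)

end

lemma chain_ops_hoch: "chain_ops (\<lambda>n. {n + 1}) (\<lambda>_. hoch_ops)"
  and chain_ops_cyc: "chain_ops (\<lambda>n. {1..n + 1}) cyc_ops"
  using ops_map_hoch ops_map_cyc by (auto simp: chain_ops_def)

section \<open>Decomposing a complex along a partition of its basis\<close>

definition push :: "('b \<Rightarrow> 'c) \<Rightarrow> ('b \<Rightarrow>\<^sub>0 'k::field) \<Rightarrow> ('c \<Rightarrow>\<^sub>0 'k)" where
  "push \<sigma> = lin_ext (\<lambda>l. single (\<sigma> l) 1)"

text \<open>
  \<open>pull P \<sigma>\<close> inverts \<open>push \<sigma>\<close> on the span of \<open>P\<close> and kills the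
  basis elements outside the image of \<open>P\<close>.
\<close>
definition pull :: "'b set \<Rightarrow> ('b \<Rightarrow> 'c) \<Rightarrow> ('c \<Rightarrow>\<^sub>0 'k::field) \<Rightarrow> ('b \<Rightarrow>\<^sub>0 'k)" where
  "pull P \<sigma> = lin_ext (\<lambda>l. if l \<in> \<sigma> ` P then single (inv_into P \<sigma> l) 1 else 0)"

lemma klin_push [intro!, simp]: "klin (push \<sigma>)" and klin_pull [intro!, simp]: "klin (pull P \<sigma>)"
  by (simp_all add: push_def pull_def)

lemma pull_push:
  assumes "inj_on \<sigma> P" "keys y \<subseteq> P"
  shows "pull P \<sigma> (push \<sigma> y) = y"
  by (rule klin_eqI[where f = "\<lambda>y. pull P \<sigma> (push \<sigma> y)", OF klin_comp[OF klin_pull klin_push] klin_id assms(2)])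
    (auto simp: push_def pull_def assms(1))

lemma pull_push_disjoint:
  assumes "\<sigma> ` P \<inter> \<sigma>' ` P' = {}" "keys y \<subseteq> P'"
  shows "pull P \<sigma> (push \<sigma>' y) = 0"
  by (rule klin_eqI[where f = "\<lambda>y. pull P \<sigma> (push \<sigma>' y)", OF klin_comp[OF klin_pull klin_push] klin_const0 assms(2)])
    (use assms(1) in \<open>auto simp: push_def pull_def\<close>)

lemma keys_push: "keys y \<subseteq> P \<Longrightarrow> keys (push \<sigma> y) \<subseteq> \<sigma> ` P"
  unfolding push_def by (erule keys_lin_ext) auto

lemma keys_pull: "keys x \<subseteq> C \<Longrightarrow> keys (pull P \<sigma> x) \<subseteq> {l \<in> P. \<sigma> l \<in> C}"
  unfolding pull_def by (erule keys_lin_ext) (auto simp: inv_into_into f_inv_into_f)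

lemma push_pull_decompose:
  fixes x :: "'b \<Rightarrow>\<^sub>0 'k::field"
  assumes dis: "\<And>c c'. c \<in> T \<Longrightarrow> c' \<in> T \<Longrightarrow> c \<noteq> c' \<Longrightarrow> \<sigma> c ` P c \<inter> \<sigma> c' ` P c' = {}"
    and x: "keys x \<subseteq> (\<Union>c\<in>T. \<sigma> c ` P c)"
  shows "\<exists>S. finite S \<and> S \<subseteq> T \<and> (\<forall>c\<in>T - S. pull (P c) (\<sigma> c) x = 0)
    \<and> x = (\<Sum>c\<in>S. push (\<sigma> c) (pull (P c) (\<sigma> c) x))"
proof -
  have "\<forall>l\<in>keys x. \<exists>c. c \<in> T \<and> l \<in> \<sigma> c ` P c" using x by blast
  then obtain k where k: "\<And>l. l \<in> keys x \<Longrightarrow> k l \<in> T \<and> l \<in> \<sigma> (k l) ` P (k l)" by metis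
  define S where "S = k ` keys x"
  have S: "finite S" "S \<subseteq> T" using k by (auto simp: S_def)
  have only: "l \<notin> \<sigma> c ` P c" if "l \<in> keys x" "c \<in> T" "c \<noteq> k l" for l c
    using dis[of c "k l"] k[OF that(1)] that by blast
  have zero: "pull (P c) (\<sigma> c) x = 0" if "c \<in> T - S" for c
    by (rule klin_eqI[OF klin_pull klin_const0 subset_refl])
      (use only that in \<open>auto simp: pull_def S_def\<close>)
  have "x = (\<Sum>c\<in>S. push (\<sigma> c) (pull (P c) (\<sigma> c) x))"
  proof (rule klin_eqI[where g = "\<lambda>x. \<Sum>c\<in>S. push (\<sigma> c) (pull (P c) (\<sigma> c) x)", OF klin_id _ subset_refl])
    show "klin (\<lambda>x. \<Sum>c\<in>S. push (\<sigma> c) (pull (P c) (\<sigma> c) x))"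
      unfolding klin_def
      by (simp add: klin_plus[OF klin_pull] klin_plus[OF klin_push] klin_scale[OF klin_pull]
          klin_scale[OF klin_push] sum.distrib pmv.scale_sum_right)
    fix l assume l: "l \<in> keys x"
    have eq: "push (\<sigma> c) (pull (P c) (\<sigma> c) (single l 1))
        = (if c = k l then single l (1::'k) else 0)" if "c \<in> S" for c
      using only[OF l, of c] k[OF l] S that by (auto simp: push_def pull_def f_inv_into_f)
    have "(\<Sum>c\<in>S. push (\<sigma> c) (pull (P c) (\<sigma> c) (single l 1)))
        = (\<Sum>c\<in>S. if c = k l then single l (1::'k) else 0)"
      by (rule sum.cong[OF refl eq])
    also have "\<dots> = single l 1" using l S(1) by (simp add: S_def)
    finally show "single l (1::'k) = (\<Sum>c\<in>S. push (\<sigma> c) (pull (P c) (\<sigma> c) (single l 1)))"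
      by (rule sym)
  qed
  then show ?thesis using S zero by blast
qed

text \<open>
  Every \<open>x\<close> is a finite sum of vectors pushed forward from the parts, and \<open>d\<close> respects this
  decomposition.
\<close>
lemma pull_commute:
  assumes dis: "\<And>c c'. c \<in> T \<Longrightarrow> c' \<in> T \<Longrightarrow> c \<noteq> c' \<Longrightarrow> \<sigma> c ` P c \<inter> \<sigma> c' ` P c' = {}"
    and inj: "\<And>c. c \<in> T \<Longrightarrow> inj_on (\<sigma> c) (P c)"
    and x: "keys x \<subseteq> (\<Union>c\<in>T. \<sigma> c ` P c) \<inter> C"
    and d: "klin d" and d': "klin (d' c)" and c: "c \<in> T"
    and dk: "\<And>c y. c \<in> T \<Longrightarrow> keys y \<subseteq> {l \<in> P c. \<sigma> c l \<in> C} \<Longrightarrow> keys (d' c y) \<subseteq> P c"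
    and dp: "\<And>c y. c \<in> T \<Longrightarrow> keys y \<subseteq> {l \<in> P c. \<sigma> c l \<in> C} \<Longrightarrow> d (push (\<sigma> c) y) = push (\<sigma> c) (d' c y)"
  shows "pull (P c) (\<sigma> c) (d x) = d' c (pull (P c) (\<sigma> c) x)"
proof -
  obtain S where S: "finite S" "S \<subseteq> T" "\<forall>c\<in>T - S. pull (P c) (\<sigma> c) x = 0"
    "x = (\<Sum>c\<in>S. push (\<sigma> c) (pull (P c) (\<sigma> c) x))"
  proof -
    have "keys x \<subseteq> (\<Union>c\<in>T. \<sigma> c ` P c)" using x by blast
    from push_pull_decompose[OF dis this] show thesis using that by blast
  qed
  let ?p = "\<lambda>c. pull (P c) (\<sigma> c) x"
  have pk: "keys (?p c) \<subseteq> {l \<in> P c. \<sigma> c l \<in> C}" for c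
    by (rule keys_pull) (use x in blast)
  have "d x = d (\<Sum>c\<in>S. push (\<sigma> c) (?p c))" by (rule arg_cong[OF S(4)])
  also have "\<dots> = (\<Sum>c\<in>S. push (\<sigma> c) (d' c (?p c)))"
    using dp[OF _ pk] S(2) by (auto simp: klin_sum[OF d] intro!: sum.cong)
  finally have "pull (P c) (\<sigma> c) (d x) = (\<Sum>c'\<in>S. pull (P c) (\<sigma> c) (push (\<sigma> c') (d' c' (?p c'))))"
    by (simp add: klin_sum[OF klin_pull])
  also have "\<dots> = (\<Sum>c'\<in>S. if c' = c then d' c (?p c) else 0)"
  proof (rule sum.cong[OF refl])
    fix c' assume "c' \<in> S"
    then have c': "c' \<in> T" using S(2) by auto
    show "pull (P c) (\<sigma> c) (push (\<sigma> c') (d' c' (?p c'))) = (if c' = c then d' c (?p c) else 0)"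
      using pull_push[OF inj[OF c] dk[OF c pk]] pull_push_disjoint[OF dis[OF c c'] dk[OF c' pk]] by auto
  qed
  also have "\<dots> = d' c (?p c)" using S c by (auto simp: klin_zero[OF d'])
  finally show ?thesis .
qed

text \<open>
  If the basis of a complex is partitioned into images of bases of other complexes, compatibly with the
  differentials, then its homology is the direct sum of the homologies of the parts.
\<close>
lemma computes_iso:
  fixes \<sigma> :: "'i \<Rightarrow> 'b \<Rightarrow> 'c"
  assumes comp: "computes V W C C1 d0 d1 \<pi>"
    and comp': "\<And>c. c \<in> T \<Longrightarrow> computes (V' c) (W' c) (C' c) (C1' c) (d0' c) (d1' c) (\<pi>' c)"
    and lin: "klin d0" "klin d1" "\<And>c. c \<in> T \<Longrightarrow> klin (d0' c)" "\<And>c. c \<in> T \<Longrightarrow> klin (d1' c)"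
    and dis: "\<And>c c'. c \<in> T \<Longrightarrow> c' \<in> T \<Longrightarrow> c \<noteq> c' \<Longrightarrow> \<sigma> c ` P c \<inter> \<sigma> c' ` P c' = {}"
    and inj: "\<And>c. c \<in> T \<Longrightarrow> inj_on (\<sigma> c) (P c)"
    and C: "C \<subseteq> (\<Union>c\<in>T. \<sigma> c ` P c)" "C1 \<subseteq> (\<Union>c\<in>T. \<sigma> c ` P c)"
    and C': "\<And>c. c \<in> T \<Longrightarrow> C' c = {l \<in> P c. \<sigma> c l \<in> C}" "\<And>c. c \<in> T \<Longrightarrow> C1' c = {l \<in> P c. \<sigma> c l \<in> C1}"
    and dk0: "\<And>c y. c \<in> T \<Longrightarrow> keys y \<subseteq> C' c \<Longrightarrow> keys (d0' c y) \<subseteq> P c"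
    and dk1: "\<And>c y. c \<in> T \<Longrightarrow> keys y \<subseteq> C1' c \<Longrightarrow> keys (d1' c y) \<subseteq> P c"
    and dp0: "\<And>c y. c \<in> T \<Longrightarrow> keys y \<subseteq> C' c \<Longrightarrow> d0 (push (\<sigma> c) y) = push (\<sigma> c) (d0' c y)"
    and dp1: "\<And>c y. c \<in> T \<Longrightarrow> keys y \<subseteq> C1' c \<Longrightarrow> d1 (push (\<sigma> c) y) = push (\<sigma> c) (d1' c y)"
  shows "quot_module (pm_space V) W \<cong>\<^sub>k direct_sum T (\<lambda>c. quot_module (pm_space (V' c)) (W' c))"
proof -
  let ?pull = "\<lambda>c. pull (P c) (\<sigma> c)" and ?push = "\<lambda>c. push (\<sigma> c)"
  have pc0: "?pull c (d0 x) = d0' c (?pull c x)" if "c \<in> T" "keys x \<subseteq> C" for c x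
  proof (rule pull_commute[where T = T and C = C])
    show "keys x \<subseteq> (\<Union>c\<in>T. \<sigma> c ` P c) \<inter> C" using that(2) C(1) by blast
    show "keys (d0' c y) \<subseteq> P c" "d0 (push (\<sigma> c) y) = push (\<sigma> c) (d0' c y)"
      if "c \<in> T" "keys y \<subseteq> {l \<in> P c. \<sigma> c l \<in> C}" for c y
      using dk0[OF that(1), of y] dp0[OF that(1), of y] that(2) C'(1)[OF that(1)] by simp_all
  qed (fact dis inj lin(1,2) lin(3,4)[OF that(1)] that(1))+
  have pc1: "?pull c (d1 x) = d1' c (?pull c x)" if "c \<in> T" "keys x \<subseteq> C1" for c x
  proof (rule pull_commute[where T = T and C = C1])
    show "keys x \<subseteq> (\<Union>c\<in>T. \<sigma> c ` P c) \<inter> C1" using that(2) C(2) by blast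
    show "keys (d1' c y) \<subseteq> P c" "d1 (push (\<sigma> c) y) = push (\<sigma> c) (d1' c y)"
      if "c \<in> T" "keys y \<subseteq> {l \<in> P c. \<sigma> c l \<in> C1}" for c y
      using dk1[OF that(1), of y] dp1[OF that(1), of y] that(2) C'(2)[OF that(1)] by simp_all
  qed (fact dis inj lin(1,2) lin(3,4)[OF that(1)] that(1))+
  note A = comp[unfolded computes_def] and Z = comp'[unfolded computes_def]
  have pullC: "keys (?pull c x) \<subseteq> C' c" if "c \<in> T" "keys x \<subseteq> C" for c x
    unfolding C'(1)[OF that(1)] by (rule keys_pull[OF that(2)])
  have pullC1: "keys (?pull c x) \<subseteq> C1' c" if "c \<in> T" "keys x \<subseteq> C1" for c x
    unfolding C'(2)[OF that(1)] by (rule keys_pull[OF that(2)])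
  have pushC: "keys (?push c y) \<subseteq> C" if "c \<in> T" "keys y \<subseteq> C' c" for c y
    using keys_push[OF that(2), of "\<sigma> c"] C'(1)[OF that(1)] by auto
  have pushC1: "keys (?push c y) \<subseteq> C1" if "c \<in> T" "keys y \<subseteq> C1' c" for c y
    using keys_push[OF that(2), of "\<sigma> c"] C'(2)[OF that(1)] by auto
  have fV: "?pull c (\<pi> x) \<in> V' c \<and> \<pi>' c (?pull c (\<pi> x)) = ?pull c (\<pi> x)" if c: "c \<in> T" and x: "x \<in> V" for c x
  proof -
    have "keys (\<pi> x) \<subseteq> C" "d0 (\<pi> x) = 0" using A x by auto
    then have "keys (?pull c (\<pi> x)) \<subseteq> C' c" "d0' c (?pull c (\<pi> x)) = 0"
      using pullC[OF c] pc0[OF c, of "\<pi> x"] by (auto simp: klin_zero[OF klin_pull])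
    then show ?thesis using Z[OF c] by blast
  qed
  have gV: "?push c (\<pi>' c y) \<in> V \<and> \<pi> (?push c (\<pi>' c y)) = ?push c (\<pi>' c y)" if c: "c \<in> T" and y: "y \<in> V' c" for c y
  proof -
    have "keys (\<pi>' c y) \<subseteq> C' c" "d0' c (\<pi>' c y) = 0" using Z[OF c] y by auto
    then have "keys (?push c (\<pi>' c y)) \<subseteq> C" "d0 (?push c (\<pi>' c y)) = 0"
      using pushC[OF c] dp0[OF c, of "\<pi>' c y"] by (auto simp: klin_zero[OF klin_push])
    then show ?thesis using A by blast
  qed
  have Pk: "keys (\<pi>' c y) \<subseteq> P c" if "c \<in> T" "y \<in> V' c" for c y
    using Z[OF that(1)] that(2) C'(1)[OF that(1)] by blast
  have dec: "\<exists>S. finite S \<and> S \<subseteq> T \<and> (\<forall>c\<in>T - S. ?pull c (\<pi> x) = 0) \<and> \<pi> x = (\<Sum>c\<in>S. ?push c (?pull c (\<pi> x)))"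
    if "x \<in> V" for x
  proof (rule push_pull_decompose[OF dis])
    have "keys (\<pi> x) \<subseteq> C" using A that by blast
    then show "keys (\<pi> x) \<subseteq> (\<Union>c\<in>T. \<sigma> c ` P c)" using C(1) by (rule subset_trans)
  qed
  show ?thesis
  proof (rule quotient_iso_direct_sum[where f = "\<lambda>c x. ?pull c (\<pi> x)" and g = "\<lambda>c y. ?push c (\<pi>' c y)"])
    show "pmv.subspace V" "pmv.subspace W" using A by auto
    show "pmv.subspace (V' c)" "pmv.subspace (W' c)" if "c \<in> T" for c using Z[OF that] by auto
    show "klin (\<lambda>x. ?pull c (\<pi> x))" for c by (rule klin_comp) (use A in auto)
    show "?pull c (\<pi> x) \<in> V' c" if "c \<in> T" "x \<in> V" for c x using fV that by blast
    show "finite {c \<in> T. ?pull c (\<pi> x) \<notin> W' c}" if x: "x \<in> V" for x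
    proof -
      obtain S where S: "finite S" "\<forall>c\<in>T - S. ?pull c (\<pi> x) = 0" using dec[OF x] by blast
      have "{c \<in> T. ?pull c (\<pi> x) \<notin> W' c} \<subseteq> S"
      proof
        fix c assume c: "c \<in> {c \<in> T. ?pull c (\<pi> x) \<notin> W' c}"
        then have "0 \<in> W' c" using Z[of c] pmv.subspace_0 by auto
        then show "c \<in> S" using c S(2) by (cases "c \<in> S") auto
      qed
      then show ?thesis using S(1) finite_subset by blast
    qed
    show "(\<forall>c\<in>T. ?pull c (\<pi> x) \<in> W' c) \<longleftrightarrow> x \<in> W" if x: "x \<in> V" for x
    proof
      assume all: "\<forall>c\<in>T. ?pull c (\<pi> x) \<in> W' c"
      have "\<forall>c\<in>T. \<exists>u. keys u \<subseteq> C1' c \<and> d1' c u = ?pull c (\<pi> x)"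
      proof
        fix c assume c: "c \<in> T"
        then show "\<exists>u. keys u \<subseteq> C1' c \<and> d1' c u = ?pull c (\<pi> x)"
          using Z[OF c] all fV[OF c x] by metis
      qed
      then obtain u where u: "\<And>c. c \<in> T \<Longrightarrow> keys (u c) \<subseteq> C1' c \<and> d1' c (u c) = ?pull c (\<pi> x)"
        by metis
      obtain S where S: "finite S" "S \<subseteq> T" "\<pi> x = (\<Sum>c\<in>S. ?push c (?pull c (\<pi> x)))"
        using dec[OF x] by blast
      have "keys (\<Sum>c\<in>S. ?push c (u c)) \<subseteq> C1"
        using pmv.subspace_sum[OF subspace_keys[of C1], of S "\<lambda>c. ?push c (u c)"] pushC1 u S(2) by blast
      moreover have "d1 (\<Sum>c\<in>S. ?push c (u c)) = (\<Sum>c\<in>S. ?push c (?pull c (\<pi> x)))"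
        unfolding klin_sum[OF lin(2)] using u dp1 S(2) by (intro sum.cong) auto
      ultimately show "x \<in> W" using A x S(3) by metis
    next
      assume "x \<in> W"
      then obtain u where u: "keys u \<subseteq> C1" "d1 u = \<pi> x" using A x by blast
      show "\<forall>c\<in>T. ?pull c (\<pi> x) \<in> W' c"
      proof
        fix c assume c: "c \<in> T"
        have "keys (?pull c u) \<subseteq> C1' c \<and> d1' c (?pull c u) = \<pi>' c (?pull c (\<pi> x))"
          using pullC1[OF c u(1)] pc1[OF c u(1)] u(2) fV[OF c x] by simp
        then show "?pull c (\<pi> x) \<in> W' c" using Z[OF c] fV[OF c x] by blast
      qed
    qed
    show "?push c (\<pi>' c y) \<in> V" if "c \<in> T" "y \<in> V' c" for c y using gV that by blast
    show "?pull c (\<pi> (?push c (\<pi>' c y))) - y \<in> W' c" if c: "c \<in> T" and y: "y \<in> V' c" for c y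
    proof -
      have 1: "?pull c (\<pi> (?push c (\<pi>' c y))) = \<pi>' c y"
        using gV[OF c y] pull_push[OF inj[OF c] Pk[OF c y]] by simp
      have "\<pi>' c y \<in> V' c \<and> \<pi>' c (\<pi>' c y) = \<pi>' c y" using Z[OF c] y by blast
      moreover have "\<pi>' c y - y \<in> V' c" using Z[OF c] y calculation pmv.subspace_diff by blast
      moreover have "\<pi>' c (\<pi>' c y - y) = 0" using calculation Z[OF c] by (simp add: klin_minus)
      moreover have "d1' c 0 = 0" using klin_zero[OF lin(4)[OF c]] by simp
      ultimately show ?thesis unfolding 1 using Z[OF c]
        by (metis (no_types, lifting) empty_subsetI keys_zero)
    qed
    show "?pull c' (\<pi> (?push c (\<pi>' c y))) \<in> W' c'" if "c \<in> T" "c' \<in> T" "c' \<noteq> c" "y \<in> V' c" for c c' y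
    proof -
      have "?pull c' (\<pi> (?push c (\<pi>' c y))) = 0"
        using gV[OF that(1,4)] pull_push_disjoint[OF dis[OF that(2,1,3)] Pk[OF that(1,4)]] by simp
      then show ?thesis using Z[OF that(2)] pmv.subspace_0 by auto
    qed
  qed
qed

section \<open>Monomial algebras have a graded basis\<close>

definition path_end :: "('v, 'e) pre_digraph \<Rightarrow> ('v, 'e) path \<Rightarrow> 'v" where
  "path_end Q w = last (pre_digraph.awalk_verts Q (fst w) (snd w))"

definition path_cat :: "('v, 'e) path \<Rightarrow> ('v, 'e) path \<Rightarrow> ('v, 'e) path" where
  "path_cat w w' = (fst w, snd w @ snd w')"

lemma path_cat_assoc: "path_cat (path_cat u v) w = path_cat u (path_cat v w)"
  by (simp add: path_cat_def)

lemma fst_path_cat [simp]: "fst (path_cat u v) = fst u"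
  and snd_path_cat [simp]: "snd (path_cat u v) = snd u @ snd v"
  by (simp_all add: path_cat_def)

text \<open>
  The sets of paths that span an ideal.
\<close>
definition path_closed :: "('v, 'e) pre_digraph \<Rightarrow> ('v, 'e) path set \<Rightarrow> bool" where
  "path_closed Q N \<longleftrightarrow> N \<subseteq> quiver_paths Q
     \<and> (\<forall>w\<in>N. \<forall>u\<in>quiver_paths Q. path_end Q u = fst w \<longrightarrow> path_cat u w \<in> N)
     \<and> (\<forall>w\<in>N. \<forall>u\<in>quiver_paths Q. path_end Q w = fst u \<longrightarrow> path_cat w u \<in> N)"

context fin_digraph
begin

lemma path_end_trivial [simp]: "path_end G (v, []) = v"
  by (simp add: path_end_def)

lemma awalk_path_end: "w \<in> quiver_paths G \<Longrightarrow> awalk (fst w) (snd w) v \<longleftrightarrow> path_end G w = v"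
  unfolding quiver_paths_def path_end_def by auto

lemma quiver_paths_iff: "w \<in> quiver_paths G \<longleftrightarrow> awalk (fst w) (snd w) (path_end G w)"
  unfolding quiver_paths_def path_end_def by auto

lemma path_cat_path: "u \<in> quiver_paths G \<Longrightarrow> v \<in> quiver_paths G \<Longrightarrow> path_end G u = fst v \<Longrightarrow>
    path_cat u v \<in> quiver_paths G"
  and path_end_cat: "path_end G u = fst v \<Longrightarrow> path_end G (path_cat u v) = path_end G v"
proof -
  show "path_cat u v \<in> quiver_paths G" if "u \<in> quiver_paths G" "v \<in> quiver_paths G" "path_end G u = fst v"
    using awalk_appendI[of "fst u" "snd u" "fst v" "snd v" "path_end G v"] that
    by (auto simp: quiver_paths_iff[of u] quiver_paths_iff[of v]) (auto simp: quiver_paths_def path_cat_def)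
  show "path_end G (path_cat u v) = path_end G v" if "path_end G u = fst v"
    using that by (simp add: path_end_def awlast_append)
qed

lemma trivial_path: "(v, []) \<in> quiver_paths G \<longleftrightarrow> v \<in> verts G"
  by (auto simp: quiver_paths_def awalk_Nil_iff)

lemma path_start: "w \<in> quiver_paths G \<Longrightarrow> fst w \<in> verts G"
  and path_end_verts: "w \<in> quiver_paths G \<Longrightarrow> path_end G w \<in> verts G"
  by (auto simp: quiver_paths_iff)

lemma path_mult_eq: "w \<in> quiver_paths G \<Longrightarrow>
    path_mult G w w' = (if path_end G w = fst w' then single (path_cat w w') 1 else 0)"
  by (simp add: path_mult_def awalk_path_end path_cat_def)

abbreviation PA :: "('k::field, ('a, 'b) path \<Rightarrow>\<^sub>0 'k) module" where
  "PA \<equiv> path_algebra G"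

lemma PA_simps:
  "carrier PA = {x. keys x \<subseteq> quiver_paths G}"
  "x \<otimes>\<^bsub>PA\<^esub> y = lin_ext (\<lambda>w. lin_ext (path_mult G w) y) x"
  "\<one>\<^bsub>PA\<^esub> = (\<Sum>v\<in>verts G. single (v, []) 1)"
  "\<zero>\<^bsub>PA\<^esub> = 0" "x \<oplus>\<^bsub>PA\<^esub> y = x + y" "add PA = (+)" "smult PA = pm_scale"
  by (simp_all add: path_algebra_def)

lemma klin_PA_mult_l: "klin (\<lambda>x. x \<otimes>\<^bsub>PA\<^esub> y)"
  by (simp add: PA_simps)

lemma klin_PA_mult_r: "klin (\<lambda>y. x \<otimes>\<^bsub>PA\<^esub> y)"
  by (simp add: PA_simps klin_def lin_ext_plus lin_ext_scale lin_ext_add_fun lin_ext_scale_fun)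

lemma PA_mult_single:
  "w \<in> quiver_paths G \<Longrightarrow> single w 1 \<otimes>\<^bsub>PA\<^esub> single w' 1
    = (if path_end G w = fst w' then single (path_cat w w') 1 else 0)"
  by (simp add: PA_simps path_mult_eq)

lemma PA_mult_keys:
  assumes "keys x \<subseteq> S" "keys y \<subseteq> S'" "S \<subseteq> quiver_paths G"
    and "\<And>w w'. w \<in> S \<Longrightarrow> w' \<in> S' \<Longrightarrow> path_end G w = fst w' \<Longrightarrow> path_cat w w' \<in> S''"
  shows "keys (x \<otimes>\<^bsub>PA\<^esub> y) \<subseteq> S''"
  unfolding PA_simps
proof (intro keys_lin_ext[OF assms(1)] keys_lin_ext[OF assms(2)])
  fix w w' assume w: "w \<in> S" "w' \<in> S'"
  then have "w \<in> quiver_paths G" using assms(3) by blast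
  then show "keys (path_mult G w w') \<subseteq> S''"
    using assms(4)[OF w] by (simp add: path_mult_eq)
qed

lemma PA_mult_closed:
  "x \<in> carrier PA \<Longrightarrow> y \<in> carrier PA \<Longrightarrow> x \<otimes>\<^bsub>PA\<^esub> y \<in> carrier PA"
  using PA_mult_keys[of x "quiver_paths G" y "quiver_paths G" "quiver_paths G"] path_cat_path
  by (simp add: PA_simps(1))

lemma PA_add_closed: "x \<in> carrier PA \<Longrightarrow> y \<in> carrier PA \<Longrightarrow> x + y \<in> carrier PA"
  by (simp add: PA_simps(1) keys_plusI)

lemma PA_scale_closed: "x \<in> carrier PA \<Longrightarrow> pm_scale c x \<in> carrier PA"
  using pmv.subspace_scale[OF subspace_keys, of x "quiver_paths G" c] by (simp add: PA_simps(1))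

text \<open>
  By linearity in one variable after the other, it suffices to consider paths.
\<close>
lemma PA_assoc:
  fixes x y z :: "('a, 'b) path \<Rightarrow>\<^sub>0 'k::field"
  assumes "x \<in> carrier PA" "y \<in> carrier PA" "z \<in> carrier PA"
  shows "(x \<otimes>\<^bsub>PA\<^esub> y) \<otimes>\<^bsub>PA\<^esub> z = x \<otimes>\<^bsub>PA\<^esub> (y \<otimes>\<^bsub>PA\<^esub> z)"
proof -
  let ?s = "\<lambda>w. single w (1::'k)"
  note k = assms[unfolded PA_simps(1) mem_Collect_eq]
  have 1: "(?s u \<otimes>\<^bsub>PA\<^esub> ?s v) \<otimes>\<^bsub>PA\<^esub> ?s w = ?s u \<otimes>\<^bsub>PA\<^esub> (?s v \<otimes>\<^bsub>PA\<^esub> ?s w)"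
    if "u \<in> quiver_paths G" "v \<in> quiver_paths G" "w \<in> quiver_paths G" for u v w
    using that path_cat_path[of u v] path_end_cat[of u v]
    by (auto simp: PA_mult_single path_cat_assoc klin_zero[OF klin_PA_mult_l] klin_zero[OF klin_PA_mult_r])
  have 2: "(?s u \<otimes>\<^bsub>PA\<^esub> ?s v) \<otimes>\<^bsub>PA\<^esub> z = ?s u \<otimes>\<^bsub>PA\<^esub> (?s v \<otimes>\<^bsub>PA\<^esub> z)"
    if "u \<in> quiver_paths G" "v \<in> quiver_paths G" for u v
    by (rule klin_eqI[OF klin_PA_mult_r klin_comp[OF klin_PA_mult_r klin_PA_mult_r] k(3)]) (rule 1[OF that])
  have 3: "(?s u \<otimes>\<^bsub>PA\<^esub> y) \<otimes>\<^bsub>PA\<^esub> z = ?s u \<otimes>\<^bsub>PA\<^esub> (y \<otimes>\<^bsub>PA\<^esub> z)"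
    if "u \<in> quiver_paths G" for u
    by (rule klin_eqI[OF klin_comp[OF klin_PA_mult_l klin_PA_mult_r] klin_comp[OF klin_PA_mult_r klin_PA_mult_l] k(2)])
      (rule 2[OF that])
  show ?thesis
    by (rule klin_eqI[OF klin_comp[OF klin_PA_mult_l klin_PA_mult_l] klin_PA_mult_l k(1)]) (rule 3)
qed

lemma PA_one:
  fixes x :: "('a, 'b) path \<Rightarrow>\<^sub>0 'k::field"
  assumes "x \<in> carrier PA"
  shows "\<one>\<^bsub>PA\<^esub> \<otimes>\<^bsub>PA\<^esub> x = x" "x \<otimes>\<^bsub>PA\<^esub> \<one>\<^bsub>PA\<^esub> = x"
proof -
  let ?s = "\<lambda>w. single w (1::'k)"
  note k = assms[unfolded PA_simps(1) mem_Collect_eq]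
  show "\<one>\<^bsub>PA\<^esub> \<otimes>\<^bsub>PA\<^esub> x = x"
  proof (rule klin_eqI[OF klin_PA_mult_r klin_id k])
    fix w assume w: "w \<in> quiver_paths G"
    have "\<one>\<^bsub>PA\<^esub> \<otimes>\<^bsub>PA\<^esub> ?s w = (\<Sum>v\<in>verts G. ?s (v, []) \<otimes>\<^bsub>PA\<^esub> ?s w)"
      unfolding PA_simps(3) by (rule klin_sum[OF klin_PA_mult_l])
    also have "\<dots> = (\<Sum>v\<in>verts G. if v = fst w then ?s w else 0)"
      by (rule sum.cong) (auto simp: PA_mult_single trivial_path path_cat_def)
    finally show "\<one>\<^bsub>PA\<^esub> \<otimes>\<^bsub>PA\<^esub> ?s w = ?s w" using path_start[OF w] by simp
  qed
  show "x \<otimes>\<^bsub>PA\<^esub> \<one>\<^bsub>PA\<^esub> = x"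
  proof (rule klin_eqI[OF klin_PA_mult_l klin_id k])
    fix w assume w: "w \<in> quiver_paths G"
    have "?s w \<otimes>\<^bsub>PA\<^esub> \<one>\<^bsub>PA\<^esub> = (\<Sum>v\<in>verts G. ?s w \<otimes>\<^bsub>PA\<^esub> ?s (v, []))"
      unfolding PA_simps(3) by (rule klin_sum[OF klin_PA_mult_r])
    also have "\<dots> = (\<Sum>v\<in>verts G. if v = path_end G w then ?s w else 0)"
      by (rule sum.cong) (auto simp: PA_mult_single w path_cat_def)
    finally show "?s w \<otimes>\<^bsub>PA\<^esub> \<one>\<^bsub>PA\<^esub> = ?s w" using path_end_verts[OF w] by simp
  qed
qed

lemma ring_PA: "ring (PA :: ('k::field, ('a, 'b) path \<Rightarrow>\<^sub>0 'k) module)"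
proof (rule ringI)
  let ?R = "PA :: ('k, ('a, 'b) path \<Rightarrow>\<^sub>0 'k) module"
  show "abelian_group ?R"
  proof (rule abelian_groupI)
    show "\<exists>y\<in>carrier ?R. y \<oplus>\<^bsub>?R\<^esub> x = \<zero>\<^bsub>?R\<^esub>" if "x \<in> carrier ?R" for x
      using that by (intro bexI[of _ "- x"]) (auto simp: PA_simps)
    show "x \<oplus>\<^bsub>?R\<^esub> y \<in> carrier ?R" if "x \<in> carrier ?R" "y \<in> carrier ?R" for x y
      using that keys_plusI[of x "quiver_paths G" y] by (simp add: PA_simps)
  qed (auto simp: PA_simps add.assoc add.commute)
  show "Group.monoid ?R"
  proof (rule Group.monoidI)
    show "\<one>\<^bsub>?R\<^esub> \<in> carrier ?R"
    proof -
      have "(\<Sum>v\<in>verts G. single (v, []) (1::'k)) \<in> {x. keys x \<subseteq> quiver_paths G}"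
        by (rule pmv.subspace_sum[OF subspace_keys]) (simp add: trivial_path)
      then show ?thesis by (simp add: PA_simps)
    qed
  qed (simp_all add: PA_mult_closed PA_assoc PA_one)
qed (auto simp: PA_simps(5) klin_plus[OF klin_PA_mult_l] klin_plus[OF klin_PA_mult_r])

lemma span_ideal:
  assumes "path_closed G N"
  shows "ideal {x. keys x \<subseteq> N} (PA :: ('k::field, ('a, 'b) path \<Rightarrow>\<^sub>0 'k) module)"
proof (rule idealI[OF ring_PA])
  let ?R = "PA :: ('k, ('a, 'b) path \<Rightarrow>\<^sub>0 'k) module"
  let ?I = "{x :: ('a, 'b) path \<Rightarrow>\<^sub>0 'k. keys x \<subseteq> N}"
  have N: "N \<subseteq> quiver_paths G" using assms by (simp add: path_closed_def)
  interpret R: ring ?R by (rule ring_PA)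
  show "subgroup ?I (add_monoid ?R)"
  proof (rule R.add.subgroupI)
    show "?I \<subseteq> carrier ?R" using N by (auto simp: PA_simps)
    show "?I \<noteq> {}" by (auto intro!: exI[of _ 0])
    fix a assume a: "a \<in> ?I"
    then have aR: "a \<in> carrier ?R" using N by (auto simp: PA_simps)
    have "- a \<oplus>\<^bsub>?R\<^esub> a = \<zero>\<^bsub>?R\<^esub>" "- a \<in> carrier ?R" using aR by (auto simp: PA_simps)
    then have "\<ominus>\<^bsub>?R\<^esub> a = - a" using R.minus_equality aR by blast
    then show "\<ominus>\<^bsub>?R\<^esub> a \<in> ?I" using a by simp
    fix b assume "b \<in> ?I"
    then show "a \<oplus>\<^bsub>?R\<^esub> b \<in> ?I" using a keys_plusI[of a N b] by (simp add: PA_simps)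
  qed
  fix a x assume "a \<in> ?I" "x \<in> carrier ?R"
  then have a: "keys a \<subseteq> N" and x: "keys x \<subseteq> quiver_paths G"
    by (auto simp: PA_simps(1))
  show "x \<otimes>\<^bsub>?R\<^esub> a \<in> ?I" "a \<otimes>\<^bsub>?R\<^esub> x \<in> ?I"
    using PA_mult_keys[OF x a subset_refl, of N] PA_mult_keys[OF a x N, of N] assms
    by (auto simp: path_closed_def)
qed

definition path_closure :: "('a, 'b) path set \<Rightarrow> ('a, 'b) path set" where
  "path_closure S = {path_cat (path_cat u s) v | u s v. s \<in> S \<and> u \<in> quiver_paths G \<and> v \<in> quiver_paths G
     \<and> path_end G u = fst s \<and> path_end G s = fst v}"

lemma path_closed_closure:
  assumes "S \<subseteq> quiver_paths G"
  shows "path_closed G (path_closure S)"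
  unfolding path_closed_def
proof (intro conjI ballI impI)
  have P: "path_cat (path_cat u s) v \<in> quiver_paths G \<and> path_end G (path_cat (path_cat u s) v) = path_end G v"
    if "s \<in> S" "u \<in> quiver_paths G" "v \<in> quiver_paths G" "path_end G u = fst s" "path_end G s = fst v" for u s v
  proof -
    have "s \<in> quiver_paths G" using that(1) assms by blast
    then have "path_cat u s \<in> quiver_paths G" "path_end G (path_cat u s) = fst v"
      using that path_cat_path[of u s] path_end_cat[of u s] by simp_all
    then show ?thesis using that path_cat_path[of "path_cat u s" v] path_end_cat[of "path_cat u s" v] by simp
  qed
  show "path_closure S \<subseteq> quiver_paths G" using P by (auto simp: path_closure_def)
  fix w t assume w: "w \<in> path_closure S" and t: "t \<in> quiver_paths G"
  then obtain u s v where usv: "w = path_cat (path_cat u s) v" "s \<in> S" "u \<in> quiver_paths G" "v \<in> quiver_paths G"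
    "path_end G u = fst s" "path_end G s = fst v" by (auto simp: path_closure_def)
  show "path_cat t w \<in> path_closure S" if "path_end G t = fst w"
  proof -
    have "path_cat t u \<in> quiver_paths G" "path_end G (path_cat t u) = fst s"
      using that usv t path_cat_path[of t u] path_end_cat[of t u] by auto
    then show ?thesis
      using usv unfolding path_closure_def mem_Collect_eq
      by (intro exI[of _ "path_cat t u"] exI[of _ s] exI[of _ v]) (simp add: path_cat_assoc)
  qed
  show "path_cat w t \<in> path_closure S" if "path_end G w = fst t"
  proof -
    have "path_end G v = fst t" using P[OF usv(2-6)] usv(1) that by simp
    then have "path_cat v t \<in> quiver_paths G"
      using usv t path_cat_path[of v t] by auto
    then show ?thesis
      using usv unfolding path_closure_def mem_Collect_eq
      by (intro exI[of _ u] exI[of _ s] exI[of _ "path_cat v t"]) (simp add: path_cat_assoc)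
  qed
qed

lemma subset_path_closure:
  assumes S: "S \<subseteq> quiver_paths G"
  shows "S \<subseteq> path_closure S"
proof
  fix s assume s: "s \<in> S"
  have "s = path_cat (path_cat (fst s, []) s) (path_end G s, [])" by (simp add: path_cat_def)
  moreover have "s \<in> quiver_paths G" using s S by blast
  then have "(fst s, []) \<in> quiver_paths G" "(path_end G s, []) \<in> quiver_paths G"
    by (simp_all add: trivial_path path_start path_end_verts)
  ultimately show "s \<in> path_closure S"
    using s unfolding path_closure_def mem_Collect_eq
    by (intro exI[of _ "(fst s, [])"] exI[of _ s] exI[of _ "(path_end G s, [])"]) simp
qed

text \<open>
  An ideal generated by paths is spanned by paths: those that contain a generator as a subpath.
\<close>
lemma genideal_paths:
  assumes S: "S \<subseteq> quiver_paths G"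
  shows "Idl\<^bsub>PA\<^esub> ((\<lambda>w. single w (1::'k::field)) ` S) = {x. keys x \<subseteq> path_closure S}"
proof -
  let ?R = "PA :: ('k, ('a, 'b) path \<Rightarrow>\<^sub>0 'k) module"
  let ?s = "\<lambda>w. single w (1::'k)"
  interpret R: ring ?R by (rule ring_PA)
  have SR: "?s ` S \<subseteq> carrier ?R" using S by (auto simp: PA_simps(1))
  have "S \<subseteq> path_closure S" by (rule subset_path_closure[OF S])
  then have 1: "Idl\<^bsub>?R\<^esub> (?s ` S) \<subseteq> {x. keys x \<subseteq> path_closure S}"
    by (intro R.genideal_minimal span_ideal path_closed_closure S) auto
  define J where "J = Idl\<^bsub>?R\<^esub> (?s ` S)"
  interpret J: ideal J ?R unfolding J_def by (rule R.genideal_ideal[OF SR])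
  have sc: "pm_scale c x \<in> J" if x: "x \<in> J" for c x
  proof -
    have "x \<in> carrier ?R" using x J.a_Hcarr by blast
    then have "pm_scale c x = pm_scale c \<one>\<^bsub>?R\<^esub> \<otimes>\<^bsub>?R\<^esub> x"
      using klin_scale[OF klin_PA_mult_l] PA_one(1) by metis
    moreover have "pm_scale c \<one>\<^bsub>?R\<^esub> \<in> carrier ?R"
      using R.one_closed by (rule PA_scale_closed)
    ultimately show ?thesis using J.I_l_closed[OF x] by simp
  qed
  have sub: "pmv.subspace J"
    unfolding pmv.subspace_def using J.zero_closed J.a_closed sc by (auto simp: PA_simps(4,5))
  have "{x. keys x \<subseteq> path_closure S} \<subseteq> J"
  proof
    fix x :: "('a, 'b) path \<Rightarrow>\<^sub>0 'k" assume "x \<in> {x. keys x \<subseteq> path_closure S}"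
    then have x: "keys x \<subseteq> path_closure S" by simp
    show "x \<in> J"
    proof (rule klin_mem_subspace[OF klin_id sub x])
      fix w assume "w \<in> path_closure S"
      then obtain u s v where usv: "w = path_cat (path_cat u s) v" "s \<in> S" "u \<in> quiver_paths G" "v \<in> quiver_paths G"
        "path_end G u = fst s" "path_end G s = fst v" by (auto simp: path_closure_def)
      have "?s s \<in> J" unfolding J_def using R.genideal_self[OF SR] usv by auto
      then have "(?s u \<otimes>\<^bsub>?R\<^esub> ?s s) \<otimes>\<^bsub>?R\<^esub> ?s v \<in> J"
        using usv by (intro J.I_r_closed J.I_l_closed) (auto simp: PA_simps(1))
      moreover have "path_cat u s \<in> quiver_paths G" "path_end G (path_cat u s) = fst v"
        using usv S path_cat_path[of u s] path_end_cat[of u s] by auto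
      ultimately show "?s w \<in> J" using usv by (simp add: PA_mult_single)
    qed
  qed
  with 1 show ?thesis unfolding J_def by blast
qed

end

text \<open>
  The quotient of the path algebra by the span of a set \<open>N\<close> of paths. The parameter \<open>ty\<close>
  fixes the ground field.
\<close>
locale monomial_quotient = fin_digraph Q for Q :: "('v, 'e) pre_digraph" +
  fixes N :: "('v, 'e) path set" and ty :: "'k::field itself"
  assumes N_closed: "path_closed Q N"
    and N_trivial: "(v, []) \<notin> N"
begin

definition I :: "(('v, 'e) path \<Rightarrow>\<^sub>0 'k) set" where
  "I = {x. keys x \<subseteq> N}"

definition P :: "('v, 'e) path set" where
  "P = quiver_paths Q - N"

definition cl :: "('v, 'e) path \<Rightarrow> (('v, 'e) path \<Rightarrow>\<^sub>0 'k) set" where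
  "cl w = coset I (single w 1)"

text \<open>
  Coordinates of the coset of a vector: discard the paths in \<open>N\<close>.
\<close>
definition cof :: "(('v, 'e) path \<Rightarrow>\<^sub>0 'k) \<Rightarrow> ((('v, 'e) path \<Rightarrow>\<^sub>0 'k) set \<Rightarrow>\<^sub>0 'k)" where
  "cof = lin_ext (\<lambda>w. if w \<in> P then single (cl w) 1 else 0)"

definition co :: "(('v, 'e) path \<Rightarrow>\<^sub>0 'k) set \<Rightarrow> ((('v, 'e) path \<Rightarrow>\<^sub>0 'k) set \<Rightarrow>\<^sub>0 'k)" where
  "co X = cof (SOME x. x \<in> X)"

definition pth :: "(('v, 'e) path \<Rightarrow>\<^sub>0 'k) set \<Rightarrow> ('v, 'e) path" where
  "pth = inv_into P cl"

abbreviation QA :: "('k, (('v, 'e) path \<Rightarrow>\<^sub>0 'k) set) module" where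
  "QA \<equiv> quiver_algebra Q I"

lemma I_subspace: "pmv.subspace I"
  unfolding I_def by (rule subspace_keys)

lemma ideal_I: "ideal I (path_algebra Q)"
  unfolding I_def by (rule span_ideal[OF N_closed])

lemma QA_simps:
  "carrier QA = coset I ` carrier (path_algebra Q)"
  "zero QA = coset I 0"
  "coset I x \<oplus>\<^bsub>QA\<^esub> coset I y = coset I (x + y)"
  "c \<odot>\<^bsub>QA\<^esub> coset I x = coset I (pm_scale c x)"
  unfolding quiver_algebra_def
  by (rule quot_module_coset[OF PA_simps(6,7) I_subspace])+

lemma QA_mult:
  assumes "x \<in> carrier (path_algebra Q)" "y \<in> carrier (path_algebra Q)"
  shows "coset I x \<otimes>\<^bsub>QA\<^esub> coset I y = coset I (x \<otimes>\<^bsub>path_algebra Q\<^esub> y)"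
  using ideal.rcoset_mult_add[OF ideal_I assms]
  by (simp add: quiver_algebra_def quot_module_simps a_r_coset_coset PA_simps(6))

lemma cof_I: "x \<in> I \<Longrightarrow> cof x = 0"
  unfolding cof_def by (rule klin_eqI[OF klin_lin_ext klin_const0, of _ N]) (auto simp: I_def P_def)

lemma co_coset: "co (coset I x) = cof x"
proof -
  have "x \<in> coset I x" by (simp add: mem_coset_iff pmv.subspace_0[OF I_subspace])
  then have "(SOME y. y \<in> coset I x) \<in> coset I x" by (rule someI)
  then have "cof ((SOME y. y \<in> coset I x) - x) = 0" by (simp add: mem_coset_iff cof_I)
  then show ?thesis by (simp add: co_def) (simp add: cof_def lin_ext_minus)
qed

lemma inj_cl: "inj_on cl P"
proof (rule inj_onI)
  fix w w' assume w: "w \<in> P" "w' \<in> P" "cl w = cl w'"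
  then have "single w 1 - single w' 1 \<in> I"
    by (simp add: cl_def coset_eq_iff[OF I_subspace])
  then have k: "keys (single w 1 - single w' (1::'k)) \<subseteq> N"
    by (simp add: I_def)
  show "w = w'"
  proof (rule ccontr)
    assume "w \<noteq> w'"
    then have "w \<in> keys (single w 1 - single w' (1::'k))"
      by (simp add: in_keys_iff lookup_minus lookup_single)
    then show False using k w by (auto simp: P_def)
  qed
qed

lemma pth_cl [simp]: "w \<in> P \<Longrightarrow> pth (cl w) = w"
  by (simp add: pth_def inj_cl)

lemma cl_zero_iff: "w \<in> quiver_paths Q \<Longrightarrow> cl w = \<zero>\<^bsub>QA\<^esub> \<longleftrightarrow> w \<in> N"
  by (simp add: cl_def QA_simps(2) coset_eq_iff[OF I_subspace] del: coset_zero) (simp add: I_def)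

lemma cl_mult:
  assumes "w \<in> P" "w' \<in> P"
  shows "cl w \<otimes>\<^bsub>QA\<^esub> cl w' = (if path_end Q w = fst w' \<and> path_cat w w' \<in> P then cl (path_cat w w') else \<zero>\<^bsub>QA\<^esub>)"
proof -
  have P: "w \<in> quiver_paths Q" "w' \<in> quiver_paths Q" using assms by (auto simp: P_def)
  then have c: "single w 1 \<in> carrier (path_algebra Q)" "single w' 1 \<in> carrier (path_algebra Q)"
    by (auto simp: PA_simps(1))
  have *: "cl w \<otimes>\<^bsub>QA\<^esub> cl w' = coset I (if path_end Q w = fst w' then single (path_cat w w') 1 else 0)"
    unfolding cl_def QA_mult[OF c] PA_mult_single[OF P(1)] by simp
  show ?thesis
  proof (cases "path_end Q w = fst w'")
    case True
    then show ?thesis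
      using path_cat_path[OF P True] cl_zero_iff[of "path_cat w w'"] * by (auto simp: P_def cl_def)
  next
    case False
    then show ?thesis using * by (simp add: QA_simps(2))
  qed
qed

lemma unit_P: "v \<in> verts Q \<Longrightarrow> (v, []) \<in> P"
  using N_trivial by (auto simp: P_def trivial_path)

sublocale multiplicative_basis QA "cl ` P" co
proof
  note carr = QA_simps(1)
  show "\<zero>\<^bsub>QA\<^esub> \<in> carrier QA" unfolding carr QA_simps(2) by (rule imageI) (simp add: PA_simps(1))
  show "x \<oplus>\<^bsub>QA\<^esub> y \<in> carrier QA" if "x \<in> carrier QA" "y \<in> carrier QA" for x y
    using that unfolding carr by (auto simp: QA_simps(3) intro!: imageI PA_add_closed)
  show "c \<odot>\<^bsub>QA\<^esub> x \<in> carrier QA" if "x \<in> carrier QA" for c x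
    using that unfolding carr by (auto simp: QA_simps(4) intro!: imageI PA_scale_closed)
  show mc: "x \<otimes>\<^bsub>QA\<^esub> y \<in> carrier QA" if "x \<in> carrier QA" "y \<in> carrier QA" for x y
    using that unfolding carr by (auto simp: QA_mult intro!: imageI PA_mult_closed)
  show "(x \<oplus>\<^bsub>QA\<^esub> y) \<otimes>\<^bsub>QA\<^esub> z = x \<otimes>\<^bsub>QA\<^esub> z \<oplus>\<^bsub>QA\<^esub> y \<otimes>\<^bsub>QA\<^esub> z"
    and "z \<otimes>\<^bsub>QA\<^esub> (x \<oplus>\<^bsub>QA\<^esub> y) = z \<otimes>\<^bsub>QA\<^esub> x \<oplus>\<^bsub>QA\<^esub> z \<otimes>\<^bsub>QA\<^esub> y"
    if xyz: "x \<in> carrier QA" "y \<in> carrier QA" "z \<in> carrier QA" for x y z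
  proof -
    obtain x' y' z' where 1: "x = coset I x'" "y = coset I y'" "z = coset I z'"
      "x' \<in> carrier (path_algebra Q)" "y' \<in> carrier (path_algebra Q)" "z' \<in> carrier (path_algebra Q)"
      using xyz unfolding carr by blast
    have 2: "x' + y' \<in> carrier (path_algebra Q)" using 1 PA_add_closed by blast
    show "(x \<oplus>\<^bsub>QA\<^esub> y) \<otimes>\<^bsub>QA\<^esub> z = x \<otimes>\<^bsub>QA\<^esub> z \<oplus>\<^bsub>QA\<^esub> y \<otimes>\<^bsub>QA\<^esub> z"
      "z \<otimes>\<^bsub>QA\<^esub> (x \<oplus>\<^bsub>QA\<^esub> y) = z \<otimes>\<^bsub>QA\<^esub> x \<oplus>\<^bsub>QA\<^esub> z \<otimes>\<^bsub>QA\<^esub> y"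
      using 1(4-6) 2
      by (simp_all add: 1(1-3) QA_mult QA_simps(3) klin_plus[OF klin_PA_mult_l] klin_plus[OF klin_PA_mult_r])
  qed
  show "(c \<odot>\<^bsub>QA\<^esub> x) \<otimes>\<^bsub>QA\<^esub> y = c \<odot>\<^bsub>QA\<^esub> (x \<otimes>\<^bsub>QA\<^esub> y)"
    and "x \<otimes>\<^bsub>QA\<^esub> (c \<odot>\<^bsub>QA\<^esub> y) = c \<odot>\<^bsub>QA\<^esub> (x \<otimes>\<^bsub>QA\<^esub> y)"
    if xy: "x \<in> carrier QA" "y \<in> carrier QA" for c x y
  proof -
    obtain x' y' where 1: "x = coset I x'" "y = coset I y'"
      "x' \<in> carrier (path_algebra Q)" "y' \<in> carrier (path_algebra Q)"
      using xy unfolding carr by blast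
    have 2: "pm_scale c x' \<in> carrier (path_algebra Q)" "pm_scale c y' \<in> carrier (path_algebra Q)"
      using 1 PA_scale_closed by blast+
    show "(c \<odot>\<^bsub>QA\<^esub> x) \<otimes>\<^bsub>QA\<^esub> y = c \<odot>\<^bsub>QA\<^esub> (x \<otimes>\<^bsub>QA\<^esub> y)"
      "x \<otimes>\<^bsub>QA\<^esub> (c \<odot>\<^bsub>QA\<^esub> y) = c \<odot>\<^bsub>QA\<^esub> (x \<otimes>\<^bsub>QA\<^esub> y)"
      using 1(3,4) 2
      by (simp_all add: 1(1,2) QA_mult QA_simps(4) klin_scale[OF klin_PA_mult_l] klin_scale[OF klin_PA_mult_r])
  qed
  show "0 \<odot>\<^bsub>QA\<^esub> x = \<zero>\<^bsub>QA\<^esub>" if "x \<in> carrier QA" for x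
    using that unfolding carr by (auto simp: QA_simps(2,4) simp del: coset_zero)
  show "cl ` P \<subseteq> carrier QA" unfolding carr by (auto simp: cl_def P_def PA_simps(1))
  show "a \<otimes>\<^bsub>QA\<^esub> b \<in> insert \<zero>\<^bsub>QA\<^esub> (cl ` P)" if ab: "a \<in> cl ` P" "b \<in> cl ` P" for a b
  proof -
    obtain w w' where "a = cl w" "b = cl w'" "w \<in> P" "w' \<in> P" using ab by blast
    then show ?thesis by (simp add: cl_mult)
  qed
  show "co (x \<oplus>\<^bsub>QA\<^esub> y) = co x + co y" if "x \<in> carrier QA" "y \<in> carrier QA" for x y
    using that unfolding carr by (auto simp: QA_simps(3) co_coset cof_def lin_ext_plus)
  show "co (c \<odot>\<^bsub>QA\<^esub> x) = pm_scale c (co x)" if "x \<in> carrier QA" for c x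
    using that unfolding carr by (auto simp: QA_simps(4) co_coset cof_def lin_ext_scale)
  show "co b = single b 1" if "b \<in> cl ` P" for b
    using that by (auto simp: co_coset cof_def cl_def)
  show "keys (co x) \<subseteq> cl ` P" if x: "x \<in> carrier QA" for x
  proof -
    obtain x' where "x = coset I x'" using x unfolding carr by blast
    then show ?thesis
      by (simp add: co_coset cof_def) (rule keys_lin_ext[OF subset_refl], simp)
  qed
  show "R x" if x: "x \<in> carrier QA" and zero: "R \<zero>\<^bsub>QA\<^esub>"
    and step: "\<And>c b y. b \<in> cl ` P \<Longrightarrow> y \<in> carrier QA \<Longrightarrow> R y \<Longrightarrow> R (c \<odot>\<^bsub>QA\<^esub> b \<oplus>\<^bsub>QA\<^esub> y)" for x R
  proof -
    obtain x' where x': "x = coset I x'" "keys x' \<subseteq> quiver_paths Q"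
      using x unfolding carr by (auto simp: PA_simps(1))
    have "R (coset I (\<Sum>l\<in>S. single l (f l)))"
      if "finite S" "S \<subseteq> quiver_paths Q" for S f
      using that
    proof (induction S rule: finite_induct)
      case empty
      then show ?case using zero by (simp add: QA_simps(2))
    next
      case (insert l S)
      let ?y = "\<Sum>l\<in>S. single l (f l)"
      have y: "coset I ?y \<in> carrier QA" unfolding carr
      proof (rule imageI)
        have "?y \<in> {x. keys x \<subseteq> quiver_paths Q}"
          using insert.prems by (intro pmv.subspace_sum[OF subspace_keys]) auto
        then show "?y \<in> carrier (path_algebra Q)" by (simp add: PA_simps(1))
      qed
      have sum: "(\<Sum>l\<in>insert l S. single l (f l)) = single l (f l) + ?y"
        using insert by simp
      show ?case
      proof (cases "l \<in> N")
        case True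
        then have "coset I (single l (f l) + ?y) = coset I ?y"
          by (simp add: coset_eq_iff[OF I_subspace]) (simp add: I_def)
        then show ?thesis unfolding sum using insert by simp
      next
        case False
        then have "cl l \<in> cl ` P" using insert.prems by (simp add: P_def)
        moreover have "f l \<odot>\<^bsub>QA\<^esub> cl l \<oplus>\<^bsub>QA\<^esub> coset I ?y = coset I (single l (f l) + ?y)"
          by (simp add: cl_def QA_simps(3,4))
        moreover have "R (coset I ?y)" using insert by simp
        ultimately show ?thesis unfolding sum using step[OF _ y, of "cl l" "f l"] by simp
      qed
    qed
    from this[OF finite_keys x'(2), of "lookup x'"] show ?thesis
      by (simp only: sum_single_lookup x'(1))
  qed
qed

sublocale graded_basis QA "cl ` P" co "verts Q" "\<lambda>b. fst (pth b)" "\<lambda>b. path_end Q (pth b)"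
  "\<lambda>b. length (snd (pth b))" "\<lambda>v. cl (v, [])" "vertex_subalgebra Q I"
proof
  have PQ: "w \<in> quiver_paths Q" if "w \<in> P" for w using that by (simp add: P_def)
  have vs: "vertex_subalgebra Q I = coset I ` {x. keys x \<subseteq> (\<lambda>v. (v, [])) ` verts Q}"
    by (simp add: vertex_subalgebra_def a_r_coset_coset PA_simps(6))
  have nz: "\<zero>\<^bsub>QA\<^esub> \<notin> cl ` P" by (rule zero_notin_B)
  show "fst (pth b) \<in> verts Q" "path_end Q (pth b) \<in> verts Q" if b: "b \<in> cl ` P" for b
  proof -
    obtain w where w: "b = cl w" "w \<in> P" using b by blast
    then show "fst (pth b) \<in> verts Q" "path_end Q (pth b) \<in> verts Q"
      using path_start[OF PQ[OF w(2)]] path_end_verts[OF PQ[OF w(2)]] by simp_all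
  qed
  show "cl (v, []) \<in> cl ` P" if "v \<in> verts Q" for v using unit_P[OF that] by simp
  show "fst (pth (cl (v, []))) = v" "path_end Q (pth (cl (v, []))) = v"
    "length (snd (pth (cl (v, [])))) = 0" if "v \<in> verts Q" for v
    using unit_P[OF that] by simp_all
  show "b = cl (fst (pth b), [])" if "b \<in> cl ` P" "length (snd (pth b)) = 0" for b
    using that by (auto simp: prod_eq_iff)
  fix a b assume ab: "a \<in> cl ` P" "b \<in> cl ` P"
  then obtain w w' where w: "a = cl w" "b = cl w'" "w \<in> P" "w' \<in> P" by blast
  show "a \<otimes>\<^bsub>QA\<^esub> b = \<zero>\<^bsub>QA\<^esub>" if "path_end Q (pth a) \<noteq> fst (pth b)"
    using that w by (simp add: cl_mult)
  show "fst (pth (a \<otimes>\<^bsub>QA\<^esub> b)) = fst (pth a)" "path_end Q (pth (a \<otimes>\<^bsub>QA\<^esub> b)) = path_end Q (pth b)"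
    "length (snd (pth (a \<otimes>\<^bsub>QA\<^esub> b))) = length (snd (pth a)) + length (snd (pth b))"
    if "a \<otimes>\<^bsub>QA\<^esub> b \<in> cl ` P"
    using that w nz path_end_cat[of w w'] by (auto simp: cl_mult split: if_splits)
next
  fix b assume "b \<in> cl ` P"
  then obtain w where w: "b = cl w" "w \<in> P" by blast
  have v: "fst w \<in> verts Q" "path_end Q w \<in> verts Q"
    using w path_start path_end_verts by (auto simp: P_def)
  show "cl (fst (pth b), []) \<otimes>\<^bsub>QA\<^esub> b = b"
    using w unit_P[OF v(1)] by (simp add: cl_mult path_cat_def)
  show "b \<otimes>\<^bsub>QA\<^esub> cl (path_end Q (pth b), []) = b"
    using w unit_P[OF v(2)] by (simp add: cl_mult path_cat_def)
next
  have vs: "vertex_subalgebra Q I = coset I ` {x. keys x \<subseteq> (\<lambda>v. (v, [])) ` verts Q}"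
    by (simp add: vertex_subalgebra_def a_r_coset_coset PA_simps(6))
  show "(\<lambda>v. cl (v, [])) ` verts Q \<subseteq> vertex_subalgebra Q I"
    unfolding vs by (auto simp: cl_def)
  show "vertex_subalgebra Q I \<subseteq> carrier QA"
  proof -
    have "(\<lambda>v. (v, [])) ` verts Q \<subseteq> quiver_paths Q" by (auto simp: trivial_path)
    then show ?thesis unfolding vs QA_simps(1) PA_simps(1) by blast
  qed
  show "keys (co a) \<subseteq> (\<lambda>v. cl (v, [])) ` verts Q" if a: "a \<in> vertex_subalgebra Q I" for a
  proof -
    obtain x where x: "a = coset I x" "keys x \<subseteq> (\<lambda>v. (v, [])) ` verts Q"
      using a unfolding vs by blast
    show ?thesis unfolding x(1) co_coset cof_def by (rule keys_lin_ext[OF x(2)]) auto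
  qed
qed

end

section \<open>Periods of cycles\<close>

text \<open>
  The periodic sequence of arrows met when running around the cycle forever. Roots and rotations of
  cycles are studied through the periods and shifts of this sequence.
\<close>
definition cyc_seq :: "'e list \<Rightarrow> nat \<Rightarrow> 'e" where
  "cyc_seq c j = c ! (j mod length c)"

definition period :: "(nat \<Rightarrow> 'e) \<Rightarrow> nat \<Rightarrow> bool" where
  "period f p \<longleftrightarrow> 0 < p \<and> (\<forall>j. f (j + p) = f j)"

lemma period_mult: "period f p \<Longrightarrow> f (j + p * k) = f j"
proof (induction k)
  case (Suc k)
  then have "f (j + p * Suc k) = f ((j + p * k) + p)" by (simp add: algebra_simps)
  also have "\<dots> = f (j + p * k)" using Suc.prems unfolding period_def by blast
  finally show ?case using Suc by simp
qed simp

lemma period_mod: "period f p \<Longrightarrow> f (j mod p) = f j"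
  using period_mult[of f p "j mod p" "j div p"] by simp

text \<open>
  Going forward a multiple of one period and backward a multiple of the other is, by Bezout, a step of
  the size of the greatest common divisor.
\<close>
lemma period_gcd:
  assumes "period f a" "period f b"
  shows "period f (gcd a b)"
proof -
  obtain x y where xy: "a * x = b * y + gcd a b"
    using bezout_nat[of a b] assms(1) by (auto simp: period_def)
  have "f (j + gcd a b) = f j" for j
  proof -
    have "f (j + gcd a b) = f (j + gcd a b + b * y)" by (simp add: period_mult[OF assms(2)])
    also have "\<dots> = f (j + a * x)" using xy by (simp add: algebra_simps)
    finally show ?thesis by (simp add: period_mult[OF assms(1)])
  qed
  then show ?thesis using assms(1) by (simp add: period_def)
qed

text \<open>
  In a periodic sequence every index occurs, modulo the period, arbitrarily far out.
\<close>
lemma period_shift: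
  assumes "period f n" "\<And>j. f (i + j + p) = f (i + j)" "0 < p"
  shows "period f p"
  unfolding period_def
proof (intro conjI allI)
  fix j
  have i: "i \<le> n * i" using assms(1) by (cases n) (auto simp: period_def)
  then obtain d where d: "n * i = i + d" using le_Suc_ex by blast
  have "f (j + p) = f (j + p + n * i)" by (simp add: period_mult[OF assms(1)])
  also have "\<dots> = f (i + (j + d) + p)" by (simp only: d) (simp add: algebra_simps)
  also have "\<dots> = f (i + (j + d))" by (rule assms(2))
  also have "\<dots> = f (j + n * i)" by (simp only: d) (simp add: algebra_simps)
  finally show "f (j + p) = f j" by (simp add: period_mult[OF assms(1)])
qed (rule assms(3))

lemma period_length: "c \<noteq> [] \<Longrightarrow> period (cyc_seq c) (length c)"
  by (simp add: period_def cyc_seq_def)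

lemma nth_concat_replicate:
  "i < k * length xs \<Longrightarrow> concat (replicate k xs) ! i = xs ! (i mod length xs)"
proof (induction k arbitrary: i)
  case (Suc k)
  show ?case
  proof (cases "i < length xs")
    case False
    then have "concat (replicate (Suc k) xs) ! i = concat (replicate k xs) ! (i - length xs)"
      by (simp add: nth_append)
    also have "\<dots> = xs ! ((i - length xs) mod length xs)"
      using False Suc.prems by (intro Suc.IH) auto
    finally show ?thesis using False by (simp add: le_mod_geq)
  qed (simp add: nth_append)
qed simp

lemma length_concat_replicate: "length (concat (replicate k xs)) = k * length xs"
  by (induction k) auto

lemma quiver_cycle_seq:
  "quiver_cycle Q c \<longleftrightarrow> c \<noteq> [] \<and> set c \<subseteq> arcs Q \<and> (\<forall>j. head Q (cyc_seq c j) = tail Q (cyc_seq c (Suc j)))"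
proof (cases "c = []")
  case False
  have "(\<forall>i<length c. head Q (c ! i) = tail Q (c ! ((i + 1) mod length c))) \<longleftrightarrow>
      (\<forall>j. head Q (cyc_seq c j) = tail Q (cyc_seq c (Suc j)))" (is "?l \<longleftrightarrow> ?r")
  proof
    assume ?l
    show ?r
    proof
      fix j
      have "j mod length c < length c" using False by simp
      then have "head Q (cyc_seq c j) = tail Q (c ! ((j mod length c + 1) mod length c))"
        using \<open>?l\<close> by (simp add: cyc_seq_def)
      then show "head Q (cyc_seq c j) = tail Q (cyc_seq c (Suc j))"
        by (simp add: cyc_seq_def mod_Suc_eq)
    qed
  next
    assume ?r
    show ?l
    proof (intro allI impI)
      fix i assume "i < length c"
      then show "head Q (c ! i) = tail Q (c ! ((i + 1) mod length c))"
        using \<open>?r\<close>[rule_format, of i] by (simp add: cyc_seq_def)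
    qed
  qed
  then show ?thesis by (simp add: quiver_cycle_def)
qed (simp add: quiver_cycle_def)

lemma cyc_seq_take:
  assumes "period (cyc_seq c) g" "g \<le> length c"
  shows "cyc_seq (take g c) = cyc_seq c"
proof
  fix j
  have g: "0 < g" using assms(1) by (simp add: period_def)
  have j: "j mod g < g" using g by simp
  have "cyc_seq c j = cyc_seq c (j mod g)" using period_mod[OF assms(1)] by simp
  also have "\<dots> = c ! (j mod g)" using j assms(2) by (simp add: cyc_seq_def)
  finally show "cyc_seq (take g c) j = cyc_seq c j" using j assms(2) by (simp add: cyc_seq_def min_absorb2)
qed

lemma quiver_cycle_take:
  assumes "quiver_cycle Q c" "period (cyc_seq c) g" "g \<le> length c"
  shows "quiver_cycle Q (take g c)"
proof -
  have "0 < g" using assms(2) by (simp add: period_def)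
  then show ?thesis
    using assms(1) set_take_subset[of g c] by (auto simp: quiver_cycle_seq cyc_seq_take[OF assms(2,3)])
qed

text \<open>
  Otherwise the greatest common divisor of \<open>p\<close> and the length would be a smaller period that divides
  the length, and the cycle would be a power of its initial part of that length.
\<close>
lemma proper_cycle_period:
  assumes "proper_cycle Q c" "period (cyc_seq c) p"
  shows "length c dvd p"
proof -
  have qc: "quiver_cycle Q c" using assms(1) by (simp add: proper_cycle_def)
  then have ne: "c \<noteq> []" by (simp add: quiver_cycle_def)
  define g where "g = gcd p (length c)"
  have g: "period (cyc_seq c) g" unfolding g_def by (rule period_gcd[OF assms(2) period_length[OF ne]])
  have gl: "g dvd length c" "g \<le> length c" "0 < g"
    using ne by (auto simp: g_def intro!: dvd_imp_le)
  show ?thesis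
  proof (cases "g = length c")
    case True
    then show ?thesis by (metis g_def gcd_dvd1)
  next
    case False
    obtain m where m: "length c = g * m" using gl(1) by (auto simp: dvd_def)
    have "m \<ge> 2" using m False ne by (cases m; cases "m - 1") auto
    have len: "length (take g c) = g" using gl by simp
    have "c = concat (replicate m (take g c))"
    proof (rule nth_equalityI)
      show "length c = length (concat (replicate m (take g c)))"
        unfolding length_concat_replicate len using m by simp
      fix i assume i: "i < length c"
      have "concat (replicate m (take g c)) ! i = cyc_seq (take g c) i"
        using i m len by (subst nth_concat_replicate) (auto simp: cyc_seq_def mult.commute)
      also have "\<dots> = c ! i" unfolding cyc_seq_take[OF g gl(2)] using i by (simp add: cyc_seq_def)
      finally show "c ! i = concat (replicate m (take g c)) ! i" by simp
    qed
    then show ?thesis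
      using assms(1) quiver_cycle_take[OF qc g gl(2)] \<open>m \<ge> 2\<close> unfolding proper_cycle_def by blast
  qed
qed

text \<open>
  The difference of the two phases would be a period smaller than the length.
\<close>
lemma proper_phase_unique:
  assumes c: "proper_cycle Q c" and i: "i < length c" "i' < length c"
    and eq: "\<And>j. cyc_seq c (i + j) = cyc_seq c (i' + j)"
  shows "i = i'"
proof -
  have ne: "c \<noteq> []" using i by auto
  have *: "\<not> a < b" if "b < length c" "\<And>j. cyc_seq c (a + j) = cyc_seq c (b + j)" for a b
  proof
    assume "a < b"
    then have "period (cyc_seq c) (b - a)"
      using that by (intro period_shift[OF period_length[OF ne], of a]) (auto simp: algebra_simps)
    then have "length c dvd b - a" by (rule proper_cycle_period[OF c])
    then show False using \<open>a < b\<close> that(1) by (auto dest: dvd_imp_le)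
  qed
  show ?thesis using *[of i' i] *[of i i'] i eq by (metis linorder_neqE_nat)
qed

text \<open>
  Each of the two lengths is a period of the sequence of the other cycle, so they divide each other.
\<close>
lemma proper_common_sequence:
  assumes c: "proper_cycle Q c" "proper_cycle Q c'"
    and eq: "\<And>j. cyc_seq c (i + j) = cyc_seq c' (i' + j)"
  shows "\<exists>k. c' = rotate k c"
proof -
  have ne: "c \<noteq> []" "c' \<noteq> []" using c by (auto simp: proper_cycle_def quiver_cycle_def)
  note p = period_length[OF ne(1)] period_length[OF ne(2)]
  have "period (cyc_seq c) (length c')"
  proof (rule period_shift[OF p(1), of i])
    fix j
    show "cyc_seq c (i + j + length c') = cyc_seq c (i + j)"
      using eq[of "j + length c'"] eq[of j] p(2) by (simp add: period_def add.assoc[symmetric])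
  qed (use ne in simp)
  moreover have "period (cyc_seq c') (length c)"
  proof (rule period_shift[OF p(2), of i'])
    fix j
    show "cyc_seq c' (i' + j + length c) = cyc_seq c' (i' + j)"
      using eq[of "j + length c"] eq[of j] p(1) by (simp add: period_def add.assoc[symmetric])
  qed (use ne in simp)
  ultimately have len: "length c = length c'"
    using proper_cycle_period[OF c(1)] proper_cycle_period[OF c(2)] dvd_antisym by blast
  have "i' \<le> length c' * i'" using ne by (cases "length c'") auto
  then obtain d where d: "length c' * i' = i' + d" using le_Suc_ex by blast
  define k where "k = i + d"
  have "c' = rotate k c"
  proof (rule nth_equalityI)
    fix j assume j: "j < length c'"
    have "c' ! j = cyc_seq c' (j + length c' * i')" using j period_mult[OF p(2)] by (simp add: cyc_seq_def)
    also have "j + length c' * i' = i' + (j + d)" using d by simp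
    also have "cyc_seq c' \<dots> = cyc_seq c (i + (j + d))" by (simp only: eq)
    also have "\<dots> = cyc_seq c (k + j)" by (simp add: k_def algebra_simps)
    finally show "c' ! j = rotate k c ! j" using j len by (simp add: nth_rotate cyc_seq_def)
  qed (simp add: len)
  then show ?thesis by blast
qed

text \<open>
  The initial part of length the least period is a cycle, and it is proper because a root of it would
  give a smaller period.
\<close>
lemma cycle_has_proper_root:
  assumes T: "proper_cycle_reps Q T" and w: "quiver_cycle Q w"
  shows "\<exists>c\<in>T. \<exists>i<length c. length c dvd length w \<and> (\<forall>j. cyc_seq w j = cyc_seq c (i + j))"
proof -
  have ne: "w \<noteq> []" using w by (simp add: quiver_cycle_def)
  define g where "g = (LEAST p. period (cyc_seq w) p)"
  have g: "period (cyc_seq w) g" unfolding g_def by (rule LeastI[of "period (cyc_seq w)", OF period_length[OF ne]])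
  have least: "g \<le> p" if "period (cyc_seq w) p" for p unfolding g_def by (rule Least_le[of "period (cyc_seq w)", OF that])
  have gl: "g \<le> length w" by (rule least[OF period_length[OF ne]])
  have g0: "0 < g" using g by (simp add: period_def)
  have "g \<le> gcd g (length w)" by (rule least[OF period_gcd[OF g period_length[OF ne]]])
  then have gd: "g dvd length w" using g0 by (metis gcd_dvd2 gcd_le1_nat le_antisym nat_neq_iff)
  define p where "p = take g w"
  have lp: "length p = g" using gl by (simp add: p_def)
  have sp: "cyc_seq p = cyc_seq w" unfolding p_def by (rule cyc_seq_take[OF g gl])
  have "proper_cycle Q p"
    unfolding proper_cycle_def
  proof (intro conjI notI)
    show "quiver_cycle Q p" unfolding p_def by (rule quiver_cycle_take[OF w g gl])
    assume "\<exists>c' m. quiver_cycle Q c' \<and> 2 \<le> m \<and> p = concat (replicate m c')"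
    then obtain c' m where c': "quiver_cycle Q c'" "2 \<le> m" "p = concat (replicate m c')" by blast
    have c'ne: "c' \<noteq> []" using c'(1) by (simp add: quiver_cycle_def)
    have lc': "g = m * length c'" using lp c'(3) by (simp add: length_concat_replicate)
    have "cyc_seq p j = cyc_seq c' j" for j
    proof -
      have "j mod g < m * length c'" using g0 lc' by simp
      then have "concat (replicate m c') ! (j mod g) = c' ! (j mod g mod length c')"
        by (rule nth_concat_replicate)
      then have "cyc_seq p j = c' ! (j mod g mod length c')"
        unfolding c'(3)[symmetric] by (simp add: cyc_seq_def lp)
      then show ?thesis by (simp add: cyc_seq_def lc' mod_mod_cancel)
    qed
    then have "period (cyc_seq w) (length c')"
      using period_length[OF c'ne] unfolding sp[symmetric] period_def by simp
    then have "g \<le> length c'" by (rule least)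
    moreover have "2 * length c' \<le> g" unfolding lc' by (rule mult_le_mono1[OF c'(2)])
    moreover have "0 < length c'" using c'ne by simp
    ultimately show False by linarith
  qed
  then obtain c k where c: "c \<in> T" "c = rotate k p"
    using T unfolding proper_cycle_reps_def by blast
  have lc: "length c = g" using c lp by simp
  have cs: "cyc_seq c j = cyc_seq p (k + j)" for j
    using g0 lp by (simp add: c(2) cyc_seq_def nth_rotate mod_add_right_eq)
  \<comment> \<open>\<open>i\<close> undoes the rotation by \<open>k\<close>\<close>
  define i where "i = (g - k mod g) mod g"
  have "cyc_seq w j = cyc_seq c (i + j)" for j
  proof -
    have "(k + i) mod g = 0"
    proof -
      have "(k + i) mod g = (k mod g + (g - k mod g)) mod g"
        unfolding i_def by (simp only: mod_add_left_eq mod_add_right_eq)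
      also have "k mod g + (g - k mod g) = g" using g0 by (simp add: less_imp_le)
      finally show ?thesis by simp
    qed
    then obtain q where q: "k + i = g * q" by (auto simp: mod_eq_0_iff_dvd dvd_def)
    have "cyc_seq c (i + j) = cyc_seq w (j + g * q)" unfolding cs sp q[symmetric] by (simp add: algebra_simps)
    then show ?thesis using period_mult[OF g] by simp
  qed
  moreover have "i < length c" using g0 lc by (simp add: i_def)
  ultimately show ?thesis using c(1) gd lc by blast
qed

section \<open>Cycle algebras\<close>

lemma fin_digraph_basic_cycle: "0 < n \<Longrightarrow> fin_digraph (basic_cycle n)"
  by unfold_locales (auto simp: basic_cycle_def)

lemma basic_cycle_cas:
  "i < n \<Longrightarrow> pre_digraph.cas (basic_cycle n) i p v \<longleftrightarrow>
    p = map (\<lambda>j. (i + j) mod n) [0..<length p] \<and> v = (i + length p) mod n"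
proof (induction p arbitrary: i)
  case Nil
  then show ?case by (auto simp: pre_digraph.cas.simps)
next
  case (Cons a p)
  have n: "(i + 1) mod n < n" using Cons.prems by simp
  have "map (\<lambda>j. (i + j) mod n) [0..<length (a # p)] = i # map (\<lambda>j. ((i + 1) mod n + j) mod n) [0..<length p]"
    using Cons.prems by (simp add: upt_conv_Cons map_Suc_upt[symmetric] comp_def mod_add_left_eq del: upt_Suc)
  moreover have "((i + 1) mod n + length p) mod n = (i + length (a # p)) mod n"
    by (simp add: mod_add_left_eq)
  moreover have "pre_digraph.cas (basic_cycle n) i (a # p) v \<longleftrightarrow>
      a = i \<and> pre_digraph.cas (basic_cycle n) ((i + 1) mod n) p v"
    by (auto simp: pre_digraph.cas.simps basic_cycle_def)
  ultimately show ?case using Cons.IH[OF n] by auto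
qed

text \<open>
  The path of length \<open>k\<close> starting at the vertex \<open>i\<close> of the basic cycle of length
  \<open>n\<close>; by the next lemma every path has this form.
\<close>
definition arc_path :: "nat \<Rightarrow> nat \<Rightarrow> nat \<Rightarrow> (nat, nat) path" where
  "arc_path n i k = (i, map (\<lambda>j. (i + j) mod n) [0..<k])"

lemma basic_cycle_paths:
  assumes "0 < n"
  shows "quiver_paths (basic_cycle n) = {arc_path n i k | i k. i < n}"
proof (rule equalityI; rule subsetI)
  fix w assume "w \<in> quiver_paths (basic_cycle n)"
  then obtain v where "pre_digraph.awalk (basic_cycle n) (fst w) (snd w) v"
    by (auto simp: quiver_paths_def)
  then have "fst w < n" "pre_digraph.cas (basic_cycle n) (fst w) (snd w) v"
    by (auto simp: pre_digraph.awalk_def basic_cycle_def)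
  then have "w = arc_path n (fst w) (length (snd w))" "fst w < n"
    using basic_cycle_cas[of "fst w" n "snd w" v] by (auto simp: arc_path_def prod_eq_iff)
  then show "w \<in> {arc_path n i k | i k. i < n}" by blast
next
  fix w assume "w \<in> {arc_path n i k | i k. i < n}"
  then obtain i k where w: "w = arc_path n i k" "i < n" by blast
  then have "pre_digraph.awalk (basic_cycle n) i (snd w) ((i + k) mod n)"
    using assms basic_cycle_cas[of i n "snd w" "(i + k) mod n"]
    by (auto simp: pre_digraph.awalk_def arc_path_def basic_cycle_def)
  then show "w \<in> quiver_paths (basic_cycle n)" by (auto simp: quiver_paths_def w arc_path_def)
qed

lemma arc_path_end:
  assumes "i < n"
  shows "path_end (basic_cycle n) (arc_path n i k) = (i + k) mod n"
proof -
  interpret C: fin_digraph "basic_cycle n" using assms by (intro fin_digraph_basic_cycle) simp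
  have "arc_path n i k \<in> quiver_paths (basic_cycle n)" using basic_cycle_paths[of n] assms by auto
  then have "pre_digraph.awalk (basic_cycle n) i (snd (arc_path n i k)) (path_end (basic_cycle n) (arc_path n i k))"
    using C.quiver_paths_iff by (auto simp: arc_path_def)
  then show ?thesis
    using basic_cycle_cas[OF assms] by (auto simp: pre_digraph.awalk_def arc_path_def)
qed

context monomial_quotient
begin

definition word :: "(('v, 'e) path \<Rightarrow>\<^sub>0 'k) set list \<Rightarrow> 'e list" where
  "word l = concat (map (\<lambda>b. snd (pth b)) l)"

lemma length_word: "length (word l) = size_of l"
  by (simp add: word_def size_of_def length_concat comp_def)

lemma awalk_word:
  "set l \<subseteq> cl ` P \<Longrightarrow> chain u l v \<Longrightarrow> u \<in> verts Q \<Longrightarrow> awalk u (word l) v"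
proof (induction l arbitrary: u)
  case Nil
  then show ?case by (simp add: word_def awalk_Nil_iff)
next
  case (Cons a l)
  obtain w where w: "a = cl w" "w \<in> P" using Cons.prems(1) by auto
  then have wp: "w \<in> quiver_paths Q" by (simp add: P_def)
  have "awalk u (snd w) (path_end Q w)"
    using awalk_path_end[OF wp, of "path_end Q w"] Cons.prems(2) w by simp
  moreover have "awalk (path_end Q w) (word l) v"
    using Cons.prems w path_end_verts[OF wp] by (intro Cons.IH) auto
  ultimately show ?case using w awalk_appendI by (simp add: word_def)
qed

lemma closed_walk_cycle:
  assumes "awalk u w u" "w \<noteq> []"
  shows "quiver_cycle Q w"
  unfolding quiver_cycle_def
proof (intro conjI allI impI)
  show "set w \<subseteq> arcs Q" using assms(1) by blast
  have first: "tail Q (w ! 0) = u" using assms by (cases w) (auto simp: awalk_Cons_iff)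
  fix i assume i: "i < length w"
  have "awalk u (take i w @ w ! i # drop (Suc i) w) u" using assms(1) i by (simp add: id_take_nth_drop[symmetric])
  then have rest: "awalk (head Q (w ! i)) (drop (Suc i) w) u" by (simp add: awalk_Cons_iff)
  show "head Q (w ! i) = tail Q (w ! ((i + 1) mod length w))"
  proof (cases "Suc i = length w")
    case True
    then show ?thesis using rest first by (simp add: awalk_Nil_iff)
  next
    case False
    then have "drop (Suc i) w = w ! Suc i # drop (Suc (Suc i)) w" using i by (simp add: Cons_nth_drop_Suc)
    then show ?thesis using rest False i by (simp add: awalk_Cons_iff)
  qed
qed (rule assms(2))

lemma word_cycle:
  assumes "l \<in> G \<inter> Pos"
  shows "quiver_cycle Q (word l)"
proof -
  obtain u where u: "chain u l u" "l \<noteq> []" "set l \<subseteq> cl ` P" "size_of l \<noteq> 0"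
    using assms by (auto simp: Pos_def cyc_def G_def)
  then have "u \<in> verts Q" using ends_V0 by (cases l) auto
  then have "awalk u (word l) u" by (rule awalk_word[OF u(3,1)])
  moreover have "word l \<noteq> []" using u(4) length_word[of l] by auto
  ultimately show ?thesis by (rule closed_walk_cycle)
qed

end

text \<open>
  The cycle algebra of \<open>c\<close>, which is again a quotient of a path algebra by a span of paths
  (\<open>Z\<close>), together with the map \<open>cov\<close> that takes nonzero paths around the cycle to their images
  in \<open>Q\<close>.
\<close>
locale cycle_cover = monomial_quotient Q N ty
  for Q :: "('v, 'e) pre_digraph" and N :: "('v, 'e) path set" and ty :: "'k::field itself" +
  fixes c :: "'e list"
  assumes cycle: "quiver_cycle Q c"
begin

abbreviation n :: nat where "n \<equiv> length c"

definition cover_zero :: "(nat, nat) path set" where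
  "cover_zero = {w \<in> quiver_paths (basic_cycle n). cycle_image Q c w \<in> N}"

lemma n_pos: "0 < n"
  using cycle by (simp add: quiver_cycle_def)

lemma seq_arc: "cyc_seq c j \<in> arcs Q"
  using cycle n_pos by (auto simp: quiver_cycle_def cyc_seq_def)

lemma seq_step: "head Q (cyc_seq c j) = tail Q (cyc_seq c (Suc j))"
  using cycle by (simp add: quiver_cycle_seq)

lemma image_arc_path:
  "i < n \<Longrightarrow> cycle_image Q c (arc_path n i k) = (tail Q (cyc_seq c i), map (\<lambda>j. cyc_seq c (i + j)) [0..<k])"
  by (simp add: cycle_image_def arc_path_def cyc_seq_def)

lemma awalk_seq: "awalk (tail Q (cyc_seq c i)) (map (\<lambda>j. cyc_seq c (i + j)) [0..<k]) (tail Q (cyc_seq c (i + k)))"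
proof (induction k)
  case 0
  then show ?case using seq_arc by (simp add: awalk_Nil_iff)
next
  case (Suc k)
  have "awalk (tail Q (cyc_seq c (i + k))) [cyc_seq c (i + k)] (tail Q (cyc_seq c (i + Suc k)))"
    using seq_arc seq_step by (simp add: awalk_Cons_iff awalk_Nil_iff)
  from awalk_appendI[OF Suc this] show ?case by simp
qed

lemma image_path:
  assumes "w \<in> quiver_paths (basic_cycle n)"
  shows "cycle_image Q c w \<in> quiver_paths Q"
    and "path_end Q (cycle_image Q c w) = tail Q (c ! path_end (basic_cycle n) w)"
proof -
  obtain i k where w: "w = arc_path n i k" "i < n" using assms basic_cycle_paths[OF n_pos] by blast
  show p: "cycle_image Q c w \<in> quiver_paths Q"
    using awalk_seq[of i k] unfolding w(1) image_arc_path[OF w(2)] quiver_paths_def by auto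
  have "path_end Q (cycle_image Q c w) = tail Q (cyc_seq c (i + k))"
    using awalk_path_end[OF p] awalk_seq[of i k] unfolding w(1) image_arc_path[OF w(2)] by simp
  then show "path_end Q (cycle_image Q c w) = tail Q (c ! path_end (basic_cycle n) w)"
    unfolding w(1) arc_path_end[OF w(2)] by (simp add: cyc_seq_def)
qed

lemma image_cat: "cycle_image Q c (path_cat u w) = path_cat (cycle_image Q c u) (cycle_image Q c w)"
  by (simp add: cycle_image_def path_cat_def)

lemma image_start: "fst (cycle_image Q c w) = tail Q (c ! fst w)"
  by (simp add: cycle_image_def)

lemma cover_zero_closed: "path_closed (basic_cycle n) cover_zero"
proof -
  interpret C: fin_digraph "basic_cycle n" by (rule fin_digraph_basic_cycle[OF n_pos])
  show ?thesis
    using N_closed C.path_cat_path image_path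
    unfolding path_closed_def cover_zero_def by (auto simp: image_cat image_start)
qed

sublocale Z: monomial_quotient "basic_cycle n" cover_zero ty
proof -
  interpret C: fin_digraph "basic_cycle n" by (rule fin_digraph_basic_cycle[OF n_pos])
  show "monomial_quotient (basic_cycle n) cover_zero"
    using cover_zero_closed N_trivial by unfold_locales (auto simp: cover_zero_def cycle_image_def)
qed

text \<open>
  The paths whose image lies in the ideal are already closed under composition with paths.
\<close>
lemma cycle_ideal_eq: "cycle_ideal Q I c = Z.I"
proof -
  have S: "{w \<in> quiver_paths (basic_cycle n). single (cycle_image Q c w) (1::'k) \<in> I} = cover_zero"
    by (auto simp: I_def cover_zero_def)
  have sub: "cover_zero \<subseteq> quiver_paths (basic_cycle n)" by (auto simp: cover_zero_def)
  have "Z.path_closure cover_zero = cover_zero"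
  proof
    show "cover_zero \<subseteq> Z.path_closure cover_zero" by (rule Z.subset_path_closure[OF sub])
    show "Z.path_closure cover_zero \<subseteq> cover_zero"
      using cover_zero_closed Z.path_end_cat unfolding Z.path_closure_def path_closed_def by auto
  qed
  then show ?thesis
    unfolding cycle_ideal_def S Z.genideal_paths[OF sub] Z.I_def by simp
qed

lemma cycle_algebra_eq: "cycle_algebra Q I c = Z.QA"
  and cycle_vertices_eq: "cycle_vertices Q I c = vertex_subalgebra (basic_cycle n) Z.I"
  by (simp_all add: cycle_algebra_def cycle_vertices_def cycle_ideal_eq)

text \<open>
  A product of two paths around the cycle can vanish. Sending zero to zero makes \<open>cov\<close>
  multiplicative in this case too.
\<close>
definition cov :: "((nat, nat) path \<Rightarrow>\<^sub>0 'k) set \<Rightarrow> (('v, 'e) path \<Rightarrow>\<^sub>0 'k) set" where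
  "cov b = (if b \<in> Z.cl ` Z.P then cl (cycle_image Q c (Z.pth b)) else \<zero>\<^bsub>QA\<^esub>)"

lemma ZP_iff: "w \<in> Z.P \<longleftrightarrow> w \<in> quiver_paths (basic_cycle n) \<and> cycle_image Q c w \<in> P"
proof -
  have "w \<in> cover_zero \<longleftrightarrow> w \<in> quiver_paths (basic_cycle n) \<and> cycle_image Q c w \<in> N" by (simp add: cover_zero_def)
  then show ?thesis using image_path(1)[of w] unfolding Z.P_def P_def by blast
qed

lemma cov_cl: "w \<in> Z.P \<Longrightarrow> cov (Z.cl w) = cl (cycle_image Q c w)"
  by (simp add: cov_def)

lemma cov_zero: "cov \<zero>\<^bsub>Z.QA\<^esub> = \<zero>\<^bsub>QA\<^esub>"
  using Z.zero_notin_B by (simp add: cov_def)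

lemma cov_B: "b \<in> Z.cl ` Z.P \<Longrightarrow> cov b \<in> cl ` P"
  by (auto simp: cov_cl ZP_iff)

lemma cov_B_iff: "cov b \<in> cl ` P \<longleftrightarrow> b \<in> Z.cl ` Z.P"
  using cov_B zero_notin_B by (auto simp: cov_def)

lemma cov_len: "b \<in> Z.cl ` Z.P \<Longrightarrow> length (snd (pth (cov b))) = length (snd (Z.pth b))"
  by (auto simp: cov_cl ZP_iff) (simp add: cycle_image_def)

lemma cov_ends:
  assumes "b \<in> Z.cl ` Z.P"
  shows "fst (pth (cov b)) = tail Q (c ! fst (Z.pth b))"
    and "path_end Q (pth (cov b)) = tail Q (c ! path_end (basic_cycle n) (Z.pth b))"
proof -
  obtain w where w: "b = Z.cl w" "w \<in> Z.P" using assms by blast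
  then have w': "w \<in> quiver_paths (basic_cycle n)" "cycle_image Q c w \<in> P" by (auto simp: ZP_iff)
  show "fst (pth (cov b)) = tail Q (c ! fst (Z.pth b))"
    "path_end Q (pth (cov b)) = tail Q (c ! path_end (basic_cycle n) (Z.pth b))"
    using w w'(2) image_path(2)[OF w'(1)] by (simp_all add: cov_cl image_start)
qed

text \<open>
  Composability has to be assumed: two paths that are not composable in the cycle can have composable
  images in \<open>Q\<close>.
\<close>
lemma cov_mult:
  assumes "a \<in> Z.cl ` Z.P" "b \<in> Z.cl ` Z.P" "path_end (basic_cycle n) (Z.pth a) = fst (Z.pth b)"
  shows "cov (a \<otimes>\<^bsub>Z.QA\<^esub> b) = cov a \<otimes>\<^bsub>QA\<^esub> cov b"
proof -
  obtain w w' where w: "a = Z.cl w" "b = Z.cl w'" "w \<in> Z.P" "w' \<in> Z.P" using assms by blast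
  have paths: "w \<in> quiver_paths (basic_cycle n)" "w' \<in> quiver_paths (basic_cycle n)"
    and imP: "cycle_image Q c w \<in> P" "cycle_image Q c w' \<in> P" using w by (auto simp: ZP_iff)
  have e: "path_end (basic_cycle n) w = fst w'" using assms(3) w by simp
  then have "path_cat w w' \<in> quiver_paths (basic_cycle n)" using Z.path_cat_path paths by blast
  moreover have "path_end Q (cycle_image Q c w) = fst (cycle_image Q c w')"
    using image_path(2)[OF paths(1)] e by (simp add: image_start)
  ultimately show ?thesis
    using w imP e cov_zero by (simp add: Z.cl_mult cl_mult cov_cl ZP_iff image_cat)
qed

lemma cov_chain:
  "set l \<subseteq> Z.cl ` Z.P \<Longrightarrow> Z.chain i l i' \<Longrightarrow> chain (tail Q (c ! i)) (map cov l) (tail Q (c ! i'))"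
  by (induction l arbitrary: i) (auto simp: cov_ends)

lemma cov_G: "map cov l \<in> G \<longleftrightarrow> l \<in> Z.G"
  by (simp add: G_def Z.G_def image_subset_iff cov_B_iff) blast

lemma cov_size: "l \<in> Z.G \<Longrightarrow> size_of (map cov l) = Z.size_of l"
  unfolding size_of_def Z.size_of_def Z.G_def
  by (auto simp: cov_len comp_def intro!: arg_cong[of _ _ sum_list] map_cong)

lemma cov_Pos:
  assumes "l \<in> Z.G \<inter> Z.Pos"
  shows "map cov l \<in> G \<inter> Pos"
proof -
  have "cyc (map cov l)"
    using assms cov_chain[of l] by (auto simp: Z.Pos_def Z.cyc_def cyc_def Z.G_def)
  then show ?thesis using assms cov_G cov_size by (auto simp: Pos_def Z.Pos_def)
qed

text \<open>
  In a cyclically composable list all pairs of entries that a face may merge are composable.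
\<close>
lemma cov_act:
  assumes l: "l \<in> Z.G \<inter> Z.Pos" and g: "valid_gen g (length l)"
  shows "map cov (act Z.QA g l) = act QA g (map cov l)"
proof (cases g)
  case (Rot j)
  then show ?thesis by (simp add: rotate_map)
next
  case (Face i)
  then have i: "i < length l" "2 \<le> length l" using g by auto
  obtain v where v: "Z.chain v l v" using l by (auto simp: Z.Pos_def Z.cyc_def)
  consider (1) us a b vs where "l = us @ a # b # vs" "i = length us"
    | (2) us a z where "l = a # us @ [z]" "i = Suc (length us)"
    using face_cases[OF i] by metis
  then show ?thesis
  proof cases
    case 1
    then have "cov (a \<otimes>\<^bsub>Z.QA\<^esub> b) = cov a \<otimes>\<^bsub>QA\<^esub> cov b"
      using l v by (intro cov_mult) (auto simp: Z.G_def Z.chain_append)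
    then show ?thesis
      using 1 face_inner[of QA "map cov us" "cov a" "cov b" "map cov vs"] by (simp add: Face face_inner)
  next
    case 2
    then have "cov (z \<otimes>\<^bsub>Z.QA\<^esub> a) = cov z \<otimes>\<^bsub>QA\<^esub> cov a"
      using l v by (intro cov_mult) (auto simp: Z.G_def Z.chain_append)
    then show ?thesis
      using 2 face_outer[of QA "map cov us" "cov a" "cov z"] by (simp add: Face face_outer)
  qed
qed

lemma dB_push:
  assumes ops: "ops_map ops L L'" and y: "keys y \<subseteq> Z.G \<inter> Z.Pos \<inter> {l. length l \<in> L}"
  shows "dB ops (push (map cov) y) = push (map cov) (Z.dB ops y)"
proof (rule klin_eqI[where f = "\<lambda>y. dB ops (push (map cov) y)" and g = "\<lambda>y. push (map cov) (Z.dB ops y)",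
      OF klin_comp[OF klin_dB klin_push] klin_comp[OF klin_push Z.klin_dB] y])
  fix l assume l: "l \<in> Z.G \<inter> Z.Pos \<inter> {l. length l \<in> L}"
  have one: "restr G (single (act QA g (map cov l)) a)
      = push (map cov) (restr Z.G (single (act Z.QA g l) (a::'k)))"
    if "(a, g) \<in> set (ops (length l))" for a g
  proof -
    have "valid_gen g (length l)" using ops l that by (auto simp: ops_map_def)
    then have "act QA g (map cov l) = map cov (act Z.QA g l)" using cov_act l by simp
    then show ?thesis using cov_G[of "act Z.QA g l"] by (simp add: restr_single push_def)
  qed
  have "dB ops (single (map cov l) 1)
      = (\<Sum>(a, g)\<leftarrow>ops (length l). restr G (single (act QA g (map cov l)) a))"
    by (simp add: dB_def op_of_single klin_sum_list[OF klin_restr] case_prod_unfold)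
  also have "\<dots> = (\<Sum>(a, g)\<leftarrow>ops (length l). push (map cov) (restr Z.G (single (act Z.QA g l) a)))"
    using one by (intro arg_cong[of _ _ sum_list] map_cong) auto
  also have "\<dots> = push (map cov) (Z.dB ops (single l 1))"
    by (simp add: Z.dB_def op_of_single klin_sum_list[OF klin_restr] klin_sum_list[OF klin_push] case_prod_unfold)
  finally show "dB ops (push (map cov) (single l 1)) = push (map cov) (Z.dB ops (single l 1))"
    by (simp add: push_def)
qed

subsection \<open>Lifting cyclically composable tensors\<close>

lemma Z_element:
  assumes "b \<in> Z.cl ` Z.P"
  obtains i k where "i < n" "Z.pth b = arc_path n i k" "b = Z.cl (arc_path n i k)" "arc_path n i k \<in> Z.P"
    "pth (cov b) = (tail Q (cyc_seq c i), map (\<lambda>j. cyc_seq c (i + j)) [0..<k])"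
proof -
  obtain w where w: "b = Z.cl w" "w \<in> Z.P" using assms by blast
  then obtain i k where ik: "w = arc_path n i k" "i < n" using basic_cycle_paths[OF n_pos] by (auto simp: ZP_iff)
  have "cycle_image Q c w \<in> P" using w ZP_iff by blast
  then show thesis using that[of i k] w ik image_arc_path[OF ik(2)] by (simp add: cov_cl)
qed

lemma map_seq_append:
  "map (\<lambda>j. s (i + j)) [0..<k] @ map (\<lambda>j. s (i + k + j)) [0..<m] = map (\<lambda>j. s (i + j)) [0..<k + m]"
  by (induction m) (auto simp: add.assoc)

lemma seq_shift_mod: "map (\<lambda>j. cyc_seq c (i mod n + j)) [0..<k] = map (\<lambda>j. cyc_seq c (i + j)) [0..<k]"
  by (simp add: cyc_seq_def mod_add_left_eq)

lemma word_cov: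
  assumes "set l \<subseteq> Z.cl ` Z.P" "Z.chain i l i'" "i < n"
  shows "word (map cov l) = map (\<lambda>j. cyc_seq c (i + j)) [0..<Z.size_of l] \<and> i' = (i + Z.size_of l) mod n"
  using assms
proof (induction l arbitrary: i)
  case Nil
  then show ?case by (simp add: word_def Z.size_of_def)
next
  case (Cons b l)
  have bB: "b \<in> Z.cl ` Z.P" using Cons.prems(1) by simp
  obtain i0 k where ik: "i0 < n" "Z.pth b = arc_path n i0 k"
    "pth (cov b) = (tail Q (cyc_seq c i0), map (\<lambda>j. cyc_seq c (i0 + j)) [0..<k])"
    by (rule Z_element[OF bB])
  have i0: "i0 = i" using Cons.prems(2) ik(2) by (simp add: arc_path_def)
  have ch: "Z.chain ((i + k) mod n) l i'"
    using Cons.prems(2) ik(2) arc_path_end[OF ik(1)] i0 by simp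
  have IH: "word (map cov l) = map (\<lambda>j. cyc_seq c ((i + k) mod n + j)) [0..<Z.size_of l]
      \<and> i' = ((i + k) mod n + Z.size_of l) mod n"
    using Cons.prems n_pos ch by (intro Cons.IH) auto
  have sz: "Z.size_of (b # l) = k + Z.size_of l" using ik(2) by (simp add: Z.size_of_def arc_path_def)
  have "word (map cov (b # l)) = map (\<lambda>j. cyc_seq c (i + j)) [0..<k] @ word (map cov l)"
    using ik(3) i0 by (simp add: word_def)
  then show ?case
    using IH map_seq_append[of "cyc_seq c" i k "Z.size_of l"]
    by (simp add: seq_shift_mod sz mod_add_left_eq add.assoc)
qed

lemma cov_chain_inj:
  assumes "set l \<subseteq> Z.cl ` Z.P" "set l' \<subseteq> Z.cl ` Z.P" "Z.chain i l e" "Z.chain i l' e'"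
    and "map cov l = map cov l'"
  shows "l = l'"
  using assms
proof (induction l arbitrary: l' i)
  case Nil
  then show ?case by simp
next
  case (Cons b l)
  obtain b' l0 where l': "l' = b' # l0" using Cons.prems(5) by (cases l') auto
  have bB: "b \<in> Z.cl ` Z.P" using Cons.prems(1) by simp
  obtain i1 k1 where b: "i1 < n" "Z.pth b = arc_path n i1 k1" "b = Z.cl (arc_path n i1 k1)"
    "pth (cov b) = (tail Q (cyc_seq c i1), map (\<lambda>j. cyc_seq c (i1 + j)) [0..<k1])"
    by (rule Z_element[OF bB])
  have b'B: "b' \<in> Z.cl ` Z.P" using Cons.prems(2) l' by simp
  obtain i2 k2 where b': "i2 < n" "Z.pth b' = arc_path n i2 k2" "b' = Z.cl (arc_path n i2 k2)"
    "pth (cov b') = (tail Q (cyc_seq c i2), map (\<lambda>j. cyc_seq c (i2 + j)) [0..<k2])"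
    by (rule Z_element[OF b'B])
  have "i1 = i" "i2 = i" using Cons.prems(3,4) l' b(2) b'(2) by (auto simp: arc_path_def)
  moreover have "k1 = k2"
    using Cons.prems(5) l' b(4) b'(4) by (metis (no_types, lifting) diff_zero length_map length_upt list.inject list.map(2) snd_conv)
  ultimately have bb: "b = b'" using b(3) b'(3) by simp
  moreover have "l = l0"
    using Cons.prems l' bb by (intro Cons.IH[of l0 "path_end (basic_cycle n) (Z.pth b)"]) auto
  ultimately show ?case using l' by simp
qed

text \<open>
  Once the vertex above the starting point is chosen, the entries lift one after the other, each from
  the end point of the previous lift.
\<close>
lemma cov_chain_lift:
  assumes "set l \<subseteq> cl ` P" "chain (tail Q (cyc_seq c i)) l v" "i < n"
    and "word l = map (\<lambda>j. cyc_seq c (i + j)) [0..<size_of l]"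
  shows "\<exists>l'. set l' \<subseteq> Z.cl ` Z.P \<and> Z.chain i l' ((i + size_of l) mod n) \<and> map cov l' = l"
  using assms
proof (induction l arbitrary: i)
  case Nil
  then show ?case by (intro exI[of _ "[]"]) (simp add: size_of_def)
next
  case (Cons a l)
  obtain w where w: "a = cl w" "w \<in> P" using Cons.prems(1) by auto
  define k where "k = length (snd w)"
  have sz: "size_of (a # l) = k + size_of l" using w by (simp add: size_of_def k_def)
  have "snd w @ word l = map (\<lambda>j. cyc_seq c (i + j)) [0..<k] @ map (\<lambda>j. cyc_seq c (i + k + j)) [0..<size_of l]"
    using Cons.prems(4) w unfolding sz map_seq_append by (simp add: word_def)
  then have sw: "snd w = map (\<lambda>j. cyc_seq c (i + j)) [0..<k]"
    and wl: "word l = map (\<lambda>j. cyc_seq c (i + k + j)) [0..<size_of l]"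
    by (simp_all add: k_def)
  define z where "z = arc_path n i k"
  have zw: "cycle_image Q c z = w"
    using image_arc_path[OF Cons.prems(3)] sw Cons.prems(2) w by (simp add: z_def prod_eq_iff)
  have z: "z \<in> Z.P" using zw w basic_cycle_paths[OF n_pos] Cons.prems(3) by (auto simp: ZP_iff z_def)
  have "path_end Q w = tail Q (cyc_seq c ((i + k) mod n))"
    using image_path(2)[of z] z zw arc_path_end[OF Cons.prems(3), of k] by (simp add: ZP_iff z_def cyc_seq_def)
  then have "chain (tail Q (cyc_seq c ((i + k) mod n))) l v" using Cons.prems(2) w by simp
  moreover have "(i + k) mod n < n" using n_pos by simp
  moreover have "word l = map (\<lambda>j. cyc_seq c ((i + k) mod n + j)) [0..<size_of l]"
    using wl by (simp add: seq_shift_mod)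
  ultimately obtain l' where l': "set l' \<subseteq> Z.cl ` Z.P"
    "Z.chain ((i + k) mod n) l' (((i + k) mod n + size_of l) mod n)" "map cov l' = l"
    using Cons.IH[of "(i + k) mod n"] Cons.prems(1) by auto
  show ?case
  proof (intro exI[of _ "Z.cl z # l'"] conjI)
    show "set (Z.cl z # l') \<subseteq> Z.cl ` Z.P" using z l' by simp
    show "map cov (Z.cl z # l') = a # l" using z zw w l' by (simp add: cov_cl)
    have "fst z = i" by (simp add: z_def arc_path_def)
    moreover have "path_end (basic_cycle n) z = (i + k) mod n"
      unfolding z_def by (rule arc_path_end[OF Cons.prems(3)])
    ultimately show "Z.chain i (Z.cl z # l') ((i + size_of (a # l)) mod n)"
      using l'(2) z sz by (simp add: mod_add_left_eq add.assoc)
  qed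
qed

text \<open>
  A closed path in the basic cycle runs around it a whole number of times.
\<close>
lemma Pos_phase:
  assumes "l \<in> Z.G \<inter> Z.Pos"
  obtains i where "i < n" "Z.chain i l i" "n dvd Z.size_of l" "0 < Z.size_of l"
    "\<And>j. cyc_seq (word (map cov l)) j = cyc_seq c (i + j)"
proof -
  obtain i where i: "Z.chain i l i" "l \<noteq> []" "set l \<subseteq> Z.cl ` Z.P" "0 < Z.size_of l"
    using assms by (auto simp: Z.Pos_def Z.cyc_def Z.G_def)
  then have "i \<in> verts (basic_cycle n)" using Z.ends_V0 by (cases l) auto
  then have "i < n" by (simp add: basic_cycle_def)
  have w: "word (map cov l) = map (\<lambda>j. cyc_seq c (i + j)) [0..<Z.size_of l]" "i = (i + Z.size_of l) mod n"
    using word_cov[OF i(3,1) \<open>i < n\<close>] by auto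
  have "(i + Z.size_of l) mod n = (i + 0) mod n" using w(2) \<open>i < n\<close> by simp
  then have d: "n dvd Z.size_of l" by (metis add_0_right add_diff_cancel_left' mod_eq_dvd_iff_nat le_add1)
  have "cyc_seq (word (map cov l)) j = cyc_seq c (i + j)" for j
  proof -
    have "cyc_seq (word (map cov l)) j = cyc_seq c (i + j mod Z.size_of l)"
      using i(4) by (simp add: w(1) cyc_seq_def)
    also have "\<dots> = cyc_seq c (i + j)"
    proof -
      have "(i + j mod Z.size_of l) mod n = (i + j) mod n"
        using d by (metis mod_add_right_eq mod_mod_cancel)
      then show ?thesis by (simp add: cyc_seq_def)
    qed
    finally show ?thesis .
  qed
  then show thesis using that \<open>i < n\<close> i d by blast
qed

lemma cov_inj:
  assumes "proper_cycle Q c"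
  shows "inj_on (map cov) (Z.G \<inter> Z.Pos)"
proof (rule inj_onI)
  fix l l' assume l: "l \<in> Z.G \<inter> Z.Pos" "l' \<in> Z.G \<inter> Z.Pos" and eq: "map cov l = map cov l'"
  obtain i where i: "i < n" "Z.chain i l i" "\<And>j. cyc_seq (word (map cov l)) j = cyc_seq c (i + j)"
    using Pos_phase[OF l(1)] by metis
  obtain i' where i': "i' < n" "Z.chain i' l' i'" "\<And>j. cyc_seq (word (map cov l')) j = cyc_seq c (i' + j)"
    using Pos_phase[OF l(2)] by metis
  have "i = i'"
  proof (rule proper_phase_unique[OF assms i(1) i'(1)])
    show "cyc_seq c (i + j) = cyc_seq c (i' + j)" for j using i(3)[of j] i'(3)[of j] eq by simp
  qed
  then show "l = l'" using cov_chain_inj[of l l' i i i] l i(2) i'(2) eq by (auto simp: Z.G_def)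
qed

end

section \<open>The decomposition\<close>

context cycle_cover
begin

text \<open>
  The complex of the cycle algebra, under names that can be used for varying \<open>c\<close>.
\<close>
definition ZPos :: "((nat, nat) path \<Rightarrow>\<^sub>0 'k) set list set" where
  "ZPos = Z.G \<inter> Z.Pos"

definition Zd_in :: "(nat \<Rightarrow> nat \<Rightarrow> ('k \<times> gen) list) \<Rightarrow> nat \<Rightarrow> (((nat, nat) path \<Rightarrow>\<^sub>0 'k) set list \<Rightarrow>\<^sub>0 'k)
    \<Rightarrow> (((nat, nat) path \<Rightarrow>\<^sub>0 'k) set list \<Rightarrow>\<^sub>0 'k)" where
  "Zd_in = Z.d_in"

definition ZdB :: "(nat \<Rightarrow> ('k \<times> gen) list) \<Rightarrow> (((nat, nat) path \<Rightarrow>\<^sub>0 'k) set list \<Rightarrow>\<^sub>0 'k)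
    \<Rightarrow> (((nat, nat) path \<Rightarrow>\<^sub>0 'k) set list \<Rightarrow>\<^sub>0 'k)" where
  "ZdB = Z.dB"

definition Zproj :: "(((nat, nat) path \<Rightarrow>\<^sub>0 'k) set list \<Rightarrow>\<^sub>0 'k) \<Rightarrow> (((nat, nat) path \<Rightarrow>\<^sub>0 'k) set list \<Rightarrow>\<^sub>0 'k)" where
  "Zproj x = restr Z.Pos (Z.Phi x)"

definition Zcomputes where
  "Zcomputes L ops n' W \<longleftrightarrow> computes (Z.Cyc L ops n') W (ZPos \<inter> {l. length l \<in> L n'})
     (ZPos \<inter> {l. length l \<in> L (Suc n')}) (Zd_in ops n') (ZdB (ops (Suc n'))) Zproj"

lemma Zcomputes_boundaries:
  "chain_ops L ops \<Longrightarrow> Z.acyclic L ops n' Z.Non \<Longrightarrow> Z.acyclic L ops n' Z.Triv \<Longrightarrow>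
    Zcomputes L ops n' (Z.Bdr L ops n')"
  using Z.computes_boundaries[of L ops n']
  by (simp add: Zcomputes_def ZPos_def Zd_in_def ZdB_def Zproj_def[abs_def])

lemma Zcomputes_coker:
  "chain_ops L ops \<Longrightarrow> Z.acyclic L ops n' Z.Non \<Longrightarrow>
    Zcomputes L ops n' {x + y | x y. x \<in> Z.Bdr L ops n'
      \<and> y \<in> cycles (Z.QA\<lparr>carrier := vertex_subalgebra (basic_cycle n) Z.I\<rparr>) L (\<lambda>n. op_of Z.QA (ops n)) n'}"
  using Z.computes_coker[of L ops n']
  by (simp add: Zcomputes_def ZPos_def Zd_in_def ZdB_def Zproj_def[abs_def])

lemma klin_Zd: "klin (Zd_in ops n')" "klin (ZdB ops')"
  by (simp_all add: Zd_in_def ZdB_def Z.klin_d_in)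

lemma cov_ZPos: "map cov ` ZPos \<subseteq> G \<inter> Pos"
  using cov_Pos by (auto simp: ZPos_def)

lemma cov_ZPos_inj: "proper_cycle Q c \<Longrightarrow> inj_on (map cov) ZPos"
  unfolding ZPos_def by (rule cov_inj)

lemma ZPos_sequence:
  assumes "l \<in> ZPos"
  shows "\<exists>i. \<forall>j. cyc_seq (word (map cov l)) j = cyc_seq c (i + j)"
  using Pos_phase[of l] assms unfolding ZPos_def by metis

lemma ZdB_keys:
  assumes "ops_map ops L L'" "keys y \<subseteq> ZPos \<inter> {l. length l \<in> L}"
  shows "keys (ZdB ops y) \<subseteq> ZPos"
  using Z.dB_keys_stable[OF Z.stable_classes(3) assms(1), of y] assms(2) by (auto simp: ZPos_def ZdB_def)

lemma dB_push_ZdB: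
  "ops_map ops L L' \<Longrightarrow> keys y \<subseteq> ZPos \<inter> {l. length l \<in> L} \<Longrightarrow>
    dB ops (push (map cov) y) = push (map cov) (ZdB ops y)"
  unfolding ZPos_def ZdB_def by (rule dB_push)

lemma Zd_in_dB: "Zd_in ops n' y = (if n' = 0 then 0 else ZdB (ops n') y)"
  by (simp add: Zd_in_def Z.d_in_def ZdB_def)

text \<open>
  A list whose word is a rotated power of \<open>c\<close> lifts; the lift closes up because the length of
  \<open>c\<close> divides that of the word.
\<close>
lemma cov_surj:
  assumes l: "l \<in> G \<inter> Pos" and i: "i < n" and d: "n dvd size_of l"
    and eq: "\<And>j. cyc_seq (word l) j = cyc_seq c (i + j)"
  shows "l \<in> map cov ` ZPos"
proof -
  obtain u where u: "chain u l u" "l \<noteq> []" "set l \<subseteq> cl ` P" "size_of l \<noteq> 0"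
    using l by (auto simp: Pos_def cyc_def G_def)
  have wl: "word l = map (\<lambda>j. cyc_seq c (i + j)) [0..<size_of l]"
  proof (rule nth_equalityI)
    fix j assume j: "j < length (word l)"
    then show "word l ! j = map (\<lambda>j. cyc_seq c (i + j)) [0..<size_of l] ! j"
      using eq[of j] by (simp add: length_word) (simp add: cyc_seq_def length_word)
  qed (simp add: length_word)
  have "u = tail Q (cyc_seq c i)"
  proof -
    have "u \<in> verts Q" using u ends_V0 by (cases l) auto
    then have "awalk u (word l) u" by (rule awalk_word[OF u(3,1)])
    moreover have "word l = cyc_seq c i # tl (word l)"
      using wl u(4) by (simp add: upt_conv_Cons)
    ultimately have "awalk u (cyc_seq c i # tl (word l)) u" by simp
    then show ?thesis by (simp add: awalk_Cons_iff)
  qed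
  then obtain l' where l': "set l' \<subseteq> Z.cl ` Z.P" "Z.chain i l' ((i + size_of l) mod n)" "map cov l' = l"
    using cov_chain_lift[OF u(3) _ i wl] u(1) by blast
  have "(i + size_of l) mod n = i" using d i by (auto simp: dvd_def)
  then have "Z.cyc l'" using l' u(2) by (auto simp: Z.cyc_def)
  moreover have "l' \<in> Z.G" using l'(1) by (simp add: Z.G_def)
  moreover have "Z.size_of l' = size_of l" using cov_size[OF \<open>l' \<in> Z.G\<close>] l'(3) by simp
  ultimately have "l' \<in> ZPos" using u(4) by (simp add: ZPos_def Z.Pos_def)
  then show ?thesis using l'(3) by blast
qed

end

context monomial_quotient
begin

lemma cycle_coverI: "quiver_cycle Q c \<Longrightarrow> cycle_cover Q N c"
  by unfold_locales

text \<open>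
  The cyclically composable lists of positive length are partitioned according to the proper cycle of
  which their word is a rotated power, and the lists belonging to \<open>c\<close> are the images of those of
  the cycle algebra of \<open>c\<close>.
\<close>
lemma decompose:
  fixes T :: "'e list set" and W' :: "'e list \<Rightarrow> (((nat, nat) path \<Rightarrow>\<^sub>0 'k) set list \<Rightarrow>\<^sub>0 'k) set"
  assumes T: "proper_cycle_reps Q T" and L: "chain_ops L ops"
    and W: "computes (Cyc L ops n) W (G \<inter> Pos \<inter> {l. length l \<in> L n}) (G \<inter> Pos \<inter> {l. length l \<in> L (Suc n)})
      (d_in ops n) (dB (ops (Suc n))) (\<lambda>x. restr Pos (Phi x))"
    and W': "\<And>c. c \<in> T \<Longrightarrow> cycle_cover.Zcomputes Q N c L ops n (W' c)"
  shows "quot_module (pm_space (Cyc L ops n)) W \<cong>\<^sub>k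
    direct_sum T (\<lambda>c. quot_module (pm_space (cycles (cycle_algebra Q I c) L (\<lambda>n. op_of (cycle_algebra Q I c) (ops n)) n)) (W' c))"
proof -
  have proper: "proper_cycle Q c" if "c \<in> T" for c using T that by (auto simp: proper_cycle_reps_def)
  have cover: "cycle_cover Q N c" if "c \<in> T" for c
    using proper[OF that] by (intro cycle_coverI) (simp add: proper_cycle_def)
  let ?\<sigma> = "\<lambda>c. map (cycle_cover.cov Q N c) :: _ \<Rightarrow> (('v, 'e) path \<Rightarrow>\<^sub>0 'k) set list"
  let ?P = "\<lambda>c. cycle_cover.ZPos Q N c"
  have o: "ops_map (ops (Suc n)) (L (Suc n)) (L n)" for n using L by (simp add: chain_ops_def)
  have union: "G \<inter> Pos \<subseteq> (\<Union>c\<in>T. ?\<sigma> c ` ?P c)"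
  proof
    fix l assume l: "l \<in> G \<inter> Pos"
    obtain c i where c: "c \<in> T" "i < length c" "length c dvd length (word l)"
      "\<And>j. cyc_seq (word l) j = cyc_seq c (i + j)"
      using cycle_has_proper_root[OF T word_cycle[OF l]] by blast
    interpret C: cycle_cover Q N ty c by (rule cover[OF c(1)])
    have "l \<in> ?\<sigma> c ` ?P c" using C.cov_surj[OF l c(2) _ c(4)] c(3) by (simp add: length_word)
    then show "l \<in> (\<Union>c\<in>T. ?\<sigma> c ` ?P c)" using c(1) by blast
  qed
  show ?thesis
  proof (rule computes_iso[OF W, where \<sigma> = ?\<sigma> and P = ?P])
    fix c assume c: "c \<in> T"
    interpret C: cycle_cover Q N ty c by (rule cover[OF c])
    show "computes (cycles (cycle_algebra Q I c) L (\<lambda>n. op_of (cycle_algebra Q I c) (ops n)) n) (W' c)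
        (?P c \<inter> {l. length l \<in> L n}) (?P c \<inter> {l. length l \<in> L (Suc n)})
        (cycle_cover.Zd_in Q N c ops n) (cycle_cover.ZdB Q N c (ops (Suc n))) (cycle_cover.Zproj Q N c)"
      using W'[OF c] unfolding C.Zcomputes_def C.cycle_algebra_eq .
    show "inj_on (?\<sigma> c) (?P c)" by (rule C.cov_ZPos_inj[OF proper[OF c]])
    show "?P c \<inter> {l. length l \<in> L n} = {l \<in> ?P c. ?\<sigma> c l \<in> G \<inter> Pos \<inter> {l. length l \<in> L n}}"
      "?P c \<inter> {l. length l \<in> L (Suc n)} = {l \<in> ?P c. ?\<sigma> c l \<in> G \<inter> Pos \<inter> {l. length l \<in> L (Suc n)}}"
      using C.cov_ZPos by auto
    show "klin (cycle_cover.Zd_in Q N c ops n :: _ \<Rightarrow> _ \<Rightarrow>\<^sub>0 'k)"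
      "klin (cycle_cover.ZdB Q N c (ops (Suc n)) :: _ \<Rightarrow> _ \<Rightarrow>\<^sub>0 'k)"
      by (rule C.klin_Zd)+
    fix y
    show "keys (cycle_cover.ZdB Q N c (ops (Suc n)) y) \<subseteq> ?P c"
      "dB (ops (Suc n)) (push (?\<sigma> c) y) = push (?\<sigma> c) (cycle_cover.ZdB Q N c (ops (Suc n)) y)"
      if "keys y \<subseteq> ?P c \<inter> {l. length l \<in> L (Suc n)}"
      using C.ZdB_keys[OF o that] C.dB_push_ZdB[OF o that] by auto
    show "keys (cycle_cover.Zd_in Q N c ops n y) \<subseteq> ?P c"
      "d_in ops n (push (?\<sigma> c) y) = push (?\<sigma> c) (cycle_cover.Zd_in Q N c ops n y)"
      if "keys y \<subseteq> ?P c \<inter> {l. length l \<in> L n}"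
      using C.ZdB_keys[OF o, of y "n - 1"] C.dB_push_ZdB[OF o, of y "n - 1"] that
      by (cases n; auto simp: C.Zd_in_dB d_in_def klin_zero)+
    fix c' assume c': "c' \<in> T" and neq: "c \<noteq> c'"
    interpret C': cycle_cover Q N ty c' by (rule cover[OF c'])
    show "?\<sigma> c ` ?P c \<inter> ?\<sigma> c' ` ?P c' = {}"
    proof (rule ccontr)
      assume "?\<sigma> c ` ?P c \<inter> ?\<sigma> c' ` ?P c' \<noteq> {}"
      then obtain l l' where l: "l \<in> ?P c" "l' \<in> ?P c'" "?\<sigma> c l = ?\<sigma> c' l'" by auto
      obtain i i' where "\<And>j. cyc_seq (word (?\<sigma> c l)) j = cyc_seq c (i + j)"
        "\<And>j. cyc_seq (word (?\<sigma> c' l')) j = cyc_seq c' (i' + j)"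
        using C.ZPos_sequence[OF l(1)] C'.ZPos_sequence[OF l(2)] by blast
      then have "\<And>j. cyc_seq c (i + j) = cyc_seq c' (i' + j)" using l(3) by metis
      then obtain k where "c' = rotate k c"
        using proper_common_sequence[OF proper[OF c] proper[OF c']] by blast
      moreover have "c = rotate 0 c" by simp
      ultimately show False
        using T proper[OF c] c c' neq unfolding proper_cycle_reps_def by metis
    qed
  next
    show "klin (d_in ops n)" "klin (dB (ops (Suc n)))" by (simp_all add: klin_d_in)
  next
    show "G \<inter> Pos \<inter> {l. length l \<in> L n} \<subseteq> (\<Union>c\<in>T. ?\<sigma> c ` ?P c)"
      "G \<inter> Pos \<inter> {l. length l \<in> L (Suc n)} \<subseteq> (\<Union>c\<in>T. ?\<sigma> c ` ?P c)"
      using union by auto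
  qed
qed

end

lemma cycles_cyc_D:
  "cycles A (\<lambda>n. {1..n + 1}) (cyc_D A') n = cycles A (\<lambda>n. {1..n + 1}) (\<lambda>n. op_of A' (cyc_ops n)) n"
proof -
  have "cyc_D A' n x = op_of A' (cyc_ops n) x" if "x \<in> free_chains A {1..n + 1}" for x
    by (rule cyc_D_eq) (use that in \<open>auto simp: free_chains_def\<close>)
  then show ?thesis unfolding cycles_def by auto
qed

lemma boundaries_cyc_D:
  "boundaries A (\<lambda>n. {1..n + 1}) (cyc_D A) n = boundaries A (\<lambda>n. {1..n + 1}) (\<lambda>n. op_of A (cyc_ops n)) n"
proof -
  have "cyc_D A (n + 1) x = op_of A (cyc_ops (n + 1)) x" if "x \<in> free_chains A {1..n + 1 + 1}" for x
    by (rule cyc_D_eq) (use that in \<open>auto simp: free_chains_def\<close>)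
  then show ?thesis unfolding boundaries_def by (metis (no_types, lifting))
qed

theorem mainTheorem3:
  fixes Q :: "('v, 'e) pre_digraph"
    and I :: "(('v, 'e) path \<Rightarrow>\<^sub>0 'k::field) set"
    and T :: "'e list set"
    and n :: nat
  assumes "fin_digraph Q"
    and "monomial_ideal Q I"
    and "proper_cycle_reps Q T"
  shows "(n \<ge> 1 \<longrightarrow>
            HH n (quiver_algebra Q I) \<cong>\<^sub>k direct_sum T (\<lambda>c. HH n (cycle_algebra Q I c)))
       \<and> (odd n \<longrightarrow>
            HC n (quiver_algebra Q I) \<cong>\<^sub>k direct_sum T (\<lambda>c. HC n (cycle_algebra Q I c)))
       \<and> HH_coker n (quiver_algebra Q I) (vertex_subalgebra Q I)
           \<cong>\<^sub>k direct_sum T (\<lambda>c. HH_coker n (cycle_algebra Q I c) (cycle_vertices Q I c))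
       \<and> HC_coker n (quiver_algebra Q I) (vertex_subalgebra Q I)
           \<cong>\<^sub>k direct_sum T (\<lambda>c. HC_coker n (cycle_algebra Q I c) (cycle_vertices Q I c))"
proof -
  interpret fin_digraph Q by (rule assms(1))
  obtain S where S: "S \<subseteq> {w \<in> quiver_paths Q. length (snd w) \<ge> 2}"
    "I = Idl\<^bsub>path_algebra Q\<^esub> ((\<lambda>w. single w 1) ` S)"
    using assms(2) by (auto simp: monomial_ideal_def)
  have SP: "S \<subseteq> quiver_paths Q" using S(1) by auto
  define N where "N = path_closure S"
  have triv: "(v, []) \<notin> N" for v
  proof
    assume "(v, []) \<in> N"
    then obtain u s w where "(v, []) = path_cat (path_cat u s) w" "s \<in> S" by (auto simp: N_def path_closure_def)
    then show False using S(1) by (auto simp: path_cat_def)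
  qed
  interpret A: monomial_quotient Q N "TYPE('k)"
    by unfold_locales (use path_closed_closure[OF SP] triv in \<open>auto simp: N_def\<close>)
  have "I = {x. keys x \<subseteq> N}" unfolding S(2) genideal_paths[OF SP] N_def ..
  then have I: "I = A.I" by (simp only: A.I_def)
  have cover: "cycle_cover Q N c" if "c \<in> T" for c
    using assms(3) that by (intro A.cycle_coverI) (auto simp: proper_cycle_reps_def proper_cycle_def)
  note dec = A.decompose[OF assms(3)]
  have HH: "HH n A' = quot_module (pm_space (cycles A' (\<lambda>n. {n + 1}) (\<lambda>n. op_of A' hoch_ops) n))
      (boundaries A' (\<lambda>n. {n + 1}) (\<lambda>n. op_of A' hoch_ops) n)" for A' :: "('k, 'x) module"
    by (simp add: HH_def homology_def hoch_b_eq)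
  have HC: "HC n A' = quot_module (pm_space (cycles A' (\<lambda>n. {1..n + 1}) (\<lambda>n. op_of A' (cyc_ops n)) n))
      (boundaries A' (\<lambda>n. {1..n + 1}) (\<lambda>n. op_of A' (cyc_ops n)) n)" for A' :: "('k, 'x) module"
    by (simp only: HC_def homology_def cycles_cyc_D boundaries_cyc_D)
  have HHc: "HH_coker n A' E = quot_module (pm_space (cycles A' (\<lambda>n. {n + 1}) (\<lambda>n. op_of A' hoch_ops) n))
      {x + y | x y. x \<in> boundaries A' (\<lambda>n. {n + 1}) (\<lambda>n. op_of A' hoch_ops) n
        \<and> y \<in> cycles (A'\<lparr>carrier := E\<rparr>) (\<lambda>n. {n + 1}) (\<lambda>n. op_of A' hoch_ops) n}" for A' :: "('k, 'x) module" and E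
    by (simp add: HH_coker_def homology_coker_def hoch_b_eq)
  have HCc: "HC_coker n A' E = quot_module (pm_space (cycles A' (\<lambda>n. {1..n + 1}) (\<lambda>n. op_of A' (cyc_ops n)) n))
      {x + y | x y. x \<in> boundaries A' (\<lambda>n. {1..n + 1}) (\<lambda>n. op_of A' (cyc_ops n)) n
        \<and> y \<in> cycles (A'\<lparr>carrier := E\<rparr>) (\<lambda>n. {1..n + 1}) (\<lambda>n. op_of A' (cyc_ops n)) n}" for A' :: "('k, 'x) module" and E
    by (simp only: HC_coker_def homology_coker_def cycles_cyc_D boundaries_cyc_D)
  show ?thesis
  proof (intro conjI impI)
    assume n: "n \<ge> 1"
    show "HH n (quiver_algebra Q I) \<cong>\<^sub>k direct_sum T (\<lambda>c. HH n (cycle_algebra Q I c))"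
      unfolding HH I
    proof (rule dec[OF chain_ops_hoch])
      fix c assume "c \<in> T"
      interpret C: cycle_cover Q N "TYPE('k)" c by (rule cover[OF \<open>c \<in> T\<close>])
      show "C.Zcomputes (\<lambda>n. {n + 1}) (\<lambda>_. hoch_ops) n (boundaries (cycle_algebra Q A.I c) (\<lambda>n. {n + 1}) (\<lambda>n. op_of (cycle_algebra Q A.I c) hoch_ops) n)"
        unfolding C.cycle_algebra_eq using n
        by (intro C.Zcomputes_boundaries chain_ops_hoch C.Z.acyclic_hoch)
    qed (intro A.computes_boundaries chain_ops_hoch A.acyclic_hoch n)
  next
    assume n: "odd n"
    show "HC n (quiver_algebra Q I) \<cong>\<^sub>k direct_sum T (\<lambda>c. HC n (cycle_algebra Q I c))"
      unfolding HC I
    proof (rule dec[OF chain_ops_cyc])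
      fix c assume "c \<in> T"
      interpret C: cycle_cover Q N "TYPE('k)" c by (rule cover[OF \<open>c \<in> T\<close>])
      show "C.Zcomputes (\<lambda>n. {1..n + 1}) cyc_ops n (boundaries (cycle_algebra Q A.I c) (\<lambda>n. {1..n + 1}) (\<lambda>n. op_of (cycle_algebra Q A.I c) (cyc_ops n)) n)"
        unfolding C.cycle_algebra_eq using n
        by (intro C.Zcomputes_boundaries chain_ops_cyc C.Z.acyclic_cyc)
    qed (intro A.computes_boundaries chain_ops_cyc A.acyclic_cyc n)
  next
    show "HH_coker n (quiver_algebra Q I) (vertex_subalgebra Q I)
      \<cong>\<^sub>k direct_sum T (\<lambda>c. HH_coker n (cycle_algebra Q I c) (cycle_vertices Q I c))"
      unfolding HHc I
    proof (rule dec[OF chain_ops_hoch])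
      fix c assume "c \<in> T"
      interpret C: cycle_cover Q N "TYPE('k)" c by (rule cover[OF \<open>c \<in> T\<close>])
      show "C.Zcomputes (\<lambda>n. {n + 1}) (\<lambda>_. hoch_ops) n {x + y | x y.
          x \<in> boundaries (cycle_algebra Q A.I c) (\<lambda>n. {n + 1}) (\<lambda>n. op_of (cycle_algebra Q A.I c) hoch_ops) n
        \<and> y \<in> cycles (cycle_algebra Q A.I c\<lparr>carrier := cycle_vertices Q A.I c\<rparr>) (\<lambda>n. {n + 1}) (\<lambda>n. op_of (cycle_algebra Q A.I c) hoch_ops) n}"
        unfolding C.cycle_algebra_eq C.cycle_vertices_eq
        by (intro C.Zcomputes_coker chain_ops_hoch C.Z.acyclic_hoch)
    qed (intro A.computes_coker chain_ops_hoch A.acyclic_hoch)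
  next
    show "HC_coker n (quiver_algebra Q I) (vertex_subalgebra Q I)
      \<cong>\<^sub>k direct_sum T (\<lambda>c. HC_coker n (cycle_algebra Q I c) (cycle_vertices Q I c))"
      unfolding HCc I
    proof (rule dec[OF chain_ops_cyc])
      fix c assume "c \<in> T"
      interpret C: cycle_cover Q N "TYPE('k)" c by (rule cover[OF \<open>c \<in> T\<close>])
      show "C.Zcomputes (\<lambda>n. {1..n + 1}) cyc_ops n {x + y | x y.
          x \<in> boundaries (cycle_algebra Q A.I c) (\<lambda>n. {1..n + 1}) (\<lambda>n. op_of (cycle_algebra Q A.I c) (cyc_ops n)) n
        \<and> y \<in> cycles (cycle_algebra Q A.I c\<lparr>carrier := cycle_vertices Q A.I c\<rparr>) (\<lambda>n. {1..n + 1}) (\<lambda>n. op_of (cycle_algebra Q A.I c) (cyc_ops n)) n}"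
        unfolding C.cycle_algebra_eq C.cycle_vertices_eq
        by (intro C.Zcomputes_coker chain_ops_cyc C.Z.acyclic_cyc)
    qed (intro A.computes_coker chain_ops_cyc A.acyclic_cyc)
  qed
qed

end
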